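(* Assume that $r\le4$ and $\bar K=K$. Let $f\in\mathcal{R}_d$, $d\ge3$, satisfy $\mathrm{ann}_R(f)_1=0$. Then for some $n\ge1$ there exists $f_t\in\mathcal{R}_d[t_1,\dots,t_n]$ such that $f_0=f$ (where $f_0$ is the value of $f_t$ at $t_1=\dots=t_n=0$) and $f_t$ splits regularly $\dim_KM_f-1$ times over $K(t_1,\dots,t_n)$.
   Context: $K$ is a field, $r\ge 1$, $R=K[\partial_1,\dots,\partial_r]$ is a polynomial ring with the standard grading, and $\mathcal{R}=K[x_1,\dots,x_r]^{DP}=\bigoplus_{d\ge0}\mathcal{R}_d$ is the divided power ring: $\mathcal{R}_d$ has $K$-basis $x^{(\alpha)}=\prod_i x_i^{(\alpha_i)}$, $|\alpha|=d$, with multiplication generated by $x_i^{(a)}x_i^{(b)}=\binom{a+b}{a}x_i^{(a+b)}$. $R$ acts on $\mathcal{R}$ by $\partial^\beta(x^{(\alpha)})=x^{(\alpha-\beta)}$ (zero if some $\alpha_i<\beta_i$). $\mathrm{ann}_R(f)=\{D\in R:Df=0\}$, with degree $e$ part $\mathrm{ann}_R(f)_e$; $R_e(f)=\{Df:D\in R_e\}$; $\partial=[\partial_1,\dots,\partial_r]^T$; and $$M_f=\{A\in\mathrm{Mat}_K(r,r):I_2(\partial\;A\partial)\subseteq\mathrm{ann}_R(f)\},$$ where $I_2(\partial\;A\partial)$ is the ideal of $R$ generated by the $2\times2$ minors of the $r\times2$ matrix with columns $\partial$ and $A\partial$. $\mathcal{R}_d[t_1,\dots,t_n]=\mathcal{R}_d\otimes_KK[t_1,\dots,t_n]$,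 regarded inside the degree $d$ forms of the divided power ring over $K(t_1,\dots,t_n)$. A form $f$ of degree $d$ (over any field) splits regularly $m$ times if $f=g_1+\dots+g_{m+1}$ with nonzero forms $g_i$ of degree $d$ such that $R_{d-1}(g_i)\cap\sum_{j\ne i}R_{d-1}(g_j)=0$ for all $i$; over $K(t_1,\dots,t_n)$, $R$ is replaced by $R\otimes_KK(t_1,\dots,t_n)$. *)

theory Defs
  imports
    "HOL-Analysis.Cartesian_Space"
    "HOL-Computational_Algebra.Polynomial_Factorial"
    "HOL-Library.Poly_Mapping"
    "HOL-Library.Set_Algebras"
begin

section \<open>Polynomials, divided powers and contraction\<close>

text \<open>
  The variables are indexed by a finite type \<open>'r\<close>, so \<open>r\<close> is \<open>CARD('r)\<close>.  An exponent
  (multi-index) is an element of \<open>'r \<Rightarrow>\<^sub>0 nat\<close>.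

  The polynomial ring \<open>R = K[\<partial>\<^sub>i]\<close> is \<open>('r \<Rightarrow>\<^sub>0 nat) \<Rightarrow>\<^sub>0 'k\<close> with the multiplication of
  \<^theory>\<open>HOL-Library.Poly_Mapping\<close>.

  The divided power ring has the same underlying vector space, the basis element
  \<open>Poly_Mapping.single \<alpha> 1\<close> now standing for \<open>x\<close> to the divided power \<open>\<alpha>\<close>.  Nothing below
  multiplies two elements of the divided power ring; the product of
  \<^theory>\<open>HOL-Library.Poly_Mapping\<close> must not be applied to them.
\<close>

type_synonym 'r exponent = "'r \<Rightarrow>\<^sub>0 nat"
type_synonym ('k, 'r) diffop = "'r exponent \<Rightarrow>\<^sub>0 'k"
type_synonym ('k, 'r) dpower = "'r exponent \<Rightarrow>\<^sub>0 'k"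

definition total_degree :: "'r::finite exponent \<Rightarrow> nat" where
  "total_degree \<alpha> = (\<Sum>i\<in>UNIV. Poly_Mapping.lookup \<alpha> i)"

text \<open>Homogeneous elements (zero included) of degree \<open>d\<close>, used both for \<open>R\<close> and for the
  divided power ring.\<close>

definition homogeneous :: "nat \<Rightarrow> ('r::finite exponent \<Rightarrow>\<^sub>0 'k::zero) set" where
  "homogeneous d = {p. \<forall>\<alpha>\<in>Poly_Mapping.keys p. total_degree \<alpha> = d}"

text \<open>The action of \<open>R\<close> on the divided power ring.  The order on exponents has to be spelled out
  componentwise: \<open>\<le>\<close> on \<open>\<Rightarrow>\<^sub>0\<close> is lexicographic.\<close>

definition contract :: "('k::comm_ring_1, 'r) diffop \<Rightarrow> ('k, 'r) dpower \<Rightarrow> ('k, 'r) dpower" where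
  "contract D f =
     (\<Sum>\<beta>\<in>Poly_Mapping.keys D. \<Sum>\<alpha>\<in>Poly_Mapping.keys f.
        if \<forall>i. Poly_Mapping.lookup \<beta> i \<le> Poly_Mapping.lookup \<alpha> i
        then Poly_Mapping.single (\<alpha> - \<beta>) (Poly_Mapping.lookup D \<beta> * Poly_Mapping.lookup f \<alpha>)
        else 0)"

lemma contract_monomial:
  "contract (Poly_Mapping.single \<beta> 1) (Poly_Mapping.single \<alpha> (1::'k::comm_ring_1)) =
     (if \<forall>i. Poly_Mapping.lookup \<beta> i \<le> Poly_Mapping.lookup \<alpha> i
      then Poly_Mapping.single (\<alpha> - \<beta>) 1 else 0)"
  by (auto simp: contract_def intro!: sum.neutral split: if_splits)

definition ann :: "('k::comm_ring_1, 'r) dpower \<Rightarrow> ('k, 'r) diffop set" where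
  "ann f = {D. contract D f = 0}"


section \<open>The matrix algebra \<open>M\<^sub>f\<close>\<close>

definition del :: "('k::comm_ring_1, 'r) diffop ^ 'r" where
  "del = (\<chi> i. Poly_Mapping.single (Poly_Mapping.single i 1) 1)"

definition const_matrix :: "'k::comm_ring_1 ^ 'r ^ 'r \<Rightarrow> ('k, 'r) diffop ^ 'r ^ 'r" where
  "const_matrix A = (\<chi> i j. Poly_Mapping.single 0 (A $ i $ j))"

definition ideal_generated :: "'a::comm_ring_1 set \<Rightarrow> 'a set" where
  "ideal_generated S = module.span (*) S"

text \<open>The ideal of \<open>2 \<times> 2\<close> minors of the two-column matrix with columns \<open>u\<close> and \<open>v\<close>.\<close>

definition I2 :: "'a::comm_ring_1 ^ 'r \<Rightarrow> 'a ^ 'r \<Rightarrow> 'a set" where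
  "I2 u v = ideal_generated {u $ i * v $ j - v $ i * u $ j | i j. True}"

definition M_alg :: "('k::field, 'r::finite) dpower \<Rightarrow> ('k ^ 'r ^ 'r) set" where
  "M_alg f = {A. I2 del (const_matrix A *v del) \<subseteq> ann f}"

definition scale_matrix :: "'k::field \<Rightarrow> 'k ^ 'm ^ 'n \<Rightarrow> 'k ^ 'm ^ 'n" where
  "scale_matrix c A = (\<chi> i j. c * A $ i $ j)"

interpretation matrix: vector_space scale_matrix
  by unfold_locales (simp_all add: scale_matrix_def vec_eq_iff algebra_simps)


section \<open>Regular splitting over a subfield\<close>

text \<open>
  The ground field is a subfield \<open>F\<close> of the type \<open>'k\<close>, because \<open>K(t\<^sub>1,\<dots>,t\<^sub>n)\<close> with \<open>n\<close>
  existentially quantified cannot be a type of its own.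
\<close>

definition homogeneous_over ::
  "'k set \<Rightarrow> nat \<Rightarrow> ('r::finite exponent \<Rightarrow>\<^sub>0 'k::zero) set" where
  "homogeneous_over F d = {p \<in> homogeneous d. \<forall>\<alpha>. Poly_Mapping.lookup p \<alpha> \<in> F}"

definition derivatives_over ::
  "'k set \<Rightarrow> nat \<Rightarrow> ('k::field, 'r::finite) dpower \<Rightarrow> ('k, 'r) dpower set" where
  "derivatives_over F e f = (\<lambda>D. contract D f) ` homogeneous_over F e"

text \<open>The sum over \<open>j\<close> is the elementwise sum of sets from \<^theory>\<open>HOL-Library.Set_Algebras\<close>;
  the empty sum (case \<open>m = 0\<close>) is \<open>{0}\<close>.\<close>

definition splits_regularly_over ::
  "'k set \<Rightarrow> nat \<Rightarrow> nat \<Rightarrow> ('k::field, 'r::finite) dpower \<Rightarrow> bool" where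
  "splits_regularly_over F d m f \<longleftrightarrow>
     (\<exists>g :: nat \<Rightarrow> ('k, 'r) dpower.
        (\<forall>i\<in>{1..m+1}. g i \<in> homogeneous_over F d \<and> g i \<noteq> 0) \<and>
        f = (\<Sum>i\<in>{1..m+1}. g i) \<and>
        (\<forall>i\<in>{1..m+1}.
           derivatives_over F (d - 1) (g i) \<inter>
           (\<Sum>j\<in>{1..m+1} - {i}. derivatives_over F (d - 1) (g j)) = {0}))"


section \<open>Families with parameters \<open>t\<^sub>1,\<dots>,t\<^sub>n\<close>\<close>

text \<open>
  \<open>'k tpoly\<close> is the polynomial ring over \<open>'k\<close> in countably many parameters; \<open>tpolys n\<close> is its
  subring of polynomials in the parameters with index \<open>0,\<dots>,n-1\<close>, i.e. \<open>K[t\<^sub>1,\<dots>,t\<^sub>n]\<close>, and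
  \<open>trats n\<close> is the fraction field of \<open>tpolys n\<close>, i.e. \<open>K(t\<^sub>1,\<dots>,t\<^sub>n)\<close>.
\<close>

type_synonym 'k tpoly = "(nat \<Rightarrow>\<^sub>0 nat) \<Rightarrow>\<^sub>0 'k"

definition tpolys :: "nat \<Rightarrow> 'k::zero tpoly set" where
  "tpolys n = {p. \<forall>m\<in>Poly_Mapping.keys p. Poly_Mapping.keys m \<subseteq> {..<n}}"

definition trats :: "nat \<Rightarrow> 'k::field tpoly fract set" where
  "trats n = {to_fract p / to_fract q | p q. p \<in> tpolys n \<and> q \<in> tpolys n \<and> q \<noteq> 0}"

definition teval :: "'k::comm_ring_1 tpoly \<Rightarrow> (nat \<Rightarrow> 'k) \<Rightarrow> 'k" where
  "teval p a = (\<Sum>m\<in>Poly_Mapping.keys p. Poly_Mapping.lookup p m *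
                  (\<Prod>i\<in>Poly_Mapping.keys m. a i ^ Poly_Mapping.lookup m i))"

text \<open>The value of a family at \<open>t = a\<close>, and a family regarded as a form with coefficients in
  the field of rational functions.\<close>

definition specialize ::
  "(nat \<Rightarrow> 'k::comm_ring_1) \<Rightarrow> ('k tpoly, 'r) dpower \<Rightarrow> ('k, 'r) dpower" where
  "specialize a ft = Poly_Mapping.map (\<lambda>c. teval c a) ft"

definition generic_form :: "('k::field tpoly, 'r) dpower \<Rightarrow> ('k tpoly fract, 'r) dpower" where
  "generic_form ft = Poly_Mapping.map to_fract ft"

end

theory Submission
  imports Defs
begin

text \<open>
  Think of a form \<open>f\<close> of degree \<open>d\<close> as a symmetric \<open>d\<close>-linear function on \<open>V = K\<^sup>r\<close>, a vector
  \<open>v\<close> acting on forms by the derivative in direction \<open>v\<close>. Evaluating the minors that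
  define \<open>M\<^sub>f\<close> on \<open>f\<close> shows that the transposes of the matrices in \<open>M\<^sub>f\<close> are operators that are
  self-adjoint for \<open>f\<close>: they may be moved from one argument of \<open>f\<close> to another. Since no
  direction kills \<open>f\<close> and \<open>f\<close> has at least three arguments, two self-adjoint operators
  commute, so they form a commutative algebra \<open>Z\<close>. It is therefore enough to find a number
  \<open>n\<close> such that \<open>n\<close> elements span \<open>Z\<close> and \<open>f\<close> is the value at \<open>t = 0\<close> of a family that splits
  into \<open>n\<close> pieces over \<open>K(t)\<close>: then \<open>n\<close> is at least \<open>dim M\<^sub>f\<close>, and superfluous pieces may be
  added together. One parameter \<open>t\<close> suffices.

  A splitting is recognised by operators (\<open>splits_regularly_overI\<close>,
  \<open>deforms_into_splits\<close>). If \<open>E\<^sub>p\<close> are self-adjoint operators for a family \<open>F\<close> over \<open>K[t]\<close>, if all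
  products \<open>E\<^sub>p E\<^sub>q\<close> with \<open>p \<noteq> q\<close> kill \<open>F\<close>, and if a combination of them acts as a nonzero
  polynomial in \<open>t\<close>, then they act on \<open>F\<close> as multiples of orthogonal idempotents over \<open>K(t)\<close> and
  the images of \<open>F\<close> are the pieces. No piece vanishes as soon as no \<open>E\<^sub>p\<close> vanishes at \<open>t = 0\<close>.
  Such families for orthogonal idempotents of \<open>Z\<close> can be added
  (\<open>deforms_into_add\<close>), which leaves the primitive idempotents \<open>e\<close>
  (\<open>reduction_to_primitive\<close>). For these the algebra \<open>eZ\<close> is local, and as \<open>K\<close> is
  algebraically closed it consists of multiples of \<open>e\<close> and nilpotents.

  If \<open>eZ\<close> is generated by one nilpotent \<open>x\<close> with \<open>x\<^sup>k = 0\<close>, the relation \<open>X\<^sup>k = 0\<close> is deformed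
  into \<open>\<Prod>(X - t\<^sup>i\<^sup>+\<^sup>1) = 0\<close>, which has \<open>k\<close> distinct roots over \<open>K(t)\<close>, and the form is deformed with
  it (\<open>deforms_into_nilpotent\<close>).

  The bound \<open>r \<le> 4\<close> leaves few other local algebras. Let \<open>x\<close> be nilpotent of the largest index \<open>k\<close>,
  and split \<open>eV\<close> into a longest Jordan chain of \<open>x\<close> and an \<open>x\<close>-stable complement \<open>W\<close>.
  As \<open>W\<close> has dimension at most \<open>r - k\<close>, either \<open>eZ\<close> is generated by \<open>x\<close>, or there is a
  self-adjoint \<open>\<epsilon>\<close> with \<open>\<epsilon>\<^sup>2 = 0\<close> and rank at least two (\<open>primitive_case\<close>). The latter forces
  \<open>r = 4\<close> and \<open>e = 1\<close>, with a basis \<open>e\<^sub>0, e\<^sub>1, \<epsilon>e\<^sub>0, \<epsilon>e\<^sub>1\<close> of \<open>V\<close>, and \<open>Z\<close> is spanned by \<open>1, \<epsilon>\<close>,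
  or by \<open>1, \<epsilon>, y\<close>, or by \<open>1, y, \<epsilon>, \<epsilon>y\<close>. In the last two cases \<open>f\<close> is given by a functional on
  \<open>K[y,\<epsilon>]\<close>. Over \<open>K[t]\<close> the relation \<open>\<epsilon>\<^sup>2 = 0\<close> is replaced by \<open>\<epsilon>(\<epsilon> - t) = 0\<close>, and on one or on both
  of the branches \<open>\<epsilon> = 0\<close> and \<open>\<epsilon> = t\<close> the action of \<open>y\<close> is given two eigenvalues; this
  makes three or four pieces (\<open>frame_three\<close>, \<open>frame_four\<close>).
\<close>

section \<open>The ring of endomorphisms of a coordinate space\<close>

text \<open>
  The product of matrices has to be the multiplication of a type of class \<open>ring_1\<close>, so
  that powers and polynomial identities of operators are available; on the type of matrices
  itself the multiplication symbol denotes the componentwise product.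
\<close>

typedef ('a, 'r) endo = "UNIV :: ('a ^ 'r ^ 'r) set"
  morphisms mat_of endo_of ..

setup_lifting type_definition_endo

instantiation endo :: (comm_ring_1, finite) ring_1
begin

lift_definition zero_endo :: "('a, 'b) endo" is "0 :: 'a ^ 'b ^ 'b" .
lift_definition one_endo :: "('a, 'b) endo" is "mat 1 :: 'a ^ 'b ^ 'b" .
lift_definition plus_endo :: "('a, 'b) endo \<Rightarrow> ('a, 'b) endo \<Rightarrow> ('a, 'b) endo" is
  "\<lambda>A B :: 'a ^ 'b ^ 'b. A + B" .
lift_definition minus_endo :: "('a, 'b) endo \<Rightarrow> ('a, 'b) endo \<Rightarrow> ('a, 'b) endo" is
  "\<lambda>A B :: 'a ^ 'b ^ 'b. A - B" .
lift_definition uminus_endo :: "('a, 'b) endo \<Rightarrow> ('a, 'b) endo" is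
  "\<lambda>A :: 'a ^ 'b ^ 'b. - A" .
lift_definition times_endo :: "('a, 'b) endo \<Rightarrow> ('a, 'b) endo \<Rightarrow> ('a, 'b) endo" is
  "\<lambda>A B :: 'a ^ 'b ^ 'b. A ** B" .

instance
proof
  fix a b c :: "('a, 'b) endo"
  show "a + b + c = a + (b + c)" by transfer (simp add: algebra_simps)
  show "a + b = b + a" by transfer (simp add: algebra_simps)
  show "0 + a = a" by transfer simp
  show "- a + a = 0" by transfer simp
  show "a - b = a + - b" by transfer simp
  show "a * b * c = a * (b * c)" by transfer (simp add: matrix_mul_assoc)
  show "1 * a = a" by transfer simp
  show "a * 1 = a" by transfer simp
  show "(a + b) * c = a * c + b * c"
    by transfer (simp add: vec_eq_iff matrix_matrix_mult_def algebra_simps sum.distrib)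
  show "a * (b + c) = a * b + a * c" by transfer (rule matrix_add_ldistrib)
  show "(0 :: ('a, 'b) endo) \<noteq> 1" by transfer (auto simp: vec_eq_iff mat_def)
qed

end

lift_definition app :: "('a::comm_ring_1, 'r::finite) endo \<Rightarrow> 'a ^ 'r \<Rightarrow> 'a ^ 'r" (infixr "\<star>" 75)
  is "(*v)" .

lift_definition scal :: "'a::comm_ring_1 \<Rightarrow> ('a, 'r::finite) endo" is "mat" .

lift_definition of_cols :: "('r::finite \<Rightarrow> 'a::comm_ring_1 ^ 'r) \<Rightarrow> ('a, 'r) endo"
  is "\<lambda>w. \<chi> i j. w j $ i" .

lemma app_one [simp]: "1 \<star> v = v"
  by transfer simp

lemma app_zero [simp]: "0 \<star> v = 0"
  by transfer (simp add: vec_eq_iff matrix_vector_mult_def)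

lemma app_mult: "(A * B) \<star> v = A \<star> (B \<star> v)"
  by transfer (simp add: matrix_vector_mul_assoc)

lemma app_add: "(A + B) \<star> v = A \<star> v + B \<star> v"
  by transfer (simp add: vec_eq_iff matrix_vector_mult_def algebra_simps sum.distrib)

lemma app_diff: "(A - B) \<star> v = A \<star> v - B \<star> v"
  by transfer (simp add: vec_eq_iff matrix_vector_mult_def algebra_simps sum_subtractf)

lemma app_uminus: "(- A) \<star> v = - (A \<star> v)"
  by transfer (simp add: vec_eq_iff matrix_vector_mult_def sum_negf)

lemma app_scal: "scal c \<star> v = c *s v"
  by transfer (simp add: vec_eq_iff matrix_vector_mult_def mat_def if_distrib if_distribR cong: if_cong)

lemma app_sum: "(\<Sum>i\<in>I. A i) \<star> v = (\<Sum>i\<in>I. A i \<star> v)"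
  by (induction I rule: infinite_finite_induct) (simp_all add: app_add)

lemma app_vzero [simp]: "A \<star> 0 = 0"
  by transfer simp

lemma app_vadd: "A \<star> (v + w) = A \<star> v + A \<star> w"
  by transfer (simp add: matrix_vector_right_distrib)

lemma app_vscale: "A \<star> (c *s v) = c *s (A \<star> v)"
  by transfer (simp add: vec_eq_iff matrix_vector_mult_def sum_distrib_left algebra_simps)

lemma app_vuminus: "A \<star> (- v) = - (A \<star> v)"
  by transfer (simp add: vec_eq_iff matrix_vector_mult_def sum_negf)

lemma app_vdiff: "A \<star> (v - w) = A \<star> v - A \<star> w"
  using app_vadd[of A v "- w"] by (simp add: app_vuminus)

lemma app_vsum: "A \<star> (\<Sum>i\<in>I. v i) = (\<Sum>i\<in>I. A \<star> v i)"
  by (induction I rule: infinite_finite_induct) (simp_all add: app_vadd)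

lemmas app_simps = app_mult app_add app_diff app_uminus app_scal app_sum
  app_vadd app_vdiff app_vuminus app_vscale app_vsum

lemma of_cols_app: "of_cols w \<star> v = (\<Sum>j\<in>UNIV. v $ j *s w j)"
  by transfer (simp add: vec_eq_iff matrix_vector_mult_def mult.commute)

lemma vec_expand: "(v :: 'a::comm_ring_1 ^ 'r::finite) = (\<Sum>j\<in>UNIV. v $ j *s axis j 1)"
  by (simp add: vec_eq_iff axis_def if_distrib cong: if_cong)

lemma endo_eqI_axis: "(\<And>j. A \<star> axis j 1 = B \<star> axis j 1) \<Longrightarrow> A = B"
proof -
  assume *: "\<And>j. A \<star> axis j 1 = B \<star> axis j 1"
  have "mat_of A $ i $ j = mat_of B $ i $ j" for i j
    using *[of j] by (auto simp: vec_eq_iff app.rep_eq matrix_vector_mult_def axis_def if_distrib cong: if_cong)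
  then have "mat_of A = mat_of B" by (simp add: vec_eq_iff)
  then show "A = B" by (simp add: mat_of_inject)
qed

lemma endo_eqI: "(\<And>v. A \<star> v = B \<star> v) \<Longrightarrow> A = B"
  by (rule endo_eqI_axis)

lemma nonzero_app:
  assumes "A \<noteq> 0" obtains v where "A \<star> v \<noteq> 0"
  using assms endo_eqI[of A 0] by auto

lemma scal_add: "scal (a + b) = scal a + scal b"
  by (rule endo_eqI) (simp add: app_simps vec_eq_iff algebra_simps)

lemma scal_mult: "scal (a * b) = scal a * scal b"
  by (rule endo_eqI) (simp add: app_simps vec_eq_iff algebra_simps)

lemma scal_0 [simp]: "scal 0 = 0"
  by (rule endo_eqI) (simp add: app_simps)

lemma scal_1 [simp]: "scal 1 = 1"
  by (rule endo_eqI) (simp add: app_simps)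

lemma scal_commute: "A * scal c = scal c * A"
  by (rule endo_eqI) (simp add: app_simps vec_eq_iff algebra_simps)

section \<open>Ring homomorphisms on coefficients\<close>

text \<open>
  Three changes of scalars occur: constants are regarded as polynomials in \<open>t\<close>, polynomials
  are evaluated at \<open>t = 0\<close>, and polynomials are regarded as rational functions.
\<close>

definition is_hom :: "('a::comm_ring_1 \<Rightarrow> 'b::comm_ring_1) \<Rightarrow> bool" where
  "is_hom h \<longleftrightarrow> h 0 = 0 \<and> h 1 = 1 \<and> (\<forall>a b. h (a + b) = h a + h b) \<and> (\<forall>a b. h (a * b) = h a * h b)"

lemma is_homD:
  assumes "is_hom h"
  shows "h 0 = 0" "h 1 = 1" "h (a + b) = h a + h b" "h (a * b) = h a * h b"
    "h (- a) = - h a" "h (a - b) = h a - h b"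
proof -
  show 0: "h 0 = 0" "h 1 = 1" "h (a + b) = h a + h b" "h (a * b) = h a * h b"
    using assms by (auto simp: is_hom_def)
  have add: "h (x + y) = h x + h y" for x y using assms by (auto simp: is_hom_def)
  show m: "h (- a) = - h a" using add[of a "- a"] 0 by (simp add: eq_neg_iff_add_eq_0 add.commute)
  show "h (a - b) = h a - h b" using add[of "a - b" b] by (simp add: algebra_simps)
qed

lemma hom_sum: "is_hom h \<Longrightarrow> h (\<Sum>i\<in>I. f i) = (\<Sum>i\<in>I. h (f i))"
  by (induction I rule: infinite_finite_induct) (simp_all add: is_homD)

definition vmap :: "('a \<Rightarrow> 'b) \<Rightarrow> 'a ^ 'r \<Rightarrow> 'b ^ 'r" where
  "vmap h v = (\<chi> i. h (v $ i))"

definition emap :: "('a \<Rightarrow> 'b) \<Rightarrow> ('a, 'r::finite) endo \<Rightarrow> ('b, 'r) endo" where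
  "emap h A = endo_of (\<chi> i j. h (mat_of A $ i $ j))"

lemma mat_of_emap: "mat_of (emap h A) $ i $ j = h (mat_of A $ i $ j)"
  by (simp add: emap_def endo_of_inverse)

lemma app_nth: "(A \<star> v) $ i = (\<Sum>j\<in>UNIV. mat_of A $ i $ j * v $ j)"
  by (simp add: app.rep_eq matrix_vector_mult_def)

lemma vmap_nth [simp]: "vmap h v $ i = h (v $ i)"
  by (simp add: vmap_def)

lemma emap_app: "is_hom h \<Longrightarrow> emap h A \<star> vmap h v = vmap h (A \<star> v)"
  by (simp add: vec_eq_iff app_nth mat_of_emap hom_sum is_homD)

lemma vmap_axis: "is_hom h \<Longrightarrow> vmap h (axis j 1) = axis j 1"
  by (simp add: vec_eq_iff axis_def is_homD)

lemma vmap_add: "is_hom h \<Longrightarrow> vmap h (v + w) = vmap h v + vmap h w"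
  by (simp add: vec_eq_iff is_homD)

lemma vmap_scale: "is_hom h \<Longrightarrow> vmap h (c *s w) = h c *s vmap h w"
  by (simp add: vec_eq_iff is_homD)

lemma vmap_0: "is_hom h \<Longrightarrow> vmap h 0 = 0"
  by (simp add: vec_eq_iff is_homD)

lemma emap_axis: "is_hom h \<Longrightarrow> emap h A \<star> axis j 1 = vmap h (A \<star> axis j 1)"
  by (metis emap_app vmap_axis)

lemma emap_mult: "is_hom h \<Longrightarrow> emap h (A * B) = emap h A * emap h B"
  by (rule endo_eqI_axis) (simp add: app_simps emap_axis emap_app)

lemma emap_add: "is_hom h \<Longrightarrow> emap h (A + B) = emap h A + emap h B"
  by (rule endo_eqI_axis) (simp add: app_simps emap_axis vmap_add)

lemma emap_0: "is_hom h \<Longrightarrow> emap h 0 = 0"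
  by (rule endo_eqI_axis) (simp add: app_simps emap_axis vmap_0)

lemma emap_1: "is_hom h \<Longrightarrow> emap h 1 = 1"
  by (rule endo_eqI_axis) (simp add: app_simps emap_axis vmap_axis)

lemma emap_scal: "is_hom h \<Longrightarrow> emap h (scal c) = scal (h c)"
  by (rule endo_eqI_axis) (simp add: app_simps emap_axis vmap_axis vmap_scale)

lemma emap_uminus: "is_hom h \<Longrightarrow> emap h (- A) = - emap h A"
  using emap_add[of h A "- A"] by (simp add: emap_0 eq_neg_iff_add_eq_0 add.commute)

lemma emap_diff: "is_hom h \<Longrightarrow> emap h (A - B) = emap h A - emap h B"
  using emap_add[of h A "- B"] by (simp add: emap_uminus)

lemma emap_sum: "is_hom h \<Longrightarrow> emap h (\<Sum>i\<in>I. A i) = (\<Sum>i\<in>I. emap h (A i))"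
  by (induction I rule: infinite_finite_induct) (simp_all add: emap_0 emap_add)

lemma emap_power: "is_hom h \<Longrightarrow> emap h (A ^ n) = emap h A ^ n"
  by (induction n) (simp_all add: emap_1 emap_mult)

lemmas emap_simps = emap_mult emap_add emap_0 emap_1 emap_scal emap_uminus emap_diff emap_sum emap_power

lemma is_hom_const_poly: "is_hom (\<lambda>a. [:a:])"
  by (simp add: is_hom_def one_pCons)

lemma is_hom_eval0: "is_hom (\<lambda>p. poly p 0)"
  by (simp add: is_hom_def)

section \<open>Contraction by linear forms\<close>

lemma lookup_map_zero: "g 0 = 0 \<Longrightarrow> Poly_Mapping.lookup (Poly_Mapping.map g p) k = g (Poly_Mapping.lookup p k)"
  by (simp add: Poly_Mapping.map.rep_eq when_def)

lemma lookup_contract: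
  fixes D :: "('a::comm_ring_1, 'r) diffop"
  shows "Poly_Mapping.lookup (contract D f) \<gamma> =
     (\<Sum>\<beta>\<in>Poly_Mapping.keys D. Poly_Mapping.lookup D \<beta> * Poly_Mapping.lookup f (\<gamma> + \<beta>))"
proof -
  have eq: "(\<forall>i. Poly_Mapping.lookup \<beta> i \<le> Poly_Mapping.lookup \<alpha> i) \<and> \<alpha> - \<beta> = \<gamma> \<longleftrightarrow> \<alpha> = \<gamma> + \<beta>"
    for \<alpha> \<beta> :: "'r exponent"
    by (auto simp: poly_mapping_eq_iff fun_eq_iff lookup_add lookup_minus) (metis le_add_diff_inverse2)
  have "(\<Sum>\<alpha>\<in>Poly_Mapping.keys f. Poly_Mapping.lookup
        (if \<forall>i. Poly_Mapping.lookup \<beta> i \<le> Poly_Mapping.lookup \<alpha> i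
        then Poly_Mapping.single (\<alpha> - \<beta>) (Poly_Mapping.lookup D \<beta> * Poly_Mapping.lookup f \<alpha>)
        else 0) \<gamma>) = Poly_Mapping.lookup D \<beta> * Poly_Mapping.lookup f (\<gamma> + \<beta>)" for \<beta>
  proof -
    have "(\<Sum>\<alpha>\<in>Poly_Mapping.keys f. Poly_Mapping.lookup
        (if \<forall>i. Poly_Mapping.lookup \<beta> i \<le> Poly_Mapping.lookup \<alpha> i
        then Poly_Mapping.single (\<alpha> - \<beta>) (Poly_Mapping.lookup D \<beta> * Poly_Mapping.lookup f \<alpha>)
        else 0) \<gamma>) = (\<Sum>\<alpha>\<in>Poly_Mapping.keys f.
         if \<alpha> = \<gamma> + \<beta> then Poly_Mapping.lookup D \<beta> * Poly_Mapping.lookup f \<alpha> else 0)"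
      by (intro sum.cong refl) (auto simp: lookup_single when_def eq[symmetric])
    also have "\<dots> = Poly_Mapping.lookup D \<beta> * Poly_Mapping.lookup f (\<gamma> + \<beta>)"
      by (auto simp: in_keys_iff)
    finally show ?thesis .
  qed
  then show ?thesis
    by (simp add: contract_def lookup_sum)
qed

lemma lookup_contract':
  assumes "finite K" "Poly_Mapping.keys D \<subseteq> K"
  shows "Poly_Mapping.lookup (contract D f) \<gamma> =
     (\<Sum>\<beta>\<in>K. Poly_Mapping.lookup D \<beta> * Poly_Mapping.lookup f (\<gamma> + \<beta>))"
  unfolding lookup_contract
  by (rule sum.mono_neutral_left) (use assms in \<open>auto simp: in_keys_iff\<close>)

lemma contract_add_left: "contract (D + E) f = contract D f + contract E f"
proof (rule poly_mapping_eqI)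
  fix k
  let ?K = "Poly_Mapping.keys D \<union> Poly_Mapping.keys E"
  have "Poly_Mapping.keys (D + E) \<subseteq> ?K" by (rule keys_add)
  then show "Poly_Mapping.lookup (contract (D + E) f) k = Poly_Mapping.lookup (contract D f + contract E f) k"
    by (simp add: lookup_add lookup_contract'[of ?K] sum.distrib algebra_simps)
qed

lemma contract_add_right: "contract D (f + g) = contract D f + contract D g"
  by (rule poly_mapping_eqI) (simp add: lookup_add lookup_contract algebra_simps sum.distrib)

lemma contract_zero_left [simp]: "contract 0 f = 0"
  by (simp add: contract_def)

lemma contract_zero_right [simp]: "contract D 0 = 0"
  by (simp add: contract_def)

lemma contract_sum_left: "contract (\<Sum>i\<in>I. D i) f = (\<Sum>i\<in>I. contract (D i) f)"
  by (induction I rule: infinite_finite_induct) (simp_all add: contract_add_left)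

lemma contract_sum_right: "contract D (\<Sum>i\<in>I. f i) = (\<Sum>i\<in>I. contract D (f i))"
  by (induction I rule: infinite_finite_induct) (simp_all add: contract_add_right)

lemma lookup_contract_single:
  "Poly_Mapping.lookup (contract (Poly_Mapping.single \<beta> b) f) \<gamma> = b * Poly_Mapping.lookup f (\<gamma> + \<beta>)"
  by (simp add: lookup_contract'[of "{\<beta>}"])

lemma poly_mapping_sum_single:
  "p = (\<Sum>k\<in>Poly_Mapping.keys p. Poly_Mapping.single k (Poly_Mapping.lookup p k))"
  by (rule poly_mapping_eqI) (auto simp: lookup_sum lookup_single when_def in_keys_iff)

text \<open>
  The forms are a module over the operators. In particular derivatives commute, which is used
  throughout to reorder the arguments of a form.
\<close>

lemma contract_mult: "contract (D * E) f = contract D (contract E f)"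
proof -
  have 1: "contract (Poly_Mapping.single a x * Poly_Mapping.single b y) f
        = contract (Poly_Mapping.single a x) (contract (Poly_Mapping.single b y) f)" for a b x y
    by (rule poly_mapping_eqI) (simp add: mult_single lookup_contract_single ac_simps)
  have "contract ((\<Sum>k\<in>Poly_Mapping.keys D. Poly_Mapping.single k (Poly_Mapping.lookup D k)) *
       (\<Sum>k\<in>Poly_Mapping.keys E. Poly_Mapping.single k (Poly_Mapping.lookup E k))) f =
     contract (\<Sum>k\<in>Poly_Mapping.keys D. Poly_Mapping.single k (Poly_Mapping.lookup D k))
       (contract (\<Sum>k\<in>Poly_Mapping.keys E. Poly_Mapping.single k (Poly_Mapping.lookup E k)) f)"
    by (simp only: sum_distrib_left sum_distrib_right contract_sum_left contract_sum_right 1)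
  then show ?thesis
    by (simp only: poly_mapping_sum_single[symmetric])
qed

definition lin :: "'a::comm_ring_1 ^ 'r::finite \<Rightarrow> ('a, 'r) diffop" where
  "lin v = (\<Sum>i\<in>UNIV. Poly_Mapping.single (Poly_Mapping.single i 1) (v $ i))"

text \<open>
  The derivative in direction \<open>v\<close>. Iterating it, a form of degree \<open>d\<close> becomes the symmetric
  \<open>d\<close>-linear function \<open>ctr v\<^sub>1 (\<dots> (ctr v\<^sub>d f))\<close>; divided powers make this correspondence work in
  every characteristic.
\<close>

definition ctr :: "'a::comm_ring_1 ^ 'r::finite \<Rightarrow> ('a, 'r) dpower \<Rightarrow> ('a, 'r) dpower" where
  "ctr v f = contract (lin v) f"

lemma lookup_ctr: "Poly_Mapping.lookup (ctr v f) \<gamma> =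
    (\<Sum>i\<in>UNIV. v $ i * Poly_Mapping.lookup f (\<gamma> + Poly_Mapping.single i 1))"
  by (simp add: ctr_def lin_def contract_sum_left lookup_sum lookup_contract_single)

lemma lookup_ctr_axis: "Poly_Mapping.lookup (ctr (axis i 1) f) \<gamma> =
    Poly_Mapping.lookup f (\<gamma> + Poly_Mapping.single i 1)"
  by (simp add: lookup_ctr axis_def if_distrib if_distribR cong: if_cong)

lemma ctr_commute: "ctr v (ctr w f) = ctr w (ctr v f)"
  by (simp add: ctr_def contract_mult[symmetric] mult.commute)

lemma ctr_contract: "ctr v (contract D f) = contract D (ctr v f)"
  by (simp add: ctr_def contract_mult[symmetric] mult.commute)

definition fscale :: "'a::comm_ring_1 \<Rightarrow> ('a, 'r) dpower \<Rightarrow> ('a, 'r) dpower" where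
  "fscale c f = Poly_Mapping.map ((*) c) f"

lemma lookup_fscale: "Poly_Mapping.lookup (fscale c f) \<gamma> = c * Poly_Mapping.lookup f \<gamma>"
  by (simp add: fscale_def lookup_map_zero)

lemma ctr_vadd: "ctr (v + w) f = ctr v f + ctr w f"
  by (rule poly_mapping_eqI) (simp add: lookup_ctr lookup_add algebra_simps sum.distrib)

lemma ctr_vdiff: "ctr (v - w) f = ctr v f - ctr w f"
  by (rule poly_mapping_eqI) (simp add: lookup_ctr lookup_minus algebra_simps sum_subtractf)

lemma ctr_vscale: "ctr (c *s v) f = fscale c (ctr v f)"
  by (rule poly_mapping_eqI) (simp add: lookup_ctr lookup_fscale algebra_simps sum_distrib_left)

lemma ctr_v0 [simp]: "ctr 0 f = 0"
  by (rule poly_mapping_eqI) (simp add: lookup_ctr)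

lemma ctr_vsum: "ctr (\<Sum>i\<in>I. v i) f = (\<Sum>i\<in>I. ctr (v i) f)"
  by (induction I rule: infinite_finite_induct) (simp_all add: ctr_vadd)

lemma ctr_add: "ctr v (f + g) = ctr v f + ctr v g"
  by (simp add: ctr_def contract_add_right)

lemma ctr_0 [simp]: "ctr v 0 = 0"
  by (simp add: ctr_def)

lemma ctr_sum: "ctr v (\<Sum>i\<in>I. f i) = (\<Sum>i\<in>I. ctr v (f i))"
  by (simp add: ctr_def contract_sum_right)

lemma ctr_diff: "ctr v (f - g) = ctr v f - ctr v g"
  by (rule poly_mapping_eqI) (simp add: lookup_ctr lookup_minus algebra_simps sum_subtractf)

lemma ctr_fscale: "ctr v (fscale c f) = fscale c (ctr v f)"
  by (rule poly_mapping_eqI) (simp add: lookup_ctr lookup_fscale algebra_simps sum_distrib_left)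

lemma contract_fscale: "contract D (fscale c f) = fscale c (contract D f)"
  by (rule poly_mapping_eqI) (simp add: lookup_contract lookup_fscale algebra_simps sum_distrib_left)

lemma fscale_0 [simp]: "fscale 0 f = 0" "fscale c 0 = 0"
  by (rule poly_mapping_eqI, simp add: lookup_fscale)+

lemma fscale_1 [simp]: "fscale 1 f = f"
  by (rule poly_mapping_eqI, simp add: lookup_fscale)

lemma fscale_add: "fscale c (f + g) = fscale c f + fscale c g"
  by (rule poly_mapping_eqI, simp add: lookup_fscale lookup_add algebra_simps)

lemma fscale_fscale: "fscale a (fscale b f) = fscale (a * b) f"
  by (rule poly_mapping_eqI, simp add: lookup_fscale algebra_simps)

lemma fscale_eq_0_iff: "fscale (c::'a::idom) f = 0 \<longleftrightarrow> c = 0 \<or> f = 0"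
  by (auto simp: poly_mapping_eq_iff fun_eq_iff lookup_fscale)

lemma fscale_sum: "fscale c (\<Sum>i\<in>I. f i) = (\<Sum>i\<in>I. fscale c (f i))"
  by (rule poly_mapping_eqI, simp add: lookup_fscale lookup_sum sum_distrib_left)

lemma ctr_expand: "ctr v f = (\<Sum>i\<in>UNIV. fscale (v $ i) (ctr (axis i 1) f))"
  by (subst vec_expand[of v]) (simp only: ctr_vsum ctr_vscale)

section \<open>Homogeneous forms\<close>

lemma total_degree_add: "total_degree (\<alpha> + \<beta>) = total_degree \<alpha> + total_degree \<beta>"
  by (simp add: total_degree_def lookup_add sum.distrib)

lemma total_degree_single [simp]: "total_degree (Poly_Mapping.single i n) = n"
  by (simp add: total_degree_def lookup_single when_def)

lemma total_degree_0 [simp]: "total_degree 0 = 0"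
  by (simp add: total_degree_def)

lemma homogeneous_iff: "p \<in> homogeneous d \<longleftrightarrow> (\<forall>\<alpha>. total_degree \<alpha> \<noteq> d \<longrightarrow> Poly_Mapping.lookup p \<alpha> = 0)"
  by (auto simp: homogeneous_def in_keys_iff)

lemma homogeneous_0 [simp]: "0 \<in> homogeneous d"
  by (simp add: homogeneous_iff)

lemma homogeneous_add: "f \<in> homogeneous d \<Longrightarrow> g \<in> homogeneous d \<Longrightarrow> f + g \<in> homogeneous d"
  by (simp add: homogeneous_iff lookup_add)

lemma homogeneous_fscale: "f \<in> homogeneous d \<Longrightarrow> fscale c f \<in> homogeneous d"
  by (simp add: homogeneous_iff lookup_fscale)

lemma homogeneous_sum: "(\<And>i. i \<in> I \<Longrightarrow> f i \<in> homogeneous d) \<Longrightarrow> (\<Sum>i\<in>I. f i) \<in> homogeneous d"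
  by (induction I rule: infinite_finite_induct) (simp_all add: homogeneous_add)

lemma homogeneous_ctr: "f \<in> homogeneous d \<Longrightarrow> ctr v f \<in> homogeneous (d - 1)"
  by (auto simp: homogeneous_iff lookup_ctr total_degree_add intro!: sum.neutral)

lemma exponent_positive:
  assumes "total_degree \<alpha> > 0"
  obtains i \<gamma> where "\<alpha> = \<gamma> + Poly_Mapping.single i 1"
proof -
  obtain i where i: "Poly_Mapping.lookup \<alpha> i > 0"
    using assms unfolding total_degree_def by (metis gr0I not_less_zero sum.neutral)
  have "\<alpha> = (\<alpha> - Poly_Mapping.single i 1) + Poly_Mapping.single i 1"
    by (rule poly_mapping_eqI) (use i in \<open>auto simp: lookup_add lookup_minus lookup_single when_def\<close>)
  then show ?thesis by (rule that)
qed

text \<open>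
  In positive degree a divided power monomial is determined by its derivatives, because every
  exponent arises from a smaller one by adding a unit; no division by the degree occurs.
\<close>

lemma form_eqI:
  assumes "f \<in> homogeneous d" "g \<in> homogeneous d" "d > 0"
    and eq: "\<And>i. ctr (axis i 1) f = ctr (axis i 1) g"
  shows "f = g"
proof (rule poly_mapping_eqI)
  fix \<alpha>
  show "Poly_Mapping.lookup f \<alpha> = Poly_Mapping.lookup g \<alpha>"
  proof (cases "total_degree \<alpha> = d")
    case True
    then have "total_degree \<alpha> > 0" using assms(3) by simp
    then obtain i \<gamma> where "\<alpha> = \<gamma> + Poly_Mapping.single i 1"
      by (rule exponent_positive)
    then show ?thesis
      using arg_cong[OF eq[of i], of "\<lambda>p. Poly_Mapping.lookup p \<gamma>"] by (simp add: lookup_ctr_axis)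
  qed (use assms in \<open>auto simp: homogeneous_iff\<close>)
qed

lemma form_zeroI:
  assumes "f \<in> homogeneous d" "d > 0" "\<And>v. ctr v f = 0"
  shows "f = 0"
  by (rule form_eqI[of f d 0]) (use assms in auto)

lemma finite_total_degree: "finite {\<alpha> :: 'r::finite exponent. total_degree \<alpha> = d}"
proof -
  have le: "Poly_Mapping.lookup \<alpha> i \<le> total_degree \<alpha>" for \<alpha> :: "'r exponent" and i
    unfolding total_degree_def by (rule member_le_sum) auto
  have "finite {g :: 'r \<Rightarrow> nat. \<forall>i. g i \<in> {..d}}"
    using finite_set_of_finite_funs[of "UNIV :: 'r set" "{..d}"] by (simp add: Collect_conj_eq)
  moreover have "Poly_Mapping.lookup ` {\<alpha> :: 'r exponent. total_degree \<alpha> = d} \<subseteq> {g. \<forall>i. g i \<in> {..d}}"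
    using le by force
  ultimately have "finite (Poly_Mapping.lookup ` {\<alpha> :: 'r exponent. total_degree \<alpha> = d})"
    by (rule finite_subset[rotated])
  then show ?thesis
    by (rule finite_imageD) (simp add: inj_on_def poly_mapping.lookup_inject)
qed

text \<open>
  The finiteness of the support is guaranteed by the bound on the degree.
\<close>

definition form_of :: "nat \<Rightarrow> ('r::finite exponent \<Rightarrow> 'a::zero) \<Rightarrow> ('a, 'r) dpower" where
  "form_of d c = Abs_poly_mapping (\<lambda>\<alpha>. if total_degree \<alpha> = d then c \<alpha> else 0)"

lemma lookup_form_of: "Poly_Mapping.lookup (form_of d c) \<alpha> = (if total_degree \<alpha> = d then c \<alpha> else 0)"
proof -
  have "finite {\<alpha>. (if total_degree \<alpha> = d then c \<alpha> else 0) \<noteq> 0}"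
    by (rule finite_subset[OF _ finite_total_degree[of d]]) auto
  then show ?thesis by (simp add: form_of_def)
qed

lemma homogeneous_form_of: "form_of d c \<in> homogeneous d"
  by (simp add: homogeneous_iff lookup_form_of)

section \<open>Self-adjoint operators\<close>

text \<open>
  The transposes of the matrices in \<open>M\<^sub>f\<close> are exactly of this kind; see
  \<open>M_alg_self_adjoint\<close> for the inclusion that matters.
\<close>

definition self_adjoint :: "('a::comm_ring_1, 'r::finite) endo \<Rightarrow> ('a, 'r) dpower \<Rightarrow> bool" where
  "self_adjoint A f \<longleftrightarrow> (\<forall>v w. ctr (A \<star> v) (ctr w f) = ctr v (ctr (A \<star> w) f))"

lemma self_adjointD: "self_adjoint A f \<Longrightarrow> ctr (A \<star> v) (ctr w f) = ctr v (ctr (A \<star> w) f)"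
  by (simp add: self_adjoint_def)

text \<open>
  A self-adjoint operator sends a form to a form again: \<open>g\<close> is \<open>f\<close> with \<open>A\<close> applied to one of its
  arguments. In characteristic zero one would differentiate and divide by \<open>d\<close>. Here the
  coefficient of an exponent is found by splitting off one of its variables, and
  self-adjointness says that the choice of this variable does not matter.
\<close>

lemma self_adjoint_form:
  assumes f: "f \<in> homogeneous d" "d > 0" and A: "self_adjoint A f"
  obtains g where "g \<in> homogeneous d" "\<And>v. ctr v g = ctr (A \<star> v) f"
proof -
  let ?P = "\<lambda>\<alpha> (i, \<gamma>). \<alpha> = \<gamma> + Poly_Mapping.single i 1"
  let ?L = "\<lambda>(i, \<gamma>). Poly_Mapping.lookup (ctr (A \<star> axis i 1) f) \<gamma>"
  \<comment> \<open>Two ways of splitting off a variable: \<open>\<gamma>\<close> and \<open>\<delta>\<close> share the exponent \<open>\<epsilon>\<close> below both.\<close>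
  have indep: "?L (i, \<gamma>) = ?L (j, \<delta>)"
    if "\<gamma> + Poly_Mapping.single i 1 = \<delta> + Poly_Mapping.single j 1" for i j \<gamma> \<delta>
  proof (cases "i = j")
    case True
    then show ?thesis using that by simp
  next
    case False
    define \<epsilon> where "\<epsilon> = \<gamma> - Poly_Mapping.single j 1"
    have eq: "Poly_Mapping.lookup \<gamma> k + Poly_Mapping.lookup (Poly_Mapping.single i 1) k
      = Poly_Mapping.lookup \<delta> k + Poly_Mapping.lookup (Poly_Mapping.single j (1::nat)) k" for k
      using arg_cong[OF that, of "\<lambda>p. Poly_Mapping.lookup p k"] by (simp add: lookup_add)
    have eq': "Poly_Mapping.lookup \<delta> k = Poly_Mapping.lookup \<gamma> k + (if i = k then 1 else 0) - (if j = k then 1 else 0)"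
      for k using eq[of k] by (cases "i = k"; cases "j = k"; simp add: lookup_single when_def)
    have gj: "Poly_Mapping.lookup \<gamma> j > 0" using eq[of j] False by (simp add: lookup_single when_def)
    have g: "\<gamma> = \<epsilon> + Poly_Mapping.single j 1"
      by (rule poly_mapping_eqI)
         (use eq[of j] False in \<open>auto simp: \<epsilon>_def lookup_add lookup_minus lookup_single when_def\<close>)
    have d: "\<delta> = \<epsilon> + Poly_Mapping.single i 1"
      by (rule poly_mapping_eqI)
         (use eq' False in \<open>auto simp: \<epsilon>_def lookup_add lookup_minus lookup_single when_def\<close>)
    have "?L (i, \<gamma>) = Poly_Mapping.lookup (ctr (axis j 1) (ctr (A \<star> axis i 1) f)) \<epsilon>"
      by (simp add: lookup_ctr_axis g)
    also have "ctr (axis j 1) (ctr (A \<star> axis i 1) f) = ctr (axis i 1) (ctr (A \<star> axis j 1) f)"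
      by (metis A ctr_commute self_adjointD)
    also have "Poly_Mapping.lookup \<dots> \<epsilon> = ?L (j, \<delta>)"
      by (simp add: lookup_ctr_axis d)
    finally show ?thesis .
  qed
  define g where "g = form_of d (\<lambda>\<alpha>. ?L (SOME x. ?P \<alpha> x))"
  have g: "g \<in> homogeneous d" by (simp add: g_def homogeneous_form_of)
  have ax: "ctr (axis i 1) g = ctr (A \<star> axis i 1) f" for i
  proof (rule poly_mapping_eqI)
    fix \<gamma>
    show "Poly_Mapping.lookup (ctr (axis i 1) g) \<gamma> = Poly_Mapping.lookup (ctr (A \<star> axis i 1) f) \<gamma>"
    proof (cases "total_degree \<gamma> = d - 1")
      case True
      obtain j \<delta> where sm: "(SOME x. ?P (\<gamma> + Poly_Mapping.single i 1) x) = (j, \<delta>)"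
        by (rule prod.exhaust)
      have "?P (\<gamma> + Poly_Mapping.single i 1) (SOME x. ?P (\<gamma> + Poly_Mapping.single i 1) x)"
        by (rule someI[of _ "(i, \<gamma>)"]) simp
      then have "\<gamma> + Poly_Mapping.single i 1 = \<delta> + Poly_Mapping.single j 1"
        unfolding sm by simp
      then have "?L (SOME x. ?P (\<gamma> + Poly_Mapping.single i 1) x) = ?L (i, \<gamma>)"
        unfolding sm by (rule indep[symmetric])
      then show ?thesis
        using True f(2) by (simp add: lookup_ctr_axis g_def lookup_form_of total_degree_add)
    next
      case False
      then show ?thesis
        using homogeneous_ctr[OF g] homogeneous_ctr[OF f(1)] by (auto simp: homogeneous_iff)
    qed
  qed
  have "ctr v g = ctr (A \<star> v) f" for v
  proof -
    have "A \<star> v = (\<Sum>i\<in>UNIV. v $ i *s (A \<star> axis i 1))"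
      by (subst vec_expand[of v]) (simp only: app_vsum app_vscale)
    then show ?thesis
      by (simp add: ctr_expand[of v] ctr_vsum ctr_vscale ax)
  qed
  with g that show ?thesis by blast
qed

section \<open>Change of coefficients\<close>

definition fmapc :: "('a::zero \<Rightarrow> 'b::zero) \<Rightarrow> ('a, 'r) dpower \<Rightarrow> ('b, 'r) dpower" where
  "fmapc h f = Poly_Mapping.map h f"

lemma lookup_fmapc: "is_hom h \<Longrightarrow> Poly_Mapping.lookup (fmapc h f) \<alpha> = h (Poly_Mapping.lookup f \<alpha>)"
  by (simp add: fmapc_def lookup_map_zero is_homD)

lemma fmapc_ctr: "is_hom h \<Longrightarrow> fmapc h (ctr v f) = ctr (vmap h v) (fmapc h f)"
  by (rule poly_mapping_eqI) (simp add: lookup_fmapc lookup_ctr hom_sum is_homD)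

lemma fmapc_0: "is_hom h \<Longrightarrow> fmapc h 0 = 0"
  by (rule poly_mapping_eqI) (simp add: lookup_fmapc is_homD)

lemma fmapc_add: "is_hom h \<Longrightarrow> fmapc h (f + g) = fmapc h f + fmapc h g"
  by (rule poly_mapping_eqI) (simp add: lookup_fmapc is_homD lookup_add)

lemma fmapc_sum: "is_hom h \<Longrightarrow> fmapc h (\<Sum>i\<in>I. f i) = (\<Sum>i\<in>I. fmapc h (f i))"
  by (rule poly_mapping_eqI) (simp add: lookup_fmapc hom_sum lookup_sum)

lemma fmapc_fscale: "is_hom h \<Longrightarrow> fmapc h (fscale c f) = fscale (h c) (fmapc h f)"
  by (rule poly_mapping_eqI) (simp add: lookup_fmapc is_homD lookup_fscale)

lemma fmapc_homogeneous: "is_hom h \<Longrightarrow> f \<in> homogeneous d \<Longrightarrow> fmapc h f \<in> homogeneous d"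
  by (simp add: homogeneous_iff lookup_fmapc is_homD)

section \<open>A criterion for regular splitting\<close>

lemma homogeneous_contract:
  fixes D :: "('a::comm_ring_1, 'r::finite) diffop"
  assumes "D \<in> homogeneous e" "f \<in> homogeneous d" "e \<le> d"
  shows "contract D f \<in> homogeneous (d - e)"
  unfolding homogeneous_iff
proof (intro allI impI)
  fix \<alpha> :: "'r exponent" assume a: "total_degree \<alpha> \<noteq> d - e"
  have "Poly_Mapping.lookup D \<beta> * Poly_Mapping.lookup f (\<alpha> + \<beta>) = 0" for \<beta>
    using assms a by (cases "total_degree \<beta> = e") (auto simp: homogeneous_iff total_degree_add)
  then show "Poly_Mapping.lookup (contract D f) \<alpha> = 0"
    by (simp add: lookup_contract)
qed

text \<open>
  The pieces are separated by directions: the derivative in direction \<open>u p i\<close> agrees, up to the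
  nonzero factor \<open>a p\<close>, with the derivative in direction \<open>i\<close> on the piece \<open>g p\<close>, and kills all other
  pieces. An operator \<open>D\<close> of degree \<open>d - 1\<close> turns the pieces into linear forms; if \<open>D\<close> applied
  to one piece is a combination of derivatives of the others, then all its partial
  derivatives vanish, hence so does the linear form itself.
  
  There may be more pieces than needed. Sums of pieces again
  have coefficients in \<open>F\<close>, so the superfluous ones are merged into one summand.
\<close>

lemma splits_regularly_overI:
  fixes f :: "('l::field, 'r::finite) dpower" and g :: "nat \<Rightarrow> ('l, 'r) dpower"
  assumes "0 \<in> F" and "d \<ge> 1" and "m + 1 \<le> n"
    and f: "f = (\<Sum>p<n. g p)"
    and hom: "\<And>I. I \<subseteq> {..<n} \<Longrightarrow> (\<Sum>p\<in>I. g p) \<in> homogeneous_over F d"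
    and nz: "\<And>p. p < n \<Longrightarrow> g p \<noteq> 0"
    and a: "\<And>p. p < n \<Longrightarrow> a p \<noteq> 0"
    and eig: "\<And>p i. p < n \<Longrightarrow> ctr (u p i) (g p) = fscale (a p) (ctr (axis i 1) (g p))"
    and orth: "\<And>p p' i. p < n \<Longrightarrow> p' < n \<Longrightarrow> p \<noteq> p' \<Longrightarrow> ctr (u p i) (g p') = 0"
  shows "splits_regularly_over F d m f"
proof -
  \<comment> \<open>The pieces \<open>m, \<dots>, n - 1\<close> are merged into the last summand.\<close>
  define I where "I i = {p. p < n \<and> min (p + 1) (m + 1) = i}" for i
  define G where "G i = (\<Sum>p\<in>I i. g p)" for i
  have fin: "finite (I i)" for i by (simp add: I_def)
  have In: "p < n" if "p \<in> I i" for p i using that by (simp add: I_def)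
  have hom1: "g p \<in> homogeneous d" if "p < n" for p
    using hom[of "{p}"] that by (auto simp: homogeneous_over_def)
  have in_part: "ctr (u p k) (G i) = fscale (a p) (ctr (axis k 1) (g p))" if "p \<in> I i" for p i k
  proof -
    have "ctr (u p k) (G i) = (\<Sum>q\<in>I i. if q = p then fscale (a p) (ctr (axis k 1) (g p)) else 0)"
      unfolding G_def ctr_sum
      by (rule sum.cong) (use that In eig orth in auto)
    then show ?thesis using that fin by simp
  qed
  have out_part: "ctr (u p k) (G j) = 0" if "p \<in> I i" "j \<noteq> i" for p i j k
    unfolding G_def ctr_sum
    by (rule sum.neutral) (use that in \<open>auto simp: I_def intro!: orth\<close>)
  have G_nz: "G i \<noteq> 0" if "i \<in> {1..m+1}" for i
  proof
    assume "G i = 0"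
    have p: "i - 1 \<in> I i" using that assms(3) by (auto simp: I_def)
    have "ctr (axis k 1) (g (i - 1)) = 0" for k
      using in_part[OF p, of k] \<open>G i = 0\<close> a[of "i - 1"] In[OF p] by (simp add: fscale_eq_0_iff)
    then have "g (i - 1) = 0"
      using form_eqI[of "g (i - 1)" d 0] hom1[of "i - 1"] In[OF p] assms(2) by simp
    with nz In[OF p] show False by blast
  qed
  have "f = (\<Sum>i\<in>{1..m+1}. G i)"
  proof -
    have "(\<Sum>i\<in>{1..m+1}. G i) = sum g (\<Union>i\<in>{1..m+1}. I i)"
      unfolding G_def by (rule sum.UNION_disjoint[symmetric]) (auto simp: fin I_def)
    also have "(\<Union>i\<in>{1..m+1}. I i) = {..<n}" by (auto simp: I_def)
    finally show ?thesis using f by simp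
  qed
  moreover have "derivatives_over F (d - 1) (G i) \<inter>
           (\<Sum>j\<in>{1..m+1} - {i}. derivatives_over F (d - 1) (G j)) = {0}"
    if i: "i \<in> {1..m+1}" for i
  proof (intro equalityI subsetI)
    fix h assume "h \<in> derivatives_over F (d - 1) (G i) \<inter>
           (\<Sum>j\<in>{1..m+1} - {i}. derivatives_over F (d - 1) (G j))"
    then obtain D where D: "D \<in> homogeneous_over F (d - 1)" "h = contract D (G i)"
      and "h \<in> (\<Sum>j\<in>{1..m+1} - {i}. derivatives_over F (d - 1) (G j))"
      by (auto simp: derivatives_over_def)
    then obtain s where s: "h = sum s ({1..m+1} - {i})"
        "\<forall>j\<in>{1..m+1} - {i}. s j \<in> derivatives_over F (d - 1) (G j)"
      by (auto simp: set_sum_alt)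
    have "contract D (g p) = 0" if p: "p \<in> I i" for p
    proof (rule form_eqI[of _ 1 0])
      show "contract D (g p) \<in> homogeneous 1"
        using homogeneous_contract[of D "d - 1" "g p" d] D(1) hom1[OF In[OF p]] assms(2)
        by (simp add: homogeneous_over_def)
      fix k
      have "ctr (u p k) (s j) = 0" if j: "j \<in> {1..m+1} - {i}" for j
      proof -
        obtain D' where "s j = contract D' (G j)"
          using bspec[OF s(2) j] unfolding derivatives_over_def by blast
        then show ?thesis using j out_part[OF p, of j k] by (simp add: ctr_contract)
      qed
      then have "ctr (u p k) h = 0" unfolding s(1) ctr_sum by (intro sum.neutral) auto
      moreover have "ctr (u p k) h = fscale (a p) (ctr (axis k 1) (contract D (g p)))"
        by (simp add: D(2) ctr_contract in_part[OF p] contract_fscale)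
      ultimately show "ctr (axis k 1) (contract D (g p)) = ctr (axis k 1) 0"
        using a[OF In[OF p]] by (simp add: fscale_eq_0_iff)
    qed simp_all
    then show "h \<in> {0}" unfolding D(2) G_def contract_sum_right by simp
  next
    fix h :: "('l, 'r) dpower" assume "h \<in> {0}"
    then have h: "h = 0" by simp
    have z: "0 \<in> derivatives_over F (d - 1) (G j)" for j
      unfolding derivatives_over_def
      by (rule image_eqI[of _ _ 0]) (use assms(1) in \<open>auto simp: homogeneous_over_def\<close>)
    have "0 \<in> (\<Sum>j\<in>{1..m+1} - {i}. derivatives_over F (d - 1) (G j))"
      unfolding set_sum_alt[OF finite_Diff[OF finite_atLeastAtMost]]
      by (rule CollectI, rule exI[of _ "\<lambda>_. 0"]) (use z in simp)
    with z h show "h \<in> derivatives_over F (d - 1) (G i) \<inter>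
           (\<Sum>j\<in>{1..m+1} - {i}. derivatives_over F (d - 1) (G j))" by simp
  qed
  moreover have "G i \<in> homogeneous_over F d" for i
    unfolding G_def by (rule hom) (auto simp: I_def)
  ultimately show ?thesis
    unfolding splits_regularly_over_def using G_nz by blast
qed

section \<open>One-parameter families as families with parameters\<close>

text \<open>
  Univariate polynomials are evaluated at the first of the parameters.
\<close>

definition tpoly_of :: "'k::comm_ring_1 poly \<Rightarrow> 'k tpoly" where
  "tpoly_of p = poly (map_poly (Poly_Mapping.single 0) p) (Poly_Mapping.single (Poly_Mapping.single 0 1) 1)"

lemma tpoly_of_0 [simp]: "tpoly_of 0 = 0"
  by (simp add: tpoly_of_def)

lemma tpoly_of_pCons: "tpoly_of (pCons a p) =
    Poly_Mapping.single 0 a + Poly_Mapping.single (Poly_Mapping.single 0 1) 1 * tpoly_of p"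
  by (simp add: tpoly_of_def map_poly_pCons)

lemma tpoly_of_add: "tpoly_of (p + q) = tpoly_of p + tpoly_of q"
  by (induction p q rule: poly_induct2) (simp_all add: tpoly_of_pCons single_add algebra_simps)

lemma tpoly_of_smult: "tpoly_of (smult a p) = Poly_Mapping.single 0 a * tpoly_of p"
  by (induction p) (simp_all add: tpoly_of_pCons mult_single algebra_simps)

lemma is_hom_tpoly_of: "is_hom (tpoly_of :: 'k::comm_ring_1 poly \<Rightarrow> _)"
proof -
  have "tpoly_of (p * q) = tpoly_of p * tpoly_of q" for p q :: "'k poly"
    by (induction p) (simp_all add: tpoly_of_pCons tpoly_of_add tpoly_of_smult algebra_simps)
  moreover have "tpoly_of (1 :: 'k poly) = 1"
    by (simp add: one_pCons tpoly_of_pCons)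
  ultimately show ?thesis by (simp add: is_hom_def tpoly_of_add)
qed

lemma lookup_tpoly_of:
  "Poly_Mapping.lookup (tpoly_of p) m = (\<Sum>i\<le>degree p. if m = Poly_Mapping.single 0 i then coeff p i else 0)"
proof -
  have pw: "Poly_Mapping.single (Poly_Mapping.single (0::nat) (1::nat)) (1::'a) ^ i = Poly_Mapping.single (Poly_Mapping.single 0 i) 1" for i
    by (induction i) (simp_all add: mult_single single_add[symmetric])
  have "degree (map_poly (Poly_Mapping.single (0 :: nat \<Rightarrow>\<^sub>0 nat)) p) = degree p"
    by (rule degree_map_poly) (metis lookup_single_eq lookup_zero)
  then have "tpoly_of p = (\<Sum>i\<le>degree p. Poly_Mapping.single (Poly_Mapping.single 0 i) (coeff p i))"
    unfolding tpoly_of_def poly_altdef by (simp only: pw) (simp add: coeff_map_poly mult_single)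
  then show ?thesis by (auto simp: lookup_sum lookup_single when_def intro!: sum.cong)
qed

lemma single_0_eq_iff: "Poly_Mapping.single (0::nat) (i::nat) = Poly_Mapping.single 0 j \<longleftrightarrow> i = j"
  by (metis lookup_single_eq)

lemma lookup_tpoly_of_single: "Poly_Mapping.lookup (tpoly_of p) (Poly_Mapping.single 0 i) = coeff p i"
  by (auto simp: lookup_tpoly_of single_0_eq_iff not_le coeff_eq_0)

lemma tpoly_of_eq_0_iff [simp]: "tpoly_of p = 0 \<longleftrightarrow> p = 0"
  by (metis lookup_tpoly_of_single lookup_zero poly_eqI coeff_0 tpoly_of_0)

lemma tpoly_of_tpolys: "tpoly_of p \<in> tpolys 1"
proof -
  have "Poly_Mapping.keys m \<subseteq> {..<1}" if "m \<in> Poly_Mapping.keys (tpoly_of p)" for m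
  proof -
    have "\<exists>i. m = Poly_Mapping.single 0 i"
    proof (rule ccontr)
      assume "\<nexists>i. m = Poly_Mapping.single 0 i"
      then have "Poly_Mapping.lookup (tpoly_of p) m = 0"
        unfolding lookup_tpoly_of by (intro sum.neutral) auto
      with that show False by (simp add: in_keys_iff)
    qed
    then show ?thesis by (auto split: if_splits)
  qed
  then show ?thesis by (simp add: tpolys_def)
qed

lemma teval_0: "teval q (\<lambda>_. 0) = Poly_Mapping.lookup q 0"
proof -
  have "(\<Prod>i\<in>Poly_Mapping.keys m. (0::'a) ^ Poly_Mapping.lookup m i) = (if m = 0 then 1 else 0)" for m :: "nat \<Rightarrow>\<^sub>0 nat"
  proof (cases "m = 0")
    case False
    then obtain i where i: "i \<in> Poly_Mapping.keys m" by fastforce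
    have "(\<Prod>i\<in>Poly_Mapping.keys m. (0::'a) ^ Poly_Mapping.lookup m i) = 0"
      by (intro prod_zero bexI[OF _ i]) (use i in \<open>auto simp: in_keys_iff zero_power\<close>)
    with False show ?thesis by simp
  qed simp
  then have "teval q (\<lambda>_. 0) = (\<Sum>m\<in>Poly_Mapping.keys q. if m = 0 then Poly_Mapping.lookup q m else 0)"
    unfolding teval_def by (intro sum.cong) simp_all
  then show ?thesis by (simp add: in_keys_iff)
qed

lemma teval_tpoly_of: "teval (tpoly_of p) (\<lambda>_. 0) = poly p 0"
  using lookup_tpoly_of_single[of p 0] by (simp add: teval_0 poly_0_coeff_0)

section \<open>Splitting families\<close>

abbreviation const :: "'a::zero \<Rightarrow> 'a poly" where "const a \<equiv> [:a:]"
abbreviation at0 :: "'a::comm_semiring_0 poly \<Rightarrow> 'a" where "at0 p \<equiv> poly p 0"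

text \<open>
  Up to the factors \<open>r p\<close> and \<open>q\<close> the \<open>E p\<close> are orthogonal idempotents for \<open>F\<close>, but they are defined
  over \<open>K[t]\<close>. The condition on \<open>emap at0 (E p)\<close> forces the pieces to be nonzero.
  The idempotent \<open>e\<close> of the special fibre localises the family: at \<open>t = 0\<close> the form \<open>F\<close> is the
  \<open>e\<close>-part of \<open>f\<close>, and for every \<open>t\<close> it only depends on the \<open>e\<close>-components of its arguments. This
  is what makes families for orthogonal idempotents additive.
\<close>

definition splitting_family ::
  "nat \<Rightarrow> ('k::field, 'r::finite) dpower \<Rightarrow> ('k, 'r) endo \<Rightarrow> nat \<Rightarrow> ('k poly, 'r) dpower \<Rightarrow>
    (nat \<Rightarrow> ('k poly, 'r) endo) \<Rightarrow> (nat \<Rightarrow> 'k poly) \<Rightarrow> 'k poly \<Rightarrow> bool" where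
  "splitting_family d f e n F E r q \<longleftrightarrow> F \<in> homogeneous d \<and> q \<noteq> 0 \<and>
     (\<forall>v. ctr v (fmapc at0 F) = ctr (e \<star> v) f) \<and>
     (\<forall>v. ctr (emap const e \<star> v) F = ctr v F) \<and>
     (\<forall>p<n. emap const e * E p = E p \<and> self_adjoint (E p) F \<and> emap at0 (E p) \<noteq> 0) \<and>
     (\<forall>p<n. \<forall>p'<n. p \<noteq> p' \<longrightarrow> (\<forall>v. ctr (E p \<star> E p' \<star> v) F = 0)) \<and>
     (\<forall>v. fscale q (ctr v F) = (\<Sum>p<n. fscale (r p) (ctr (E p \<star> v) F)))"

lemma splitting_familyD:
  assumes "splitting_family d f e n F E r q"
  shows "F \<in> homogeneous d" "q \<noteq> 0"
    "ctr v (fmapc at0 F) = ctr (e \<star> v) f"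
    "ctr (emap const e \<star> w) F = ctr w F"
    "p < n \<Longrightarrow> emap const e * E p = E p"
    "p < n \<Longrightarrow> self_adjoint (E p) F"
    "p < n \<Longrightarrow> emap at0 (E p) \<noteq> 0"
    "p < n \<Longrightarrow> p' < n \<Longrightarrow> p \<noteq> p' \<Longrightarrow> ctr (E p \<star> E p' \<star> w) F = 0"
    "fscale q (ctr w F) = (\<Sum>p<n. fscale (r p) (ctr (E p \<star> w) F))"
  using assms unfolding splitting_family_def by blast+

definition deforms_into ::
  "nat \<Rightarrow> ('k::field, 'r::finite) dpower \<Rightarrow> ('k, 'r) endo \<Rightarrow> nat \<Rightarrow> bool" where
  "deforms_into d f e n \<longleftrightarrow> (\<exists>F E r q. splitting_family d f e n F E r q)"

definition nondegenerate :: "('k::field, 'r::finite) dpower \<Rightarrow> bool" where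
  "nondegenerate f \<longleftrightarrow> (\<forall>v. ctr v f = 0 \<longrightarrow> v = 0)"

lemma nondegenerate_endo:
  assumes "nondegenerate f" "\<And>j. ctr (A \<star> axis j 1) f = 0"
  shows "A = 0"
  by (rule endo_eqI_axis) (use assms in \<open>auto simp: nondegenerate_def\<close>)

text \<open>
  The pieces are \<open>(r p / q) E\<^sub>p F\<close>. Applying \<open>E\<^sub>p\<close> to the identity
  \<open>q = \<Sum> r\<^sub>p E\<^sub>p\<close> gives \<open>r\<^sub>p E\<^sub>p\<^sup>2 = q E\<^sub>p\<close>, so the directions \<open>E\<^sub>p e\<^sub>i\<close> separate the pieces. A piece
  that vanished would vanish at \<open>t = 0\<close>, but the form \<open>f\<close> is nondegenerate there.
\<close>

lemma deforms_into_splits: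
  fixes f :: "('k::field, 'r::finite) dpower"
  assumes f: "f \<in> homogeneous d" "nondegenerate f" and d: "d \<ge> 1"
    and br: "deforms_into d f 1 n" and mn: "m + 1 \<le> n"
  shows "\<exists>ft :: ('k tpoly, 'r) dpower. ft \<in> homogeneous_over (tpolys 1) d \<and>
           specialize (\<lambda>_. 0) ft = f \<and> splits_regularly_over (trats 1) d m (generic_form ft)"
proof -
  from br obtain F E r q where "splitting_family d f 1 n F E r q"
    unfolding deforms_into_def by blast
  note fam = splitting_familyD[OF this]
  have F: "F \<in> homogeneous d" "q \<noteq> 0" "\<And>v. ctr v (fmapc at0 F) = ctr v f"
    and E: "\<And>p. p < n \<Longrightarrow> self_adjoint (E p) F" "\<And>p. p < n \<Longrightarrow> emap at0 (E p) \<noteq> 0"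
    and orth: "\<And>p p' v. p < n \<Longrightarrow> p' < n \<Longrightarrow> p \<noteq> p' \<Longrightarrow> ctr (E p \<star> E p' \<star> v) F = 0"
    and part: "\<And>v. fscale q (ctr v F) = (\<Sum>p<n. fscale (r p) (ctr (E p \<star> v) F))"
    using fam by simp_all
  note h0 = is_hom_eval0[where 'a='k]
  have F0: "fmapc at0 F = f"
    by (rule form_eqI[of _ d]) (use F f d fmapc_homogeneous[OF h0] in auto)
  have E0: "\<exists>i. ctr (E p \<star> axis i 1) F \<noteq> 0" if "p < n" for p
  proof (rule ccontr)
    assume "\<not> ?thesis"
    then have "fmapc at0 (ctr (E p \<star> axis i 1) F) = 0" for i by (simp add: fmapc_0[OF h0])
    then have "ctr (emap at0 (E p) \<star> axis i 1) f = 0" for i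
      by (simp add: fmapc_ctr[OF h0] F0 emap_axis[OF h0])
    then have "emap at0 (E p) = 0" by (rule nondegenerate_endo[OF f(2)])
    with E(2) that show False by blast
  qed
  \<comment> \<open>The embedding of \<open>K[t]\<close> into the field of rational functions.\<close>
  define \<iota> where "\<iota> p = to_fract (tpoly_of p)" for p :: "'k poly"
  have h\<iota>: "is_hom \<iota>"
    unfolding is_hom_def \<iota>_def
    by (simp only: is_homD[OF is_hom_tpoly_of] to_fract_add to_fract_mult to_fract_0 to_fract_1) simp
  have \<iota>0: "\<iota> p = 0 \<longleftrightarrow> p = 0" for p by (simp add: \<iota>_def to_fract_eq_0_iff)
  have \<iota>t: "\<iota> a / \<iota> b \<in> trats 1" if "b \<noteq> 0" for a b
    unfolding trats_def \<iota>_def using that tpoly_of_tpolys by fastforce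
  have inj: "fmapc \<iota> g = 0 \<longleftrightarrow> g = 0" for g :: "('k poly, 'r) dpower"
    by (simp add: poly_mapping_eq_iff fun_eq_iff lookup_fmapc[OF h\<iota>] \<iota>0)
  have "\<exists>G. \<forall>p<n. G p \<in> homogeneous d \<and> (\<forall>v. ctr v (G p) = ctr (E p \<star> v) F)"
    using self_adjoint_form[OF F(1) _ E(1)] d by (intro choice_iff'[THEN iffD1]) (metis less_eq_Suc_le One_nat_def)
  then obtain G where G: "\<And>p. p < n \<Longrightarrow> G p \<in> homogeneous d" "\<And>p v. p < n \<Longrightarrow> ctr v (G p) = ctr (E p \<star> v) F"
    by blast
  have sumG: "fscale q F = (\<Sum>p<n. fscale (r p) (G p))"
  proof (rule form_eqI[of _ d])
    show "ctr (axis i 1) (fscale q F) = ctr (axis i 1) (\<Sum>p<n. fscale (r p) (G p))" for i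
      by (simp add: ctr_fscale ctr_sum G part)
  qed (use F G d in \<open>auto intro!: homogeneous_fscale homogeneous_sum\<close>)
  have rE: "fscale (r p) (ctr (E p \<star> E p \<star> v) F) = fscale q (ctr (E p \<star> v) F)" if "p < n" for p v
  proof -
    have "fscale q (ctr (E p \<star> v) F) = (\<Sum>p'<n. if p' = p then fscale (r p) (ctr (E p \<star> E p \<star> v) F) else 0)"
      unfolding part by (rule sum.cong) (use that orth in auto)
    then show ?thesis using that by simp
  qed
  have r: "r p \<noteq> 0" if "p < n" for p
    using rE[OF that] E0[OF that] F(2) by (metis fscale_0(1) fscale_eq_0_iff)
  define g where "g p = fscale (\<iota> (r p) / \<iota> q) (fmapc \<iota> (G p))" for p
  have split: "splits_regularly_over (trats 1) d m (fmapc \<iota> F)"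
  proof (rule splits_regularly_overI[where n = n and g = g and
        u = "\<lambda>p i. vmap \<iota> (E p \<star> axis i 1)" and a = "\<lambda>p. \<iota> q / \<iota> (r p)"])
    show "0 \<in> (trats 1 :: 'k tpoly fract set)"
      using \<iota>t[of 1 0] by (simp add: is_homD[OF h\<iota>])
    show "fmapc \<iota> F = (\<Sum>p<n. g p)"
    proof -
      have "fscale (1 / \<iota> q) (fscale (\<iota> q) (fmapc \<iota> F)) = fscale (1 / \<iota> q) (fmapc \<iota> (\<Sum>p<n. fscale (r p) (G p)))"
        by (simp add: fmapc_fscale[OF h\<iota>, symmetric] sumG)
      then show ?thesis
        by (simp add: g_def fscale_fscale fmapc_fscale[OF h\<iota>] fmapc_sum[OF h\<iota>] fscale_sum \<iota>0 F(2))
    qed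
    fix I assume I: "I \<subseteq> {..<n}"
    show "(\<Sum>p\<in>I. g p) \<in> homogeneous_over (trats 1) d"
    proof -
      have "(\<Sum>p\<in>I. g p) = fscale (1 / \<iota> q) (fmapc \<iota> (\<Sum>p\<in>I. fscale (r p) (G p)))"
        by (simp add: g_def fscale_fscale fmapc_fscale[OF h\<iota>] fmapc_sum[OF h\<iota>] fscale_sum)
      moreover have "Poly_Mapping.lookup (fscale (1 / \<iota> q) (fmapc \<iota> H)) \<alpha> \<in> trats 1" for H :: "('k poly, 'r) dpower" and \<alpha>
        using \<iota>t[OF F(2)] by (simp add: lookup_fscale lookup_fmapc[OF h\<iota>])
      moreover have "(\<Sum>p\<in>I. g p) \<in> homogeneous d"
        unfolding g_def by (intro homogeneous_sum homogeneous_fscale fmapc_homogeneous[OF h\<iota>] G(1)) (use I in auto)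
      ultimately show ?thesis by (simp add: homogeneous_over_def)
    qed
  next
    fix p assume p: "p < n"
    show "g p \<noteq> 0"
      using E0[OF p] G(2)[OF p] r[OF p] F(2) by (auto simp: g_def fscale_eq_0_iff inj \<iota>0)
    show "\<iota> q / \<iota> (r p) \<noteq> 0" using r[OF p] F(2) by (simp add: \<iota>0)
    show "ctr (vmap \<iota> (E p \<star> axis i 1)) (g p) = fscale (\<iota> q / \<iota> (r p)) (ctr (axis i 1) (g p))" for i
    proof -
      have "ctr (vmap \<iota> (E p \<star> axis i 1)) (g p) = fscale (1 / \<iota> q) (fmapc \<iota> (fscale (r p) (ctr (E p \<star> E p \<star> axis i 1) F)))"
        by (simp add: g_def ctr_fscale fmapc_ctr[OF h\<iota>, symmetric] G p fmapc_fscale[OF h\<iota>] fscale_fscale)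
      also have "\<dots> = fmapc \<iota> (ctr (E p \<star> axis i 1) F)"
        using F(2) by (simp add: rE p fmapc_fscale[OF h\<iota>] fscale_fscale \<iota>0)
      also have "\<dots> = ctr (vmap \<iota> (axis i 1)) (fmapc \<iota> (G p))"
        by (simp add: fmapc_ctr[OF h\<iota>, symmetric] G p)
      finally show ?thesis
        using F(2) r[OF p] by (simp add: g_def ctr_fscale fscale_fscale \<iota>0 vmap_axis[OF h\<iota>])
    qed
    fix p' i assume p': "p' < n" "p \<noteq> p'"
    have "ctr (vmap \<iota> (E p \<star> axis i 1)) (g p') = fscale (\<iota> (r p') / \<iota> q) (fmapc \<iota> (ctr (E p' \<star> E p \<star> axis i 1) F))"
      by (simp add: g_def ctr_fscale fmapc_ctr[OF h\<iota>, symmetric] G p')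
    then show "ctr (vmap \<iota> (E p \<star> axis i 1)) (g p') = 0"
      using orth[OF p'(1) p] p'(2) by (simp add: fmapc_0[OF h\<iota>])
  qed (use d mn in auto)
  define ft where "ft = fmapc tpoly_of F"
  have lft: "Poly_Mapping.lookup ft \<alpha> = tpoly_of (Poly_Mapping.lookup F \<alpha>)" for \<alpha>
    by (simp add: ft_def lookup_fmapc[OF is_hom_tpoly_of])
  have "ft \<in> homogeneous_over (tpolys 1) d"
    using fmapc_homogeneous[OF is_hom_tpoly_of F(1)] by (simp add: homogeneous_over_def lft tpoly_of_tpolys[simplified] ft_def[symmetric])
  moreover have "specialize (\<lambda>_. 0) ft = f"
  proof (rule poly_mapping_eqI)
    fix \<alpha>
    have "Poly_Mapping.lookup (specialize (\<lambda>_. 0) ft) \<alpha> = at0 (Poly_Mapping.lookup F \<alpha>)"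
      by (simp add: specialize_def lookup_map_zero teval_0 lft flip: teval_tpoly_of)
    then show "Poly_Mapping.lookup (specialize (\<lambda>_. 0) ft) \<alpha> = Poly_Mapping.lookup f \<alpha>"
      by (simp add: F0[symmetric] lookup_fmapc[OF h0])
  qed
  moreover have "generic_form ft = fmapc \<iota> F"
    by (rule poly_mapping_eqI) (simp add: generic_form_def lookup_map_zero lft lookup_fmapc[OF h\<iota>] \<iota>_def)
  ultimately show ?thesis using split by auto
qed

text \<open>
  Take the sum of the two families and all operators together, the scalars being multiplied by
  the \<open>q\<close> of the other family. Either family is killed by the idempotent of the other one,
  so no mixed terms arise.
\<close>

lemma deforms_into_add:
  fixes f :: "('k::field, 'r::finite) dpower"
  assumes d: "d \<ge> 2"
    and e: "e1 * e2 = 0" "e2 * e1 = 0" "e1 * e1 = e1" "e2 * e2 = e2"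
    and d1: "deforms_into d f e1 n1" and d2: "deforms_into d f e2 n2"
  shows "deforms_into d f (e1 + e2) (n1 + n2)"
proof -
  note h0 = is_hom_eval0[where 'a='k] and hc = is_hom_const_poly[where 'a='k]
  let ?c = "emap const"
  from d1 obtain F1 E1 r1 q1 where 1: "splitting_family d f e1 n1 F1 E1 r1 q1" by (auto simp: deforms_into_def)
  from d2 obtain F2 E2 r2 q2 where 2: "splitting_family d f e2 n2 F2 E2 r2 q2" by (auto simp: deforms_into_def)
  note s1 = splitting_familyD[OF 1] and s2 = splitting_familyD[OF 2]
  have c: "?c e1 * ?c e2 = 0" "?c e2 * ?c e1 = 0" "?c e1 * ?c e1 = ?c e1" "?c e2 * ?c e2 = ?c e2"
    using e by (simp_all add: emap_mult[OF hc, symmetric] emap_0[OF hc])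
  have z: "ctr (?c e1 \<star> v) F2 = 0" "ctr (?c e2 \<star> v) F1 = 0" for v
  proof -
    have "ctr (?c e1 \<star> v) F2 = ctr (?c e2 \<star> ?c e1 \<star> v) F2" by (rule s2(4)[symmetric])
    then show "ctr (?c e1 \<star> v) F2 = 0" by (simp add: app_mult[symmetric] c)
    have "ctr (?c e2 \<star> v) F1 = ctr (?c e1 \<star> ?c e2 \<star> v) F1" by (rule s1(4)[symmetric])
    then show "ctr (?c e2 \<star> v) F1 = 0" by (simp add: app_mult[symmetric] c)
  qed
  have x1: "ctr (E1 p \<star> v) F2 = 0" if "p < n1" for p v
    using z(1)[of "E1 p \<star> v"] by (simp add: app_mult[symmetric] s1(5)[OF that])
  have x2: "ctr (E2 p \<star> v) F1 = 0" if "p < n2" for p v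
    using z(2)[of "E2 p \<star> v"] by (simp add: app_mult[symmetric] s2(5)[OF that])
  \<comment> \<open>The radical of \<open>F\<close> is stable under operators that are self-adjoint for \<open>F\<close>.\<close>
  have y: "ctr (A \<star> v) F = 0" if "self_adjoint A F" "F \<in> homogeneous d" "ctr v F = 0"
    for A v and F :: "('k poly, 'r) dpower"
  proof (rule form_zeroI[of _ "d - 1"])
    show "ctr (A \<star> v) F \<in> homogeneous (d - 1)" by (rule homogeneous_ctr) fact
    show "ctr w (ctr (A \<star> v) F) = 0" for w
      using self_adjointD[OF that(1), of w v] that(3) by (metis ctr_0 ctr_commute)
  qed (use d in auto)
  define E where "E p = (if p < n1 then E1 p else E2 (p - n1))" for p
  define r where "r p = (if p < n1 then q2 * r1 p else q1 * r2 (p - n1))" for p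
  have E1: "E p = E1 p" "r p = q2 * r1 p" if "p < n1" for p using that by (auto simp: E_def r_def)
  have E2: "E (n1 + p) = E2 p" "r (n1 + p) = q1 * r2 p" for p by (auto simp: E_def r_def)
  have split_less: "(\<forall>p<n1+n2. P p) \<longleftrightarrow> (\<forall>p<n1. P p) \<and> (\<forall>p<n2. P (n1 + p))" for P
    by (metis add_less_cancel_left le_add_diff_inverse not_le trans_less_add1)
  have "splitting_family d f (e1 + e2) (n1 + n2) (F1 + F2) E r (q1 * q2)"
    unfolding splitting_family_def
  proof (intro conjI)
    show "F1 + F2 \<in> homogeneous d" by (rule homogeneous_add[OF s1(1) s2(1)])
    show "q1 * q2 \<noteq> 0" using s1(2) s2(2) by simp
    show "\<forall>v. ctr v (fmapc at0 (F1 + F2)) = ctr ((e1 + e2) \<star> v) f"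
      by (simp add: fmapc_add[OF h0] ctr_add ctr_vadd app_add s1(3) s2(3))
    show "\<forall>v. ctr (?c (e1 + e2) \<star> v) (F1 + F2) = ctr v (F1 + F2)"
      by (simp add: emap_add[OF hc] app_add ctr_add ctr_vadd z s1(4) s2(4))
    have xx1: "ctr v (ctr (E1 p \<star> w) F2) = 0" "ctr (E1 p \<star> w) (ctr v F2) = 0" if "p < n1" for p v w
      using x1[OF that] ctr_commute[of "E1 p \<star> w" v F2] by simp_all
    have xx2: "ctr v (ctr (E2 p \<star> w) F1) = 0" "ctr (E2 p \<star> w) (ctr v F1) = 0" if "p < n2" for p v w
      using x2[OF that] ctr_commute[of "E2 p \<star> w" v F1] by simp_all
    have a1: "self_adjoint (E1 p) (F1 + F2)" if "p < n1" for p
      using self_adjointD[OF s1(6)[OF that]] by (simp add: self_adjoint_def ctr_add xx1[OF that])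
    have a2: "self_adjoint (E2 p) (F1 + F2)" if "p < n2" for p
      using self_adjointD[OF s2(6)[OF that]] by (simp add: self_adjoint_def ctr_add xx2[OF that])
    have b1: "?c (e1 + e2) * E1 p = E1 p" if "p < n1" for p
    proof -
      have "?c e2 * E1 p = ?c e2 * ?c e1 * E1 p" by (simp add: mult.assoc s1(5)[OF that])
      then show ?thesis by (simp add: emap_add[OF hc] distrib_right c s1(5)[OF that])
    qed
    have b2: "?c (e1 + e2) * E2 p = E2 p" if "p < n2" for p
    proof -
      have "?c e1 * E2 p = ?c e1 * ?c e2 * E2 p" by (simp add: mult.assoc s2(5)[OF that])
      then show ?thesis by (simp add: emap_add[OF hc] distrib_right c s2(5)[OF that])
    qed
    show "\<forall>p<n1 + n2. ?c (e1 + e2) * E p = E p \<and> self_adjoint (E p) (F1 + F2) \<and> emap at0 (E p) \<noteq> 0"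
      unfolding split_less by (simp add: E1 E2 a1 a2 b1 b2 s1(7) s2(7))
    have o12: "ctr (E1 p \<star> E2 p' \<star> v) (F1 + F2) = 0" if "p < n1" "p' < n2" for p p' v
      using that x1 x2 y[OF s1(6) s1(1)] by (simp add: ctr_add)
    have o21: "ctr (E2 p \<star> E1 p' \<star> v) (F1 + F2) = 0" if "p < n2" "p' < n1" for p p' v
      using that x1 x2 y[OF s2(6) s2(1)] by (simp add: ctr_add)
    have o11: "ctr (E1 p \<star> E1 p' \<star> v) (F1 + F2) = 0" if "p < n1" "p' < n1" "p \<noteq> p'" for p p' v
      using that x1 s1(8) by (simp add: ctr_add)
    have o22: "ctr (E2 p \<star> E2 p' \<star> v) (F1 + F2) = 0" if "p < n2" "p' < n2" "p \<noteq> p'" for p p' v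
      using that x2 s2(8) by (simp add: ctr_add)
    show "\<forall>p<n1 + n2. \<forall>p'<n1 + n2. p \<noteq> p' \<longrightarrow> (\<forall>v. ctr (E p \<star> E p' \<star> v) (F1 + F2) = 0)"
      unfolding split_less using o12 o21 o11 o22 by (simp add: E1 E2)
    show "\<forall>v. fscale (q1 * q2) (ctr v (F1 + F2)) = (\<Sum>p<n1 + n2. fscale (r p) (ctr (E p \<star> v) (F1 + F2)))"
    proof
      fix v
      have sp: "(\<Sum>p<n1 + n2. h p) = (\<Sum>p<n1. h p) + (\<Sum>p<n2. h (n1 + p))" for h :: "nat \<Rightarrow> ('k poly, 'r) dpower"
        by (induction n2) (simp_all add: add.assoc)
      have "(\<Sum>p<n1 + n2. fscale (r p) (ctr (E p \<star> v) (F1 + F2))) =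
        (\<Sum>p<n1. fscale (q2 * r1 p) (ctr (E1 p \<star> v) F1)) + (\<Sum>p<n2. fscale (q1 * r2 p) (ctr (E2 p \<star> v) F2))"
        unfolding sp by (intro arg_cong2[where f = "(+)"] sum.cong refl) (simp_all add: E1 E2 ctr_add x1 x2)
      also have "\<dots> = fscale q2 (\<Sum>p<n1. fscale (r1 p) (ctr (E1 p \<star> v) F1)) + fscale q1 (\<Sum>p<n2. fscale (r2 p) (ctr (E2 p \<star> v) F2))"
        by (simp add: fscale_sum fscale_fscale)
      also have "\<dots> = fscale q2 (fscale q1 (ctr v F1)) + fscale q1 (fscale q2 (ctr v F2))"
        by (simp add: s1(9) s2(9))
      finally show "fscale (q1 * q2) (ctr v (F1 + F2)) = (\<Sum>p<n1 + n2. fscale (r p) (ctr (E p \<star> v) (F1 + F2)))"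
        by (simp add: ctr_add fscale_add fscale_fscale mult.commute)
    qed
  qed
  then show ?thesis by (auto simp: deforms_into_def)
qed

section \<open>Linear independence of finite families\<close>

definition indep :: "nat \<Rightarrow> (nat \<Rightarrow> 'k::field ^ 'r::finite) \<Rightarrow> bool" where
  "indep n b \<longleftrightarrow> (\<forall>c. (\<Sum>i<n. c i *s b i) = 0 \<longrightarrow> (\<forall>i<n. c i = 0))"

lemma indepD: "indep n b \<Longrightarrow> (\<Sum>i<n. c i *s b i) = 0 \<Longrightarrow> i < n \<Longrightarrow> c i = 0"
  unfolding indep_def by blast

lemma indep_inj: assumes "indep n b" shows "inj_on b {..<n}"
proof (rule inj_onI, rule ccontr)
  fix i j assume ij: "i \<in> {..<n}" "j \<in> {..<n}" "b i = b j" "i \<noteq> j"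
  let ?c = "\<lambda>l. (if l = i then 1 else 0) - (if l = j then 1 else 0) :: 'a"
  have "(\<Sum>l<n. ?c l *s b l) = (\<Sum>l<n. (if l = i then 1 else 0) *s b l) - (\<Sum>l<n. (if l = j then 1 else 0) *s b l)"
    unfolding sum_subtractf[symmetric] by (rule sum.cong) (simp_all add: vec.scale_left_diff_distrib)
  also have "\<dots> = b i - b j" using ij by (simp add: if_distrib[of "\<lambda>c. c *s _"] cong: if_cong)
  finally have "(\<Sum>l<n. ?c l *s b l) = 0" using ij by simp
  then have "?c i = 0" using indepD[OF assms, of ?c i] ij(1) by blast
  with ij(4) show False by simp
qed

lemma indep_independent: assumes "indep n b" shows "vec.independent (b ` {..<n})"
proof
  assume "vec.dependent (b ` {..<n})"
  then obtain u where u: "\<exists>v\<in>b ` {..<n}. u v \<noteq> 0" "(\<Sum>v\<in>b ` {..<n}. u v *s v) = 0"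
    using vec.dependent_finite[of "b ` {..<n}"] by blast
  from u(2) have "(\<Sum>i<n. u (b i) *s b i) = 0"
    by (simp add: sum.reindex[OF indep_inj[OF assms]])
  then have "\<forall>i<n. u (b i) = 0" using indepD[OF assms, of "\<lambda>i. u (b i)"] by blast
  with u(1) show False by auto
qed

lemma indep_le_card:
  fixes b :: "nat \<Rightarrow> 'k::field ^ 'r::finite"
  assumes "indep n b" shows "n \<le> CARD('r)"
proof -
  have "card (b ` {..<n}) \<le> vec.dim (UNIV :: ('k ^ 'r) set)"
    by (rule vec.independent_card_le_dim) (simp_all add: indep_independent[OF assms])
  then show ?thesis by (simp add: card_image[OF indep_inj[OF assms]] vec.dim_UNIV card_cart_basis)
qed

lemma indep_spans:
  fixes b :: "nat \<Rightarrow> 'k::field ^ 'r::finite"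
  assumes "indep n b" "CARD('r) \<le> n"
  obtains c where "v = (\<Sum>i<n. c i *s b i)"
proof -
  define b' where "b' = b(n := v)"
  have "\<not> indep (Suc n) b'" using indep_le_card[of "Suc n" b'] assms(2) by auto
  then obtain c j where c: "(\<Sum>i<Suc n. c i *s b' i) = 0" "j < Suc n" "c j \<noteq> 0"
    unfolding indep_def by blast
  then have e: "(\<Sum>i<n. c i *s b i) + c n *s v = 0"
    by (simp add: b'_def)
  have "c n \<noteq> 0"
  proof
    assume "c n = 0"
    then have "\<forall>i<n. c i = 0" using e indepD[OF assms(1), of c] by simp
    with \<open>c n = 0\<close> c show False by (auto simp: less_Suc_eq)
  qed
  have "v = (\<Sum>i<n. (- c i / c n) *s b i)"
  proof -
    have "(- 1 / c n) *s (\<Sum>i<n. c i *s b i) = v"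
      using e \<open>c n \<noteq> 0\<close> by (simp add: eq_neg_iff_add_eq_0[symmetric] vec_eq_iff)
    then show ?thesis by (simp add: vec.scale_sum_right)
  qed
  then show ?thesis by (rule that)
qed

text \<open>
  Dual vectors, given by their coordinates so that they define operators of rank one.
\<close>

lemma indep_functional:
  assumes "indep n b" "l < n"
  obtains \<zeta> where "\<And>i. i < n \<Longrightarrow> (\<Sum>j\<in>UNIV. \<zeta> $ j * b i $ j) = (if i = l then 1 else 0)"
proof -
  obtain a :: 'b where True by simp
  obtain g where g: "Vector_Spaces.linear (*s) (*s) g"
    "\<And>x. x \<in> b ` {..<n} \<Longrightarrow> g x = (if x = b l then axis a 1 else 0)"
    using vec.linear_independent_extend[OF indep_independent[OF assms(1)], of "\<lambda>x. if x = b l then axis a 1 else 0"]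
    by blast
  interpret g: Vector_Spaces.linear "(*s)" "(*s)" g by (rule g(1))
  define \<zeta> where "\<zeta> = (\<chi> j. g (axis j 1) $ a)"
  have lin: "g v $ a = (\<Sum>j\<in>UNIV. \<zeta> $ j * v $ j)" for v
  proof -
    have "g v = (\<Sum>j\<in>UNIV. v $ j *s g (axis j 1))"
      by (subst vec_expand[of v]) (simp only: g.sum g.scale)
    then show ?thesis by (simp add: \<zeta>_def mult.commute)
  qed
  have "(\<Sum>j\<in>UNIV. \<zeta> $ j * b i $ j) = (if i = l then 1 else 0)" if "i < n" for i
    using g(2)[of "b i"] that assms(2) indep_inj[OF assms(1)]
    by (auto simp: lin[symmetric] inj_on_def axis_def)
  then show ?thesis by (rule that)
qed

lemma power_app_add: "(N ^ (i + j)) \<star> v = (N ^ i) \<star> (N ^ j) \<star> v"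
  by (simp add: power_add app_mult)

lemma power_app_zero: "(N ^ k) \<star> v = 0 \<Longrightarrow> k \<le> m \<Longrightarrow> (N ^ m) \<star> v = 0"
  by (metis app_vzero le_add_diff_inverse2 power_app_add)

text \<open>
  Multiplying a relation by the right power of \<open>N\<close> isolates its lowest remaining coefficient.
\<close>

lemma nilpotent_indep:
  fixes e0 :: "'k::field ^ 'r::finite"
  assumes "(N ^ k) \<star> e0 = 0" "(N ^ (k - 1)) \<star> e0 \<noteq> 0"
  shows "indep k (\<lambda>i. (N ^ i) \<star> e0)"
  unfolding indep_def
proof (intro allI impI)
  fix c i assume c: "(\<Sum>i<k. c i *s (N ^ i) \<star> e0) = 0" and "i < k"
  show "c i = 0" using \<open>i < k\<close>
  proof (induction i rule: less_induct)
    case (less i)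
    have "0 = (N ^ (k - 1 - i)) \<star> (\<Sum>j<k. c j *s (N ^ j) \<star> e0)" unfolding c by simp
    also have "\<dots> = (\<Sum>j<k. c j *s (N ^ (k - 1 - i + j)) \<star> e0)"
      by (simp only: app_vsum app_vscale power_app_add)
    also have "\<dots> = (\<Sum>j<k. if j = i then c i *s (N ^ (k - 1)) \<star> e0 else 0)"
    proof (rule sum.cong[OF refl])
      fix j assume j: "j \<in> {..<k}"
      consider "j < i" | "j = i" | "j > i" by linarith
      then show "c j *s (N ^ (k - 1 - i + j)) \<star> e0 = (if j = i then c i *s (N ^ (k - 1)) \<star> e0 else 0)"
      proof cases
        case 1
        then have "c j = 0" using less.IH j by simp
        with 1 show ?thesis by simp
      next
        case 2
        then have "k - 1 - i + j = k - 1" using \<open>i < k\<close> less.prems by simp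
        then show ?thesis using 2 by simp
      next
        case 3
        then have "k \<le> k - 1 - i + j" using less.prems by simp
        then show ?thesis using 3 power_app_zero[OF assms(1)] by simp
      qed
    qed
    also have "\<dots> = c i *s (N ^ (k - 1)) \<star> e0" using less.prems by simp
    finally show ?case using assms(2) by simp
  qed
qed

section \<open>Jordan systems of nilpotent endomorphisms\<close>

text \<open>
  A Jordan basis of \<open>N\<close> on the range of \<open>Q\<close>, in terms of operators instead of vectors. If
  \<open>u\<^sub>1, u\<^sub>2, \<dots>\<close> generate the Jordan chains and \<open>v = \<Sum> a\<^sub>c\<^sub>j N\<^sup>j u\<^sub>c\<close>, then \<open>\<pi>\<^sub>j v = \<Sum> a\<^sub>c\<^sub>j u\<^sub>c\<close>, so that
  \<open>v = \<Sum> N\<^sup>j \<pi>\<^sub>j v\<close>. Multiplication by \<open>N\<close> shifts coefficients, \<open>\<pi>\<^sub>j\<^sub>+\<^sub>1 N = \<pi>\<^sub>j\<close>, except at the ends of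
  chains, that is on generators killed by \<open>N\<^sup>j\<^sup>+\<^sup>1\<close>; this explains the power of \<open>N\<close> in the
  second last condition.
\<close>

definition jordan_system ::
  "('a::comm_ring_1, 'r::finite) endo \<Rightarrow> ('a, 'r) endo \<Rightarrow> (nat \<Rightarrow> ('a, 'r) endo) \<Rightarrow> nat \<Rightarrow> bool" where
  "jordan_system N Q \<pi> k \<longleftrightarrow> (\<forall>j\<ge>k. \<pi> j = 0) \<and> (\<forall>j. Q * \<pi> j = \<pi> j) \<and> (\<forall>j. \<pi> j * Q = \<pi> j) \<and>
     (\<Sum>j<k. N ^ j * \<pi> j) = Q \<and> \<pi> 0 * N = 0 \<and>
     (\<forall>j. N ^ Suc j * (\<pi> j - \<pi> (Suc j) * N) = 0) \<and>
     (\<forall>i j. \<pi> j * N ^ i * \<pi> i = (if i = j then \<pi> j else 0))"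

lemma jordan_systemD:
  assumes "jordan_system N Q \<pi> k"
  shows "k \<le> j \<Longrightarrow> \<pi> j = 0" "Q * \<pi> j = \<pi> j" "\<pi> j * Q = \<pi> j" "(\<Sum>j<k. N ^ j * \<pi> j) = Q"
    "\<pi> 0 * N = 0" "N ^ Suc j * (\<pi> j - \<pi> (Suc j) * N) = 0"
    "\<pi> j * N ^ i * \<pi> i = (if i = j then \<pi> j else 0)"
  using assms unfolding jordan_system_def by blast+

lemma power_commute_endo: "N * Q = Q * N \<Longrightarrow> N ^ i * Q = Q * N ^ i" for N :: "'a::ring_1"
  by (rule power_commuting_commutes)

lemma jordan_system_add:
  assumes 1: "jordan_system N Q \<pi> k" and 2: "jordan_system N Q' \<pi>' k"
    and c: "Q * Q' = 0" "Q' * Q = 0" "N * Q = Q * N" "N * Q' = Q' * N"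
  shows "jordan_system N (Q + Q') (\<lambda>j. \<pi> j + \<pi>' j) k"
proof -
  note s1 = jordan_systemD[OF 1] and s2 = jordan_systemD[OF 2]
  have x: "A * N ^ i * B' = 0" if "A * Q = A" "Q' * B' = B'" for A B' i
  proof -
    have "A * N ^ i * B' = (A * Q) * N ^ i * (Q' * B')" using that by simp
    also have "\<dots> = A * (Q * N ^ i) * Q' * B'" by (simp only: mult.assoc)
    also have "\<dots> = A * (N ^ i * Q) * Q' * B'" by (simp only: power_commute_endo[OF c(3)])
    also have "\<dots> = A * N ^ i * (Q * Q') * B'" by (simp only: mult.assoc)
    finally show ?thesis by (simp add: c)
  qed
  have x': "A * N ^ i * B' = 0" if "A * Q' = A" "Q * B' = B'" for A B' i
  proof -
    have "A * N ^ i * B' = (A * Q') * N ^ i * (Q * B')" using that by simp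
    also have "\<dots> = A * (Q' * N ^ i) * Q * B'" by (simp only: mult.assoc)
    also have "\<dots> = A * (N ^ i * Q') * Q * B'" by (simp only: power_commute_endo[OF c(4)])
    also have "\<dots> = A * N ^ i * (Q' * Q) * B'" by (simp only: mult.assoc)
    finally show ?thesis by (simp add: c)
  qed
  have y: "Q * \<pi>' j = 0" "Q' * \<pi> j = 0" "\<pi> j * Q' = 0" "\<pi>' j * Q = 0" for j
  proof -
    have "Q * (Q' * \<pi>' j) = 0" "Q' * (Q * \<pi> j) = 0" "\<pi> j * Q * Q' = 0" "\<pi>' j * Q' * Q = 0"
      by (simp_all add: mult.assoc[symmetric] c) (simp_all add: mult.assoc c)
    then show "Q * \<pi>' j = 0" "Q' * \<pi> j = 0" "\<pi> j * Q' = 0" "\<pi>' j * Q = 0"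
      by (simp_all add: s1 s2)
  qed
  show ?thesis unfolding jordan_system_def
  proof (intro conjI allI impI)
    show "\<pi> j + \<pi>' j = 0" if "k \<le> j" for j using that s1(1) s2(1) by simp
    show "(Q + Q') * (\<pi> j + \<pi>' j) = \<pi> j + \<pi>' j" for j by (simp add: algebra_simps s1(2) s2(2) y)
    show "(\<pi> j + \<pi>' j) * (Q + Q') = \<pi> j + \<pi>' j" for j by (simp add: algebra_simps s1(3) s2(3) y)
    show "(\<Sum>j<k. N ^ j * (\<pi> j + \<pi>' j)) = Q + Q'"
      by (simp add: distrib_left sum.distrib s1(4) s2(4))
    show "(\<pi> 0 + \<pi>' 0) * N = 0" by (simp add: distrib_right s1(5) s2(5))
    show "N ^ Suc j * (\<pi> j + \<pi>' j - (\<pi> (Suc j) + \<pi>' (Suc j)) * N) = 0" for j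
    proof -
      have "\<pi> j + \<pi>' j - (\<pi> (Suc j) + \<pi>' (Suc j)) * N = (\<pi> j - \<pi> (Suc j) * N) + (\<pi>' j - \<pi>' (Suc j) * N)"
        by (simp add: algebra_simps)
      then show ?thesis using s1(6)[of j] s2(6)[of j] by (simp only: distrib_left) simp
    qed
    fix i j
    have "(\<pi> j + \<pi>' j) * N ^ i * (\<pi> i + \<pi>' i) = \<pi> j * N ^ i * \<pi> i + \<pi>' j * N ^ i * \<pi>' i"
      using x[OF s1(3)[of j] s2(2)[of i], of i] x'[OF s2(3)[of j] s1(2)[of i], of i]
      by (simp add: distrib_left distrib_right)
    then show "(\<pi> j + \<pi>' j) * N ^ i * (\<pi> i + \<pi>' i) = (if i = j then \<pi> j + \<pi>' j else 0)"
      by (simp add: s1(7) s2(7))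
  qed
qed

text \<open>
  \<open>R v\<close> is \<open>e0\<close> times the last coordinate of \<open>v\<close> along the chain of \<open>e0\<close>. The other coordinates
  are obtained by applying powers of \<open>N\<close> first.
\<close>

lemma cyclic_functional:
  fixes Q N :: "('k::field, 'r::finite) endo"
  assumes Q: "Q * Q = Q" "N * Q = Q * N" and k: "k \<ge> 1" "N ^ k * Q = 0"
    and e0: "Q \<star> e0 = e0" "(N ^ (k - 1)) \<star> e0 \<noteq> 0"
  obtains R where "Q * R = R" "R * Q = R" "\<And>v. \<exists>c. R \<star> v = c *s e0"
    "\<And>i. R \<star> (N ^ i) \<star> e0 = (if i = k - 1 then e0 else 0)"
proof -
  have z: "(N ^ i) \<star> e0 = 0" if "k \<le> i" for i
  proof -
    have "(N ^ k) \<star> e0 = (N ^ k * Q) \<star> e0" by (simp only: app_mult e0(1))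
    then have "(N ^ k) \<star> e0 = 0" by (simp add: k(2))
    then show ?thesis using that by (rule power_app_zero)
  qed
  have "indep k (\<lambda>i. (N ^ i) \<star> e0)" using nilpotent_indep[OF z[OF order_refl] e0(2)] .
  then obtain \<zeta> where \<zeta>: "\<And>i. i < k \<Longrightarrow> (\<Sum>j\<in>UNIV. \<zeta> $ j * ((N ^ i) \<star> e0) $ j) = (if i = k - 1 then 1 else 0)"
    by (rule indep_functional[of k _ "k - 1"]) (use k(1) in auto)
  define Z where "Z v = (\<Sum>j\<in>UNIV. \<zeta> $ j * v $ j)" for v
  define T where "T = of_cols (\<lambda>j. \<zeta> $ j *s e0)"
  have T: "T \<star> v = Z v *s e0" for v
    unfolding T_def of_cols_app Z_def by (simp add: vec_eq_iff sum_distrib_left ac_simps)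
  have R: "(T * Q) \<star> v = Z (Q \<star> v) *s e0" for v by (simp add: app_mult T)
  show thesis
  proof (rule that[of "T * Q"])
    show "Q * (T * Q) = T * Q" by (rule endo_eqI) (simp add: app_mult T app_vscale e0)
    show "T * Q * Q = T * Q" by (simp add: mult.assoc Q)
    show "\<exists>c. (T * Q) \<star> v = c *s e0" for v using R by blast
    fix i
    have "Q \<star> (N ^ i) \<star> e0 = (N ^ i) \<star> e0"
    proof -
      have "Q \<star> (N ^ i) \<star> e0 = (N ^ i) \<star> Q \<star> e0"
        by (simp only: app_mult[symmetric] power_commute_endo[OF Q(2)])
      then show ?thesis by (simp only: e0(1))
    qed
    then show "(T * Q) \<star> (N ^ i) \<star> e0 = (if i = k - 1 then e0 else 0)"
      using \<zeta>[of i] z[of i] k(1) unfolding R Z_def by (cases "i < k") auto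
  qed
qed

text \<open>
  A Jordan chain of the largest possible length \<open>k\<close> has an \<open>N\<close>-stable complement: the projection \<open>P\<close>
  that reads off all coordinates along the chain with the help of \<open>R\<close> commutes with \<open>N\<close>.
\<close>

lemma cyclic_jordan_system:
  fixes Q N R :: "('k::field, 'r::finite) endo"
  assumes Q: "N * Q = Q * N" and k: "k \<ge> 1" "N ^ k * Q = 0" "k \<le> K"
    and R: "Q * R = R" "R * Q = R" "\<And>v. \<exists>c. R \<star> v = c *s e0"
    "\<And>i. R \<star> (N ^ i) \<star> e0 = (if i = k - 1 then e0 else 0)"
  defines "P \<equiv> (\<Sum>j<k. N ^ j * (R * N ^ (k - 1 - j)))"
  shows "P * P = P" "N * P = P * N" "Q * P = P" "P * Q = P"
    "jordan_system N P (\<lambda>j. if j < k then R * N ^ (k - 1 - j) else 0) K"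
proof -
  have RR: "R * N ^ i * R = (if i = k - 1 then R else 0)" for i
  proof (rule endo_eqI)
    fix v
    obtain c where "R \<star> v = c *s e0" using R(3) by blast
    then show "(R * N ^ i * R) \<star> v = (if i = k - 1 then R else 0) \<star> v"
      by (simp add: app_mult app_vscale R(4))
  qed
  have cQ: "N ^ i * Q = Q * N ^ i" for i by (rule power_commute_endo[OF Q])
  have NR: "N ^ i * R = 0" if "k \<le> i" for i
  proof -
    have "N ^ i * R = N ^ (i - k + k) * (Q * R)" using that R(1) by simp
    also have "\<dots> = N ^ (i - k) * (N ^ k * Q) * R" by (simp only: power_add mult.assoc)
    finally show ?thesis by (simp add: k)
  qed
  have RN: "R * N ^ i = 0" if "k \<le> i" for i
  proof -
    have "R * N ^ i = (R * Q) * N ^ (k + (i - k))" using that R(2) by simp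
    also have "\<dots> = R * (Q * N ^ k) * N ^ (i - k)" by (simp only: power_add mult.assoc)
    finally show ?thesis by (simp add: k cQ[symmetric])
  qed
  define \<pi> where "\<pi> j = (if j < k then R * N ^ (k - 1 - j) else 0)" for j
  have P: "P = (\<Sum>j<k. N ^ j * \<pi> j)" unfolding P_def by (rule sum.cong) (auto simp: \<pi>_def)
  have \<pi>\<pi>: "\<pi> j * N ^ i * \<pi> i = (if i = j then \<pi> j else 0)" for i j
  proof (cases "i < k \<and> j < k")
    case True
    have "\<pi> j * N ^ i * \<pi> i = R * N ^ (k - 1 - j + i) * R * N ^ (k - 1 - i)"
      using True unfolding \<pi>_def by (simp only: power_add mult.assoc if_True)
    also have "\<dots> = (if k - 1 - j + i = k - 1 then R else 0) * N ^ (k - 1 - i)"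
      by (simp add: RR)
    finally show ?thesis using True by (auto simp: \<pi>_def)
  qed (auto simp: \<pi>_def)
  have Q\<pi>: "Q * \<pi> j = \<pi> j" "\<pi> j * Q = \<pi> j" for j
  proof -
    show "Q * \<pi> j = \<pi> j" by (simp add: \<pi>_def mult.assoc[symmetric] R)
    have "R * N ^ i * Q = R * N ^ i" for i
    proof -
      have "R * N ^ i * Q = R * (N ^ i * Q)" by (simp only: mult.assoc)
      also have "\<dots> = R * Q * N ^ i" by (simp only: cQ mult.assoc)
      finally show ?thesis by (simp add: R)
    qed
    then show "\<pi> j * Q = \<pi> j" by (simp add: \<pi>_def)
  qed
  show QP: "Q * P = P"
  proof -
    have "Q * (N ^ j * \<pi> j) = N ^ j * \<pi> j" for j
    proof -
      have "Q * (N ^ j * \<pi> j) = (Q * N ^ j) * \<pi> j" by (simp only: mult.assoc)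
      also have "\<dots> = N ^ j * (Q * \<pi> j)" by (simp only: cQ[symmetric] mult.assoc)
      finally show ?thesis by (simp add: Q\<pi>)
    qed
    then show ?thesis unfolding P sum_distrib_left by simp
  qed
  show "P * Q = P" unfolding P sum_distrib_right by (simp add: mult.assoc Q\<pi>)
  have \<pi>P: "\<pi> j * P = \<pi> j" for j
  proof -
    have "\<pi> j * P = (\<Sum>i<k. if i = j then \<pi> j else 0)"
      unfolding P sum_distrib_left by (rule sum.cong) (simp_all add: mult.assoc[symmetric] \<pi>\<pi>)
    then show ?thesis by (simp add: \<pi>_def)
  qed
  show PP: "P * P = P"
  proof -
    have "P * P = (\<Sum>j<k. N ^ j * (\<pi> j * P))"
      by (subst (1) P) (simp only: sum_distrib_right mult.assoc)
    then show ?thesis by (simp only: \<pi>P P[symmetric])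
  qed
  have P\<pi>: "P * \<pi> j = \<pi> j" for j
  proof (cases "j < k")
    case True
    have "P * R = R"
    proof -
      have "P * R = (\<Sum>i<k. if i = 0 then R else 0)"
        unfolding P_def sum_distrib_right
      proof (rule sum.cong[OF refl])
        fix i assume "i \<in> {..<k}"
        then have "k - 1 - i = k - 1 \<longleftrightarrow> i = 0" using k(1) by auto
        then show "N ^ i * (R * N ^ (k - 1 - i)) * R = (if i = 0 then R else 0)"
          using RR[of "k - 1 - i"] by (simp add: mult.assoc)
      qed
      then show ?thesis using k(1) by simp
    qed
    then show ?thesis using True by (simp add: \<pi>_def mult.assoc[symmetric])
  qed (simp add: \<pi>_def)
  have s: "\<pi> (Suc j) * N = \<pi> j" if "Suc j < k" for j
  proof -
    have "k - 1 - j = Suc (k - 1 - Suc j)" using that by simp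
    then have "R * N ^ (k - 1 - j) = R * N ^ (k - 1 - Suc j) * N"
      by (simp only: power_Suc2 mult.assoc)
    then show ?thesis using that unfolding \<pi>_def by simp
  qed
  have \<pi>0: "\<pi> 0 * N = 0"
  proof -
    have "\<pi> 0 * N = R * N ^ (k - 1) * N" using k(1) by (simp add: \<pi>_def)
    also have "\<dots> = R * N ^ Suc (k - 1)" by (simp only: power_Suc2 mult.assoc)
    finally have "\<pi> 0 * N = R * N ^ Suc (k - 1)" .
    then show ?thesis using RN[of k] k(1) by simp
  qed
  show "N * P = P * N"
  proof -
    obtain k' where k': "k = Suc k'" using k(1) by (cases k) auto
    have "N * P = (\<Sum>j<k. N ^ Suc j * \<pi> j)" unfolding P sum_distrib_left by (simp add: mult.assoc)
    also have "\<dots> = (\<Sum>j<k'. N ^ Suc j * \<pi> j) + N ^ k * \<pi> k'" by (simp add: k')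
    also have "N ^ k * \<pi> k' = 0" using NR[of k] by (simp add: \<pi>_def mult.assoc[symmetric] k' del: power_Suc)
    also have "(\<Sum>j<k'. N ^ Suc j * \<pi> j) = (\<Sum>j<k'. N ^ Suc j * (\<pi> (Suc j) * N))"
      by (rule sum.cong) (auto simp: s k')
    also have "(\<Sum>j<k'. N ^ Suc j * (\<pi> (Suc j) * N)) + 0 = (\<Sum>j<k. N ^ j * (\<pi> j * N))"
      unfolding k' by (subst sum.lessThan_Suc_shift) (simp add: \<pi>0)
    also have "\<dots> = P * N" unfolding P sum_distrib_right by (simp add: mult.assoc)
    finally show ?thesis .
  qed
  have "jordan_system N P \<pi> K" unfolding jordan_system_def
  proof (intro conjI allI impI)
    show "\<pi> j = 0" if "K \<le> j" for j using that k(3) by (simp add: \<pi>_def)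
    show "P * \<pi> j = \<pi> j" for j by (rule P\<pi>)
    show "\<pi> j * P = \<pi> j" for j by (rule \<pi>P)
    show "(\<Sum>j<K. N ^ j * \<pi> j) = P"
      unfolding P by (rule sum.mono_neutral_right) (use k(3) in \<open>auto simp: \<pi>_def\<close>)
    show "\<pi> 0 * N = 0" by (rule \<pi>0)
    show "N ^ Suc j * (\<pi> j - \<pi> (Suc j) * N) = 0" for j
    proof -
      consider "Suc j < k" | "Suc j = k" | "k \<le> j" by linarith
      then show ?thesis
      proof cases
        case 1 then show ?thesis by (simp add: s)
      next
        case 2 
        then have "\<pi> (Suc j) = 0" "\<pi> j = R" by (auto simp: \<pi>_def)
        then show ?thesis using NR[of "Suc j"] 2 by simp
      next
        case 3 then show ?thesis by (simp add: \<pi>_def)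
      qed
    qed
    show "\<pi> j * N ^ i * \<pi> i = (if i = j then \<pi> j else 0)" for i j by (rule \<pi>\<pi>)
  qed
  then show "jordan_system N P (\<lambda>j. if j < k then R * N ^ (k - 1 - j) else 0) K" 
    by (simp add: \<pi>_def[abs_def])
qed

definition rank :: "('k::field, 'r::finite) endo \<Rightarrow> nat" where
  "rank Q = vec.dim (range ((\<star>) Q))"

lemma subspace_range: "vec.subspace (range ((\<star>) Q))"
  unfolding vec.subspace_def
proof (intro conjI ballI allI)
  show "0 \<in> range ((\<star>) Q)" by (rule image_eqI[of _ _ 0]) simp_all
  fix x y c assume "x \<in> range ((\<star>) Q)" "y \<in> range ((\<star>) Q)"
  then obtain v w where "x = Q \<star> v" "y = Q \<star> w" by auto
  then have "x + y = Q \<star> (v + w)" "c *s x = Q \<star> (c *s v)" by (simp_all add: app_simps)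
  then show "x + y \<in> range ((\<star>) Q)" "c *s x \<in> range ((\<star>) Q)" by auto
qed

text \<open>
  Inductions over idempotents run along the rank.
\<close>

lemma rank_less:
  assumes "Q' * Q' = Q'" "Q * Q' = Q'" "Q' * Q = Q'" "Q \<noteq> Q'"
  shows "rank Q' < rank Q"
proof (rule ccontr)
  assume "\<not> ?thesis"
  moreover have "range ((\<star>) Q') \<subseteq> range ((\<star>) Q)"
  proof
    fix x assume "x \<in> range ((\<star>) Q')"
    then obtain v where "x = Q' \<star> v" by auto
    then have "x = Q \<star> Q' \<star> v" using assms(2) by (metis app_mult)
    then show "x \<in> range ((\<star>) Q)" by auto
  qed
  ultimately have eq: "range ((\<star>) Q') = range ((\<star>) Q)"
    by (intro vec.subspace_dim_equal subspace_range) (simp_all add: rank_def)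
  have "Q' = Q"
  proof (rule endo_eqI)
    fix v
    have "Q \<star> v \<in> range ((\<star>) Q')" unfolding eq by simp
    then obtain w where w: "Q \<star> v = Q' \<star> w" by blast
    have "Q' \<star> v = Q' \<star> Q \<star> v" using assms(3) by (metis app_mult)
    also have "\<dots> = Q \<star> v" unfolding w using assms(1) by (metis app_mult)
    finally show "Q' \<star> v = Q \<star> v" .
  qed
  with assms(4) show False by simp
qed

text \<open>
  The Jordan normal form of a nilpotent: split off a longest chain and continue with its complement.
\<close>

lemma jordan_system_exists:
  fixes N :: "('k::field, 'r::finite) endo"
  assumes "Q * Q = Q" "N * Q = Q * N" "N ^ K * Q = 0"
  shows "\<exists>\<pi>. jordan_system N Q \<pi> K"
  using assms
proof (induction "rank Q" arbitrary: Q rule: less_induct)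
  case less
  show ?case
  proof (cases "Q = 0")
    case True
    then have "jordan_system N Q (\<lambda>_. 0) K" by (simp add: jordan_system_def)
    then show ?thesis by blast
  next
    case False
    define k where "k = (LEAST k. N ^ k * Q = 0)"
    have k: "N ^ k * Q = 0" unfolding k_def by (rule LeastI) (rule less.prems(3))
    have kK: "k \<le> K" unfolding k_def by (rule Least_le) (rule less.prems(3))
    have k1: "k \<ge> 1" using k False by (cases k) auto
    have "N ^ (k - 1) * Q \<noteq> 0" using not_less_Least[of "k - 1" "\<lambda>k. N ^ k * Q = 0"] k1 unfolding k_def by linarith
    then obtain v where "(N ^ (k - 1) * Q) \<star> v \<noteq> 0" by (rule nonzero_app)
    then have e0: "Q \<star> (Q \<star> v) = Q \<star> v" "(N ^ (k - 1)) \<star> (Q \<star> v) \<noteq> 0"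
      using less.prems(1) by (simp_all add: app_mult[symmetric])
    obtain R where R: "Q * R = R" "R * Q = R" "\<And>w. \<exists>c. R \<star> w = c *s (Q \<star> v)"
      "\<And>i. R \<star> (N ^ i) \<star> (Q \<star> v) = (if i = k - 1 then Q \<star> v else 0)"
      by (rule cyclic_functional[OF less.prems(1,2) k1 k e0]) blast
    define P where "P = (\<Sum>j<k. N ^ j * (R * N ^ (k - 1 - j)))"
    note c = cyclic_jordan_system[OF less.prems(2) k1 k kK R, folded P_def]
    have "P \<noteq> 0"
    proof
      assume "P = 0"
      then have j: "jordan_system N 0 (\<lambda>j. if j < k then R * N ^ (k - 1 - j) else 0) K" using c(5) by simp
      have "R * N ^ (k - 1 - (k - 1)) = 0" using jordan_systemD(2)[OF j, of "k - 1"] k1 by simp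
      then have "R = 0" by simp
      then show False using R(4)[of "k - 1"] e0 k1 by simp
    qed
    then have "rank (Q - P) < rank Q"
      by (intro rank_less) (simp_all add: algebra_simps c less.prems)
    moreover have "(Q - P) * (Q - P) = Q - P" by (simp add: algebra_simps c less.prems)
    moreover have "N * (Q - P) = (Q - P) * N" by (simp add: right_diff_distrib left_diff_distrib c less.prems)
    moreover have "N ^ K * (Q - P) = 0"
    proof -
      have "N ^ K * P = N ^ K * Q * P" by (simp add: mult.assoc c)
      then show ?thesis by (simp add: right_diff_distrib less.prems)
    qed
    ultimately obtain \<pi> where "jordan_system N (Q - P) \<pi> K"
      using less.hyps[of "Q - P"] by blast
    from jordan_system_add[OF c(5) this] show ?thesis
      using c less.prems by (auto simp: algebra_simps)
  qed
qed

section \<open>Forms given by a functional on a commutative ring\<close>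

text \<open>
  Every \<open>K[t]\<close>-linear functional \<open>\<Psi>\<close> on a commutative \<open>K[t]\<close>-algebra \<open>S\<close> with elements
  \<open>\<sigma>\<^sub>1, \<dots>, \<sigma>\<^sub>r\<close> gives the symmetric multilinear function \<open>\<Psi>(v\<^sub>1 \<dots> v\<^sub>d)\<close> where \<open>\<Sum> v\<^sub>i \<sigma>\<^sub>i\<close> is substituted
  for a vector \<open>v\<close>. All families constructed below have this shape, because for such forms
  multiplication by an element of \<open>S\<close> is automatically self-adjoint.
\<close>

definition dform :: "('s::comm_ring_1 \<Rightarrow> 'a::comm_ring_1) \<Rightarrow> ('r::finite \<Rightarrow> 's) \<Rightarrow> nat \<Rightarrow> ('a, 'r) dpower" where
  "dform \<Psi> \<sigma> d = form_of d (\<lambda>\<alpha>. \<Psi> (\<Prod>i\<in>UNIV. \<sigma> i ^ Poly_Mapping.lookup \<alpha> i))"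

lemma homogeneous_dform: "dform \<Psi> \<sigma> d \<in> homogeneous d"
  by (simp add: dform_def homogeneous_form_of)

lemma lookup_dform: "Poly_Mapping.lookup (dform \<Psi> \<sigma> d) \<alpha> =
    (if total_degree \<alpha> = d then \<Psi> (\<Prod>i\<in>UNIV. \<sigma> i ^ Poly_Mapping.lookup \<alpha> i) else 0)"
  by (simp add: dform_def lookup_form_of)

locale functional =
  fixes \<kappa> :: "'a::comm_ring_1 \<Rightarrow> 's::comm_ring_1" and \<Psi> :: "'s \<Rightarrow> 'a"
  assumes hom: "is_hom \<kappa>"
    and add: "\<Psi> (x + y) = \<Psi> x + \<Psi> y"
    and scale: "\<Psi> (\<kappa> c * x) = c * \<Psi> x"
begin

lemma zero [simp]: "\<Psi> 0 = 0"
  using add[of 0 0] by simp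

lemma uminus: "\<Psi> (- x) = - \<Psi> x"
  using add[of x "- x"] by (simp add: eq_neg_iff_add_eq_0 add.commute)

lemma diff: "\<Psi> (x - y) = \<Psi> x - \<Psi> y"
  using add[of x "- y"] by (simp add: uminus)

lemma sum: "\<Psi> (\<Sum>i\<in>I. x i) = (\<Sum>i\<in>I. \<Psi> (x i))"
  by (induction I rule: infinite_finite_induct) (simp_all add: add)

text \<open>
  The element of \<open>S\<close> that a vector stands for.
\<close>

definition vect :: "('r::finite \<Rightarrow> 's) \<Rightarrow> 'a ^ 'r \<Rightarrow> 's" where
  "vect \<sigma> v = (\<Sum>i\<in>UNIV. \<kappa> (v $ i) * \<sigma> i)"

lemma vect_add: "vect \<sigma> (v + w) = vect \<sigma> v + vect \<sigma> w"
  by (simp add: vect_def is_homD[OF hom] sum.distrib distrib_right)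

lemma vect_diff: "vect \<sigma> (v - w) = vect \<sigma> v - vect \<sigma> w"
  by (simp add: vect_def is_homD[OF hom] sum_subtractf left_diff_distrib)

lemma vect_scale: "vect \<sigma> (c *s v) = \<kappa> c * vect \<sigma> v"
  by (simp add: vect_def is_homD[OF hom] sum_distrib_left mult.assoc)

lemma functional_mult: "functional \<kappa> (\<lambda>z. \<Psi> (a * z))"
proof
  show "\<Psi> (a * (\<kappa> c * x)) = c * \<Psi> (a * x)" for c x
    by (subst mult.left_commute) (rule scale)
qed (simp_all add: hom add distrib_left)

lemma ctr_dform:
  assumes "d \<ge> 1"
  shows "ctr v (dform \<Psi> \<sigma> d) = dform (\<lambda>z. \<Psi> (vect \<sigma> v * z)) \<sigma> (d - 1)"
proof (rule poly_mapping_eqI)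
  fix \<gamma>
  have e: "(\<Prod>j\<in>UNIV. \<sigma> j ^ Poly_Mapping.lookup (\<gamma> + Poly_Mapping.single i 1) j) =
      \<sigma> i * (\<Prod>j\<in>UNIV. \<sigma> j ^ Poly_Mapping.lookup \<gamma> j)" for i
  proof -
    have "(\<Prod>j\<in>UNIV. \<sigma> j ^ Poly_Mapping.lookup (\<gamma> + Poly_Mapping.single i 1) j) =
      (\<Prod>j\<in>UNIV. (if j = i then \<sigma> i else 1) * \<sigma> j ^ Poly_Mapping.lookup \<gamma> j)"
      by (rule prod.cong) (auto simp: lookup_add lookup_single when_def)
    then show ?thesis by (simp add: prod.distrib)
  qed
  show "Poly_Mapping.lookup (ctr v (dform \<Psi> \<sigma> d)) \<gamma> =
      Poly_Mapping.lookup (dform (\<lambda>z. \<Psi> (vect \<sigma> v * z)) \<sigma> (d - 1)) \<gamma>"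
  proof (cases "total_degree \<gamma> = d - 1")
    case True
    then have "Suc (total_degree \<gamma>) = d" using assms by simp
    then have "Poly_Mapping.lookup (ctr v (dform \<Psi> \<sigma> d)) \<gamma> =
        (\<Sum>i\<in>UNIV. v $ i * \<Psi> (\<sigma> i * (\<Prod>j\<in>UNIV. \<sigma> j ^ Poly_Mapping.lookup \<gamma> j)))"
      unfolding lookup_ctr lookup_dform e by (simp add: total_degree_add)
    also have "\<dots> = \<Psi> (vect \<sigma> v * (\<Prod>j\<in>UNIV. \<sigma> j ^ Poly_Mapping.lookup \<gamma> j))"
      unfolding vect_def sum_distrib_right sum by (simp add: scale mult.assoc)
    finally show ?thesis using True by (simp add: lookup_dform)
  next
    case False
    then show ?thesis
      using homogeneous_ctr[OF homogeneous_dform[of \<Psi> \<sigma> d]] homogeneous_dform[of _ \<sigma> "d - 1"]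
      by (auto simp: homogeneous_iff)
  qed
qed

text \<open>
  The span of the \<open>\<sigma> i\<close> is stable under multiplication by \<open>m\<close> only modulo elements that \<open>\<Psi>\<close> does
  not see, i.e. modulo the largest ideal in the kernel of \<open>\<Psi>\<close>; hence the factor \<open>z\<close>.
\<close>

definition acts_as :: "('r::finite \<Rightarrow> 's) \<Rightarrow> ('a, 'r) endo \<Rightarrow> 's \<Rightarrow> bool" where
  "acts_as \<sigma> A m \<longleftrightarrow> (\<forall>v z. \<Psi> (vect \<sigma> (A \<star> v) * z) = \<Psi> (m * (vect \<sigma> v * z)))"

lemma acts_asD: "acts_as \<sigma> A m \<Longrightarrow> \<Psi> (vect \<sigma> (A \<star> v) * z) = \<Psi> (m * (vect \<sigma> v * z))"
  by (simp add: acts_as_def)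

lemma acts_as_mult:
  assumes "acts_as \<sigma> A m" "acts_as \<sigma> B n"
  shows "acts_as \<sigma> (A * B) (m * n)"
  unfolding acts_as_def
proof (intro allI)
  fix v z
  have "\<Psi> (vect \<sigma> ((A * B) \<star> v) * z) = \<Psi> (m * (vect \<sigma> (B \<star> v) * z))"
    by (simp only: app_mult acts_asD[OF assms(1)])
  also have "\<dots> = \<Psi> (vect \<sigma> (B \<star> v) * (m * z))" by (simp only: mult.left_commute)
  also have "\<dots> = \<Psi> (n * (vect \<sigma> v * (m * z)))" by (rule acts_asD[OF assms(2)])
  also have "\<dots> = \<Psi> (m * n * (vect \<sigma> v * z))" by (simp only: ac_simps)
  finally show "\<Psi> (vect \<sigma> ((A * B) \<star> v) * z) = \<Psi> (m * n * (vect \<sigma> v * z))" .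
qed

lemma acts_as_one: "acts_as \<sigma> 1 1"
  by (simp add: acts_as_def)

lemma acts_as_scal: "acts_as \<sigma> (scal c) (\<kappa> c)"
  by (simp add: acts_as_def app_scal vect_scale mult.assoc)

lemma acts_as_diff: "acts_as \<sigma> A m \<Longrightarrow> acts_as \<sigma> B n \<Longrightarrow> acts_as \<sigma> (A - B) (m - n)"
  by (simp add: acts_as_def app_diff vect_diff left_diff_distrib diff)

lemma acts_as_prod_list:
  "(\<And>i. i \<in> set is \<Longrightarrow> acts_as \<sigma> (A i) (m i)) \<Longrightarrow> acts_as \<sigma> (prod_list (map A is)) (prod_list (map m is))"
  by (induction "is") (simp_all add: acts_as_one acts_as_mult)

lemma ctr_acts_as:
  assumes "acts_as \<sigma> A m" "d \<ge> 1"
  shows "ctr (A \<star> v) (dform \<Psi> \<sigma> d) = dform (\<lambda>z. \<Psi> (m * (vect \<sigma> v * z))) \<sigma> (d - 1)"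
  by (simp only: ctr_dform[OF assms(2)] acts_asD[OF assms(1)])

lemma acts_as_self_adjoint:
  assumes A: "acts_as \<sigma> A m" and d: "d \<ge> 2"
  shows "self_adjoint A (dform \<Psi> \<sigma> d)"
  unfolding self_adjoint_def
proof (intro allI)
  fix v w
  have d1: "d \<ge> 1" "d - 1 \<ge> 1" using d by auto
  have 2: "ctr v (ctr w (dform \<Psi> \<sigma> d)) = dform (\<lambda>z. \<Psi> (vect \<sigma> w * (vect \<sigma> v * z))) \<sigma> (d - 1 - 1)" for v w
  proof -
    interpret w: functional \<kappa> "\<lambda>z. \<Psi> (vect \<sigma> w * z)" by (rule functional_mult)
    show ?thesis unfolding ctr_dform[OF d1(1)] by (rule w.ctr_dform[OF d1(2)])
  qed
  have "\<Psi> (vect \<sigma> w * (vect \<sigma> (A \<star> v) * z)) = \<Psi> (vect \<sigma> (A \<star> w) * (vect \<sigma> v * z))" for z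
  proof -
    have "\<Psi> (vect \<sigma> w * (vect \<sigma> (A \<star> v) * z)) = \<Psi> (vect \<sigma> (A \<star> v) * (vect \<sigma> w * z))"
      by (simp only: mult.left_commute)
    also have "\<dots> = \<Psi> (m * (vect \<sigma> v * (vect \<sigma> w * z)))" by (rule acts_asD[OF A])
    also have "\<dots> = \<Psi> (m * (vect \<sigma> w * (vect \<sigma> v * z)))" by (simp only: mult.left_commute)
    also have "\<dots> = \<Psi> (vect \<sigma> (A \<star> w) * (vect \<sigma> v * z))" by (rule acts_asD[OF A, symmetric])
    finally show ?thesis .
  qed
  then show "ctr (A \<star> v) (ctr w (dform \<Psi> \<sigma> d)) = ctr v (ctr (A \<star> w) (dform \<Psi> \<sigma> d))"
    by (simp only: 2 mult.left_commute[of "vect \<sigma> v"])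
qed

end

text \<open>
  Everything about operators is translated into identities in the algebra: the \<open>m p\<close> have products
  in the ideal that \<open>\<Psi>\<close> does not see, and a combination of them is the constant \<open>q\<close>.
\<close>

lemma splitting_family_dform:
  fixes f :: "('k::field, 'r::finite) dpower" and \<sigma> :: "'r \<Rightarrow> 's::comm_ring_1"
  assumes func: "functional \<kappa> \<Psi>" and d: "d \<ge> 2"
    and acts: "\<And>p. p < n \<Longrightarrow> functional.acts_as \<kappa> \<Psi> \<sigma> (E p) (m p)"
    and orth: "\<And>p p' z. p < n \<Longrightarrow> p' < n \<Longrightarrow> p \<noteq> p' \<Longrightarrow> \<Psi> (m p * m p' * z) = 0"
    and part: "(\<Sum>p<n. \<kappa> (r p) * m p) = \<kappa> q" and q: "q \<noteq> 0"
    and E: "\<And>p. p < n \<Longrightarrow> emap at0 (E p) \<noteq> 0" "\<And>p. p < n \<Longrightarrow> emap const e * E p = E p"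
    and e: "\<And>v. functional.vect \<kappa> \<sigma> (emap const e \<star> v) = functional.vect \<kappa> \<sigma> v"
    and F0: "\<And>v. ctr v (fmapc at0 (dform \<Psi> \<sigma> d)) = ctr (e \<star> v) f"
  shows "splitting_family d f e n (dform \<Psi> \<sigma> d) E r q"
proof -
  interpret functional \<kappa> \<Psi> by (rule func)
  have d1: "d \<ge> 1" using d by simp
  have z: "dform (\<lambda>_. 0) \<sigma> d' = 0" for d'
    by (rule poly_mapping_eqI) (simp add: lookup_dform)
  show ?thesis unfolding splitting_family_def
  proof (intro conjI allI impI)
    show "ctr (emap const e \<star> v) (dform \<Psi> \<sigma> d) = ctr v (dform \<Psi> \<sigma> d)" for v
      by (simp only: ctr_dform[OF d1] e)
    show "ctr (E p \<star> E p' \<star> v) (dform \<Psi> \<sigma> d) = 0" if "p < n" "p' < n" "p \<noteq> p'" for p p' v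
      using ctr_acts_as[OF acts_as_mult[OF acts[OF that(1)] acts[OF that(2)]] d1]
      by (simp add: app_mult[symmetric] orth[OF that] z)
    fix v
    show "fscale q (ctr v (dform \<Psi> \<sigma> d)) = (\<Sum>p<n. fscale (r p) (ctr (E p \<star> v) (dform \<Psi> \<sigma> d)))"
    proof (rule poly_mapping_eqI)
      fix \<gamma>
      have "(\<Sum>p<n. r p * \<Psi> (m p * w)) = q * \<Psi> w" for w
      proof -
        have "(\<Sum>p<n. r p * \<Psi> (m p * w)) = \<Psi> ((\<Sum>p<n. \<kappa> (r p) * m p) * w)"
          unfolding sum_distrib_right sum by (simp add: scale mult.assoc)
        then show ?thesis by (simp add: part scale)
      qed
      then show "Poly_Mapping.lookup (fscale q (ctr v (dform \<Psi> \<sigma> d))) \<gamma> =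
        Poly_Mapping.lookup (\<Sum>p<n. fscale (r p) (ctr (E p \<star> v) (dform \<Psi> \<sigma> d))) \<gamma>"
        by (simp add: lookup_fscale lookup_sum ctr_dform[OF d1] lookup_dform acts_asD[OF acts])
    qed
  qed (use q E F0 acts_as_self_adjoint[OF acts d] in \<open>auto simp: homogeneous_dform\<close>)
qed

text \<open>
  If two substitutions agree in every single factor, whatever the other factors are, they agree in
  products.
\<close>

lemma prod_replace:
  fixes a b :: "'i \<Rightarrow> 's::comm_monoid_mult" and G :: "'s \<Rightarrow> 'b"
  assumes G: "\<And>i z. G (a i * z) = G (b i * z)" and I: "finite I"
  shows "G ((\<Prod>i\<in>I. a i ^ n i) * z) = G ((\<Prod>i\<in>I. b i ^ n i) * z)"
proof -
  have pw: "G (a i ^ m * z) = G (b i ^ m * z)" for i m z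
  proof (induction m arbitrary: z)
    case (Suc m)
    have "G (a i ^ Suc m * z) = G (a i ^ m * (b i * z))"
      using G[of i "a i ^ m * z"] by (simp add: ac_simps)
    also have "\<dots> = G (b i ^ m * (b i * z))" by (rule Suc)
    also have "\<dots> = G (b i ^ Suc m * z)" by (simp add: ac_simps)
    finally show ?case .
  qed simp
  show ?thesis using I
  proof (induction I arbitrary: z)
    case (insert i I)
    have "G ((\<Prod>i\<in>insert i I. a i ^ n i) * z) = G ((\<Prod>i\<in>I. a i ^ n i) * (a i ^ n i * z))"
      using insert by (simp add: ac_simps)
    also have "\<dots> = G ((\<Prod>i\<in>I. b i ^ n i) * (a i ^ n i * z))" by (rule insert.IH)
    also have "\<dots> = G (a i ^ n i * ((\<Prod>i\<in>I. b i ^ n i) * z))" by (simp only: mult.left_commute)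
    also have "\<dots> = G (b i ^ n i * ((\<Prod>i\<in>I. b i ^ n i) * z))" by (rule pw)
    also have "\<dots> = G ((\<Prod>i\<in>insert i I. b i ^ n i) * z)" using insert by (simp add: ac_simps)
    finally show ?case .
  qed simp
qed

section \<open>Coefficientwise functionals on polynomials\<close>

definition pfun :: "(nat \<Rightarrow> 'a::zero \<Rightarrow> 'b::comm_ring_1) \<Rightarrow> 'a poly \<Rightarrow> 'b" where
  "pfun \<phi> h = (\<Sum>m\<le>degree h. \<phi> m (coeff h m))"

lemma pfun_upto: "(\<And>m. \<phi> m 0 = 0) \<Longrightarrow> degree h \<le> n \<Longrightarrow> pfun \<phi> h = (\<Sum>m\<le>n. \<phi> m (coeff h m))"
  unfolding pfun_def by (rule sum.mono_neutral_left) (auto simp: coeff_eq_0)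

lemma pfun_add:
  assumes "\<And>m. \<phi> m 0 = 0" "\<And>m a b. \<phi> m (a + b) = \<phi> m a + \<phi> m b"
  shows "pfun \<phi> (g + h) = pfun \<phi> g + pfun \<phi> h"
proof -
  let ?n = "max (degree g) (degree h)"
  have "degree (g + h) \<le> ?n" by (rule degree_add_le_max)
  then show ?thesis
    by (simp add: pfun_upto[where n = ?n] assms sum.distrib)
qed

lemma pfun_pCons:
  assumes "\<And>m. \<phi> m 0 = 0"
  shows "pfun \<phi> (pCons a h) = \<phi> 0 a + pfun (\<lambda>m. \<phi> (Suc m)) h"
proof -
  have "pfun \<phi> (pCons a h) = (\<Sum>m\<le>Suc (degree h). \<phi> m (coeff (pCons a h) m))"
    by (rule pfun_upto) (simp_all add: assms degree_pCons_le)
  then show ?thesis by (simp add: sum.atMost_Suc_shift pfun_def del: sum.atMost_Suc)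
qed

lemma pfun_smult:
  fixes \<phi> :: "nat \<Rightarrow> 'a::comm_ring_1 \<Rightarrow> 'b::comm_ring_1"
  assumes "\<And>m. \<phi> m 0 = 0"
  shows "pfun \<phi> (smult a h) = pfun (\<lambda>m x. \<phi> m (a * x)) h"
proof -
  have "pfun \<phi> (smult a h) = (\<Sum>m\<le>degree h. \<phi> m (coeff (smult a h) m))"
    by (rule pfun_upto) (simp_all add: assms degree_smult_le)
  then show ?thesis by (simp add: pfun_def)
qed

lemma pfun_add_fun: "pfun (\<lambda>m x. \<phi> m x + \<psi> m x) h = pfun \<phi> h + pfun \<psi> h"
  by (simp add: pfun_def sum.distrib)

lemma pfun_mult_fun: "pfun (\<lambda>m x. c * \<phi> m x) h = c * pfun \<phi> h"
  by (simp add: pfun_def sum_distrib_left)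

lemma pfun_zero_fun [simp]: "pfun (\<lambda>m x. 0) h = 0"
  by (simp add: pfun_def)

section \<open>The pairing of operators and forms\<close>

text \<open>
  For operators and forms of the same degree this is the perfect pairing of the
  monomials \<open>\<partial>\<^sup>\<alpha>\<close> with the divided powers \<open>x\<^sup>(\<^sup>\<alpha>\<^sup>)\<close>.
\<close>

definition pair :: "('a::comm_ring_1, 'r) diffop \<Rightarrow> ('a, 'r) dpower \<Rightarrow> 'a" where
  "pair D f = Poly_Mapping.lookup (contract D f) 0"

lemma pair_add: "pair (D + E) f = pair D f + pair E f" "pair D (f + g) = pair D f + pair D g"
  by (simp_all add: pair_def contract_add_left contract_add_right lookup_add)

lemma pair_zero [simp]: "pair 0 f = 0" "pair D 0 = 0"
  by (simp_all add: pair_def)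

lemma pair_mult: "pair (D * E) f = pair E (contract D f)"
  by (metis pair_def contract_mult mult.commute)

lemma pair_fscale: "pair D (fscale c f) = c * pair D f"
  by (simp add: pair_def contract_fscale lookup_fscale)

lemma pair_monomial: "pair (Poly_Mapping.single \<alpha> 1) f = Poly_Mapping.lookup f \<alpha>"
  by (simp add: pair_def lookup_contract_single)

lemma contract_const: "contract (Poly_Mapping.single 0 c) f = fscale c f"
  by (rule poly_mapping_eqI) (simp add: lookup_contract_single lookup_fscale)

lemma pair_at0: "at0 (pair D f) = at0 (pair D g)" if "fmapc at0 f = fmapc at0 g"
proof -
  have "at0 (Poly_Mapping.lookup f \<alpha>) = at0 (Poly_Mapping.lookup g \<alpha>)" for \<alpha>
    using that by (metis lookup_fmapc[OF is_hom_eval0])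
  then show ?thesis by (simp add: pair_def lookup_contract poly_sum)
qed

lemma is_hom_single0: "is_hom (Poly_Mapping.single (0 :: 'x::comm_monoid_add) :: 'a::comm_ring_1 \<Rightarrow> _)"
  by (simp add: is_hom_def single_add mult_single)

lemma is_hom_comp: "is_hom g \<Longrightarrow> is_hom h \<Longrightarrow> is_hom (\<lambda>x. g (h x))"
  by (simp add: is_hom_def)

lemma lin_axis: "lin (axis i 1) = Poly_Mapping.single (Poly_Mapping.single i 1) 1"
  by (rule poly_mapping_eqI) (simp add: lin_def lookup_sum axis_def lookup_single when_def if_distrib[of "\<lambda>x. Poly_Mapping.lookup x _"] if_distrib cong: if_cong)

lemma prod_lin_axis: "(\<Prod>i\<in>UNIV. lin (axis i 1) ^ Poly_Mapping.lookup \<alpha> i) = (Poly_Mapping.single \<alpha> 1 :: ('a::comm_ring_1, 'r::finite) diffop)"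
proof -
  have pw: "(Poly_Mapping.single (Poly_Mapping.single i 1) 1 :: ('a, 'r) diffop) ^ n = Poly_Mapping.single (Poly_Mapping.single i n) 1" for i and n :: nat
    by (induction n) (simp_all add: mult_single single_add[symmetric])
  have pr: "(\<Prod>i\<in>I. (Poly_Mapping.single (Poly_Mapping.single i (Poly_Mapping.lookup \<alpha> i)) 1 :: ('a, 'r) diffop)) =
    Poly_Mapping.single (\<Sum>i\<in>I. Poly_Mapping.single i (Poly_Mapping.lookup \<alpha> i)) 1" for I
    by (induction I rule: infinite_finite_induct) (simp_all add: mult_single)
  have "(\<Sum>i\<in>UNIV. Poly_Mapping.single i (Poly_Mapping.lookup \<alpha> i)) = \<alpha>"
    by (rule poly_mapping_eqI) (simp add: lookup_sum lookup_single when_def)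
  then show ?thesis by (simp only: lin_axis pw pr)
qed

section \<open>Deforming along a nilpotent self-adjoint operator\<close>

text \<open>
  Distinct nodes \<open>\<theta>\<^sub>i\<close>: the products of all but one factor \<open>x - \<theta>\<^sub>i\<close> generate the unit ideal
  after inverting some \<open>q \<noteq> 0\<close>. Omitting a node \<open>b\<close>, respectively \<open>a\<close>, one obtains by induction
  combinations that equal \<open>(x - \<theta>\<^sub>b) q\<^sub>A\<close> and \<open>(x - \<theta>\<^sub>a) q\<^sub>B\<close>, and \<open>x\<close> is eliminated from these two.
\<close>

lemma separating_combination:
  fixes \<theta> :: "nat \<Rightarrow> 'a::idom" and \<kappa> :: "'a \<Rightarrow> 's::comm_ring_1"
  assumes "is_hom \<kappa>" "finite I" "I \<noteq> {}" "inj_on \<theta> I"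
  shows "\<exists>r q. q \<noteq> 0 \<and> (\<forall>x. (\<Sum>j\<in>I. \<kappa> (r j) * (\<Prod>i\<in>I - {j}. x - \<kappa> (\<theta> i))) = \<kappa> q)"
  using assms(2-4)
proof (induction "card I" arbitrary: I rule: less_induct)
  case less
  note h = is_homD[OF assms(1)]
  show ?case
  proof (cases "\<exists>a b. a \<in> I \<and> b \<in> I \<and> a \<noteq> b")
    case False
    then obtain a where "I = {a}" using less.prems by blast
    then show ?thesis by (intro exI[of _ "\<lambda>_. 1"] exI[of _ 1]) (simp add: h)
  next
    case True
    then obtain a b where ab: "a \<in> I" "b \<in> I" "a \<noteq> b" by blast
    have ex: "\<exists>r q. q \<noteq> 0 \<and> (\<forall>x. (\<Sum>j\<in>I - {c}. \<kappa> (r j) * (\<Prod>i\<in>I - {c} - {j}. x - \<kappa> (\<theta> i))) = \<kappa> q)"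
      if c: "c = a \<or> c = b" for c
    proof (rule less.hyps)
      show "card (I - {c}) < card I" using c ab less.prems by (intro psubset_card_mono) auto
      show "I - {c} \<noteq> {}" using c ab by auto
    qed (use less.prems in \<open>auto intro: inj_on_diff\<close>)
    obtain rA qA where qA: "qA \<noteq> 0"
      and A: "\<And>x. (\<Sum>j\<in>I - {b}. \<kappa> (rA j) * (\<Prod>i\<in>I - {b} - {j}. x - \<kappa> (\<theta> i))) = \<kappa> qA"
      using ex[of b] by blast
    obtain rB qB where qB: "qB \<noteq> 0"
      and B: "\<And>x. (\<Sum>j\<in>I - {a}. \<kappa> (rB j) * (\<Prod>i\<in>I - {a} - {j}. x - \<kappa> (\<theta> i))) = \<kappa> qB"
      using ex[of a] by blast
    define q where "q = qA * qB * (\<theta> a - \<theta> b)"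
    define r where "r j = qB * (if j = b then 0 else rA j) - qA * (if j = a then 0 else rB j)" for j
    have "\<theta> a \<noteq> \<theta> b" using inj_onD[OF less.prems(3), of a b] ab by blast
    then have q: "q \<noteq> 0" using qA qB by (simp add: q_def)
    have one: "(\<Sum>j\<in>I. \<kappa> (if j = c then 0 else s j) * (\<Prod>i\<in>I - {j}. x - \<kappa> (\<theta> i))) = (x - \<kappa> (\<theta> c)) * \<kappa> t"
      if c: "c \<in> I" and t: "(\<Sum>j\<in>I - {c}. \<kappa> (s j) * (\<Prod>i\<in>I - {c} - {j}. x - \<kappa> (\<theta> i))) = \<kappa> t" for c s t x
    proof -
      have "(\<Sum>j\<in>I. \<kappa> (if j = c then 0 else s j) * (\<Prod>i\<in>I - {j}. x - \<kappa> (\<theta> i))) =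
          (\<Sum>j\<in>I - {c}. \<kappa> (s j) * (\<Prod>i\<in>I - {j}. x - \<kappa> (\<theta> i)))"
        using less.prems(1) c by (subst sum.remove[OF less.prems(1) c]) (auto simp: h intro!: sum.cong)
      also have "\<dots> = (\<Sum>j\<in>I - {c}. (x - \<kappa> (\<theta> c)) * (\<kappa> (s j) * (\<Prod>i\<in>I - {c} - {j}. x - \<kappa> (\<theta> i))))"
      proof (rule sum.cong[OF refl])
        fix j assume j: "j \<in> I - {c}"
        have "(\<Prod>i\<in>I - {j}. x - \<kappa> (\<theta> i)) = (x - \<kappa> (\<theta> c)) * (\<Prod>i\<in>I - {j} - {c}. x - \<kappa> (\<theta> i))"
          using less.prems(1) c j by (intro prod.remove) auto
        moreover have "I - {j} - {c} = I - {c} - {j}" by auto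
        ultimately show "\<kappa> (s j) * (\<Prod>i\<in>I - {j}. x - \<kappa> (\<theta> i)) =
            (x - \<kappa> (\<theta> c)) * (\<kappa> (s j) * (\<Prod>i\<in>I - {c} - {j}. x - \<kappa> (\<theta> i)))"
          by (simp only: mult.left_commute)
      qed
      finally show ?thesis by (simp only: sum_distrib_left[symmetric] t)
    qed
    have "(\<Sum>j\<in>I. \<kappa> (r j) * (\<Prod>i\<in>I - {j}. x - \<kappa> (\<theta> i))) = \<kappa> q" for x
    proof -
      have "(\<Sum>j\<in>I. \<kappa> (r j) * (\<Prod>i\<in>I - {j}. x - \<kappa> (\<theta> i))) =
        \<kappa> qB * (\<Sum>j\<in>I. \<kappa> (if j = b then 0 else rA j) * (\<Prod>i\<in>I - {j}. x - \<kappa> (\<theta> i))) -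
        \<kappa> qA * (\<Sum>j\<in>I. \<kappa> (if j = a then 0 else rB j) * (\<Prod>i\<in>I - {j}. x - \<kappa> (\<theta> i)))"
        unfolding r_def sum_distrib_left sum_subtractf[symmetric]
        by (rule sum.cong) (simp_all only: h left_diff_distrib mult.assoc)
      also have "\<dots> = \<kappa> qB * ((x - \<kappa> (\<theta> b)) * \<kappa> qA) - \<kappa> qA * ((x - \<kappa> (\<theta> a)) * \<kappa> qB)"
        by (simp only: one[OF ab(2) A] one[OF ab(1) B])
      also have "\<dots> = \<kappa> q" by (simp add: q_def h algebra_simps)
      finally show ?thesis .
    qed
    with q show ?thesis by blast
  qed
qed

text \<open>
  A functional on \<open>K[t][X]\<close> is to be given by prescribing its value \<open>g j\<close> on the Newton
  polynomial \<open>P\<^sub>j = \<Prod>\<^bsub>i<j\<^esub> (X - \<theta>\<^sub>i)\<close>. Then \<open>newton \<theta> g m j\<close> is its value on \<open>X\<^sup>m P\<^sub>j\<close>, as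
  \<open>X P\<^sub>j = P\<^sub>j\<^sub>+\<^sub>1 + \<theta>\<^sub>j P\<^sub>j\<close>. The values are forms.
\<close>

primrec newton :: "(nat \<Rightarrow> 'a::comm_ring_1) \<Rightarrow> (nat \<Rightarrow> ('a, 'r) dpower) \<Rightarrow> nat \<Rightarrow> nat \<Rightarrow> ('a, 'r) dpower" where
  "newton \<theta> g 0 j = g j"
| "newton \<theta> g (Suc m) j = newton \<theta> g m (Suc j) + fscale (\<theta> j) (newton \<theta> g m j)"

lemma newton_ctr_zero:
  "(\<And>l. l \<ge> j \<Longrightarrow> ctr u (g l) = 0) \<Longrightarrow> ctr u (newton \<theta> g m j) = 0"
  by (induction m arbitrary: j) (simp_all add: ctr_add ctr_fscale)

lemma newton_zero: "(\<And>l. l \<ge> j \<Longrightarrow> g l = 0) \<Longrightarrow> newton \<theta> g m j = 0"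
  by (induction m arbitrary: j) simp_all

lemma newton_at0:
  "(\<And>i. at0 (\<theta> i) = 0) \<Longrightarrow> fmapc at0 (newton \<theta> g m j) = fmapc at0 (g (j + m))"
  by (induction m arbitrary: j) (simp_all add: fmapc_add[OF is_hom_eval0] fmapc_fscale[OF is_hom_eval0])

lemma lin_add: "lin (v + w) = lin v + lin w"
  by (simp add: lin_def single_add sum.distrib)

lemma lin_diff: "lin (v - w) = lin v - lin w"
  by (simp add: lin_def single_diff sum_subtractf)

lemma lin_0 [simp]: "lin 0 = 0"
  by (simp add: lin_def)

lemma lin_scale: "lin (c *s v) = Poly_Mapping.single 0 c * lin v"
  by (simp add: lin_def sum_distrib_left mult_single)

lemma lin_sum: "lin (\<Sum>i\<in>I. v i) = (\<Sum>i\<in>I. lin (v i))"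
  by (induction I rule: infinite_finite_induct) (simp_all add: lin_add)

lemma emap_at0_const [simp]:
  fixes A :: "('a::comm_ring_1, 'r::finite) endo"
  shows "emap at0 (emap const A) = A"
proof (rule endo_eqI_axis)
  fix j
  have "emap at0 (emap const A) \<star> axis j 1 = vmap at0 (vmap const (A \<star> axis j 1))"
    by (simp add: emap_axis is_hom_eval0 is_hom_const_poly)
  then show "emap at0 (emap const A) \<star> axis j 1 = A \<star> axis j 1" by (simp add: vec_eq_iff)
qed

lemma fmapc_at0_const [simp]:
  fixes f :: "('a::comm_ring_1, 'r) dpower"
  shows "fmapc at0 (fmapc const f) = f"
  by (rule poly_mapping_eqI) (simp add: lookup_fmapc is_hom_eval0 is_hom_const_poly)

lemma ctr_lift:
  fixes A :: "('a::comm_ring_1, 'r::finite) endo"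
  assumes g: "\<And>v. ctr v g = ctr (A \<star> v) f"
  shows "ctr w (fmapc const g) = ctr (emap const A \<star> w) (fmapc const f)"
proof -
  note h = is_hom_const_poly
  have ax: "ctr (axis i 1) (fmapc const g) = ctr (emap const A \<star> axis i 1) (fmapc const f)" for i
  proof -
    have "ctr (axis i 1) (fmapc const g) = fmapc const (ctr (axis i 1) g)"
      by (simp add: fmapc_ctr[OF h] vmap_axis[OF h])
    also have "\<dots> = ctr (emap const A \<star> axis i 1) (fmapc const f)"
      by (simp add: g fmapc_ctr[OF h] emap_axis[OF h])
    finally show ?thesis .
  qed
  have "emap const A \<star> w = (\<Sum>i\<in>UNIV. w $ i *s (emap const A \<star> axis i 1))"
    by (subst vec_expand[of w]) (simp only: app_vsum app_vscale)
  then show ?thesis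
    by (simp add: ctr_expand[of w] ctr_vsum ctr_vscale ax)
qed

lemma pair_sum: "pair D (\<Sum>i\<in>I. f i) = (\<Sum>i\<in>I. pair D (f i))"
  by (induction I rule: infinite_finite_induct) (simp_all add: pair_add)

lemma emap_prod_list: "is_hom h \<Longrightarrow> emap h (prod_list xs) = prod_list (map (emap h) xs)"
  by (induction xs) (simp_all add: emap_simps)

lemma prod_list_const_map: "prod_list (map (\<lambda>_. N) xs) = N ^ length xs"
  by (induction xs) simp_all

text \<open>
  Were \<open>f\<close> of the form \<open>\<Psi>\<^sub>0(v\<^sub>1 \<dots> v\<^sub>d)\<close> on a free module over \<open>K[X]/X\<^sup>k\<close>, with \<open>N\<close> acting as \<open>X\<close>, one would
  replace \<open>X\<^sup>j\<close> by \<open>P\<^sub>j = \<Prod>\<^bsub>i<j\<^esub> (X - \<theta>\<^sub>i)\<close> in the definition of \<open>\<Psi>\<^sub>0\<close> and in the vectors, the nodes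
  being \<open>\<theta>\<^sub>i = t\<^sup>i\<^sup>+\<^sup>1\<close>. This also works in general. The algebra is \<open>K[t][\<partial>\<^sub>1, \<dots>, \<partial>\<^sub>r][X]\<close>, the functional \<open>\<Psi>\<close>
  sends \<open>P\<^sub>j D\<close> to the pairing of \<open>D\<close> with the form \<open>N\<^sup>j e f\<close>, and a vector \<open>v = \<Sum> N\<^sup>j \<pi>\<^sub>j v\<close> is
  represented by \<open>\<Sum> P\<^sub>j \<pi>\<^sub>j v\<close>. At \<open>t = 0\<close> the polynomials \<open>P\<^sub>j\<close> become \<open>X\<^sup>j\<close>, which acts on \<open>f\<close> as \<open>N\<^sup>j\<close>,
  so this is \<open>e f\<close>. For general \<open>t\<close> the element \<open>X\<close> acts as the operator
  \<open>A = N + \<Sum> \<theta>\<^sub>i N\<^sup>i \<pi>\<^sub>i\<close>; the shift identity \<open>\<pi>\<^sub>j\<^sub>+\<^sub>1 N = \<pi>\<^sub>j\<close> fails at the ends of the chains, but only by vectors on which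
  \<open>N\<^sup>l e f\<close> with \<open>l > j\<close> vanishes. As \<open>\<Psi>\<close> kills the multiples of \<open>P\<^sub>k\<close>, the \<open>k\<close> products of
  all but one factor \<open>A - \<theta>\<^sub>i\<close> separate \<open>k\<close> pieces. At \<open>t = 0\<close> each of them is \<open>N\<^sup>k\<^sup>-\<^sup>1 e \<noteq> 0\<close>.
\<close>

theorem deforms_into_nilpotent:
  fixes f :: "('k::field, 'r::finite) dpower"
  assumes f: "f \<in> homogeneous d" and d: "d \<ge> 2"
    and e: "e * e = e" "N * e = e * N" and sa: "\<And>l. self_adjoint (N ^ l * e) f"
    and k: "k \<ge> 1" "N ^ k * e = 0" "N ^ (k - 1) * e \<noteq> 0"
  shows "deforms_into d f e k"
proof -
  note h0 = is_hom_eval0[where 'a='k] and hc = is_hom_const_poly[where 'a='k]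
  let ?c = "emap const :: ('k, 'r) endo \<Rightarrow> ('k poly, 'r) endo"
  let ?X = "[:0, 1:] :: ('k poly, 'r) diffop poly"
  obtain \<pi> where "jordan_system N e \<pi> k" using jordan_system_exists[OF e k(2)] by blast
  note js = jordan_systemD[OF this]
  have "\<exists>fl. \<forall>l. fl l \<in> homogeneous d \<and> (\<forall>v. ctr v (fl l) = ctr ((N ^ l * e) \<star> v) f)"
  proof (rule choice, rule allI)
    fix l
    show "\<exists>g. g \<in> homogeneous d \<and> (\<forall>v. ctr v g = ctr ((N ^ l * e) \<star> v) f)"
    proof (rule self_adjoint_form[OF f _ sa[of l]])
      show "0 < d" using d by simp
    qed blast
  qed
  then obtain fl where fl: "\<And>l. fl l \<in> homogeneous d" "\<And>l v. ctr v (fl l) = ctr ((N ^ l * e) \<star> v) f"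
    by blast
  define g where "g l = fmapc const (fl l)" for l
  have g: "ctr w (g l) = ctr (?c (N ^ l * e) \<star> w) (fmapc const f)" for w l
    unfolding g_def by (rule ctr_lift) (rule fl)
  have Nl: "N ^ l * e * B = 0" if "k \<le> l" for l B
  proof -
    have "N ^ l * e * B = N ^ (l - k) * (N ^ k * e) * B"
      using that by (simp only: mult.assoc[symmetric] power_add[symmetric]) simp
    then show ?thesis by (simp add: k)
  qed
  have gz: "g l = 0" if "k \<le> l" for l
  proof -
    have "ctr v (fl l) = 0" for v using Nl[OF that, of 1] by (simp add: fl)
    then have "fl l = 0" using form_zeroI[OF fl(1)] d by simp
    then show ?thesis by (simp add: g_def fmapc_0[OF hc])
  qed
  define \<theta> where "\<theta> i = (monom 1 (Suc i) :: 'k poly)" for i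
  have \<theta>0: "at0 (\<theta> i) = 0" for i by (simp add: \<theta>_def poly_monom)
  have \<theta>inj: "inj_on \<theta> I" for I
  proof (rule inj_onI)
    fix i j assume "\<theta> i = \<theta> j"
    then have "degree (monom (1::'k) (Suc i)) = degree (monom (1::'k) (Suc j))" by (simp add: \<theta>_def)
    then show "i = j" by (simp add: degree_monom_eq)
  qed
  define \<kappa> where "\<kappa> c = [:Poly_Mapping.single (0 :: 'r exponent) c:]" for c :: "'k poly"
  have h\<kappa>: "is_hom \<kappa>" unfolding \<kappa>_def by (rule is_hom_comp[OF is_hom_const_poly is_hom_single0])
  \<comment> \<open>\<open>\<Phi> j\<close> is \<open>\<Psi>\<close> after multiplication by \<open>P j\<close>; see \<open>\<Psi>P\<close>.\<close>
  define \<Phi> where "\<Phi> j = pfun (\<lambda>m D. pair D (newton \<theta> g m j))" for j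
  have \<Phi>_add: "\<Phi> j (x + y) = \<Phi> j x + \<Phi> j y" for j x y
    unfolding \<Phi>_def by (rule pfun_add) (simp_all add: pair_add)
  have \<Phi>_C: "\<Phi> j ([:D:] * x) = pfun (\<lambda>m E. pair E (contract D (newton \<theta> g m j))) x" for j D x
    unfolding \<Phi>_def by (simp add: pfun_smult pair_mult)
  have \<Phi>_scale: "\<Phi> j (\<kappa> c * x) = c * \<Phi> j x" for j c x
    unfolding \<kappa>_def \<Phi>_C by (simp add: contract_const pair_fscale pfun_mult_fun \<Phi>_def)
  define \<Psi> where "\<Psi> = \<Phi> 0"
  interpret functional \<kappa> \<Psi>
    by unfold_locales (simp_all add: \<Psi>_def h\<kappa> \<Phi>_add \<Phi>_scale)
  have \<Phi>_X: "\<Phi> j ((?X - \<kappa> (\<theta> j)) * x) = \<Phi> (Suc j) x" for j x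
  proof -
    interpret j: functional \<kappa> "\<Phi> j" by unfold_locales (simp_all add: h\<kappa> \<Phi>_add \<Phi>_scale)
    have "\<Phi> j (?X * x) = pfun (\<lambda>m D. pair D (newton \<theta> g (Suc m) j)) x"
      unfolding \<Phi>_def by (simp add: pfun_pCons)
    also have "\<dots> = \<Phi> (Suc j) x + \<theta> j * \<Phi> j x"
      by (simp add: pair_add pair_fscale pfun_add_fun pfun_mult_fun \<Phi>_def)
    finally show ?thesis by (simp add: left_diff_distrib j.diff \<Phi>_scale)
  qed
  define P where "P j = (\<Prod>i<j. ?X - \<kappa> (\<theta> i))" for j
  have P0: "P 0 = 1" and PS: "P (Suc j) = P j * (?X - \<kappa> (\<theta> j))" for j by (simp_all add: P_def)
  have \<Psi>P: "\<Psi> (P j * x) = \<Phi> j x" for j x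
    by (induction j arbitrary: x) (simp_all add: P0 PS \<Psi>_def mult.assoc \<Phi>_X)
  have \<Psi>Pk: "\<Psi> (P k * x) = 0" for x
    unfolding \<Psi>P \<Phi>_def by (simp add: newton_zero[OF gz])
  \<comment> \<open>The ends of chains are discarded by this fact.\<close>
  have kill: "\<Psi> (P j * ([:lin u:] * x)) = 0" if "\<And>l. l \<ge> j \<Longrightarrow> ctr u (g l) = 0" for j u x
  proof -
    have "ctr u (newton \<theta> g m j) = 0" for m by (rule newton_ctr_zero) (rule that)
    then show ?thesis unfolding \<Psi>P \<Phi>_C ctr_def[symmetric] by simp
  qed
  \<comment> \<open>The element that represents the vector \<open>v\<close>.\<close>
  define s where "s v = (\<Sum>j<k. P j * [:lin (?c (\<pi> j) \<star> v):])" for v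
  define \<sigma> where "\<sigma> i = s (axis i 1)" for i
  have vect: "vect \<sigma> v = s v" for v
  proof -
    have l: "lin (A \<star> v) = (\<Sum>i\<in>UNIV. Poly_Mapping.single 0 (v $ i) * lin (A \<star> axis i 1))" for A
      by (subst vec_expand[of v]) (simp only: app_vsum app_vscale lin_sum lin_scale)
    have c: "[:\<Sum>i\<in>UNIV. x i:] = (\<Sum>i\<in>UNIV. [:x i:])" for x :: "'r \<Rightarrow> ('k poly, 'r) diffop"
      by (rule hom_sum) (rule is_hom_const_poly)
    have "vect \<sigma> v = (\<Sum>i\<in>UNIV. \<Sum>j<k. P j * (\<kappa> (v $ i) * [:lin (?c (\<pi> j) \<star> axis i 1):]))"
      unfolding vect_def \<sigma>_def s_def sum_distrib_left by (simp only: mult.left_commute)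
    also have "\<dots> = (\<Sum>j<k. P j * (\<Sum>i\<in>UNIV. \<kappa> (v $ i) * [:lin (?c (\<pi> j) \<star> axis i 1):]))"
      by (subst sum.swap) (simp only: sum_distrib_left)
    also have "\<dots> = s v" unfolding s_def l c by (simp add: \<kappa>_def mult.commute)
    finally show ?thesis .
  qed
  define A where "A = ?c N + (\<Sum>i<k. scal (\<theta> i) * (?c N ^ i * ?c (\<pi> i)))"
  have \<pi>A: "?c (\<pi> j) \<star> A \<star> v = ?c (\<pi> j * N) \<star> v + \<theta> j *s (?c (\<pi> j) \<star> v)" for j v
  proof -
    have "?c (\<pi> j) * (scal (\<theta> i) * (?c N ^ i * ?c (\<pi> i))) = scal (\<theta> i) * ?c (\<pi> j * N ^ i * \<pi> i)" for i
      by (simp only: emap_mult[OF hc] emap_power[OF hc] mult.assoc[symmetric] scal_commute)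
    then have "?c (\<pi> j) * A = ?c (\<pi> j * N) + (\<Sum>i<k. scal (\<theta> i) * ?c (if i = j then \<pi> j else 0))"
      unfolding A_def distrib_left sum_distrib_left by (simp only: emap_mult[OF hc] js(7))
    also have "(\<Sum>i<k. scal (\<theta> i) * ?c (if i = j then \<pi> j else 0)) = (\<Sum>i<k. if i = j then scal (\<theta> j) * ?c (\<pi> j) else 0)"
      by (rule sum.cong) (auto simp: emap_0[OF hc])
    also have "\<dots> = scal (\<theta> j) * ?c (\<pi> j)" using js(1)[of j] by (auto simp: emap_0[OF hc])
    finally have "(?c (\<pi> j) * A) \<star> v = ?c (\<pi> j * N) \<star> v + \<theta> j *s (?c (\<pi> j) \<star> v)"
      by (simp only: app_add app_mult app_scal)
    then show ?thesis by (simp only: app_mult)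
  qed
  have actA: "acts_as \<sigma> A ?X" unfolding acts_as_def vect
  proof (intro allI)
    fix v z
    define w where "w j = ?c (\<pi> j - \<pi> (Suc j) * N) \<star> v" for j
    have XP: "?X * P j = P (Suc j) + \<kappa> (\<theta> j) * P j" for j by (simp add: PS algebra_simps)
    have "s (A \<star> v) = (\<Sum>j<k. P j * [:lin (?c (\<pi> j * N) \<star> v):]) + (\<Sum>j<k. \<kappa> (\<theta> j) * P j * [:lin (?c (\<pi> j) \<star> v):])"
      unfolding s_def \<pi>A lin_add lin_scale sum.distrib[symmetric]
      by (rule sum.cong) (simp_all add: \<kappa>_def algebra_simps smult_add_left)
    also have "(\<Sum>j<k. P j * [:lin (?c (\<pi> j * N) \<star> v):]) = (\<Sum>j<k. P (Suc j) * [:lin (?c (\<pi> (Suc j) * N) \<star> v):])"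
    proof -
      let ?g = "\<lambda>j. P j * [:lin (?c (\<pi> j * N) \<star> v):]"
      have "?g 0 = 0" "?g k = 0" by (simp_all add: js(1,5) emap_0[OF hc])
      moreover have "(\<Sum>j<Suc k. ?g j) = ?g 0 + (\<Sum>j<k. ?g (Suc j))" by (rule sum.lessThan_Suc_shift)
      ultimately show ?thesis by simp
    qed
    finally have sA: "s (A \<star> v) = (\<Sum>j<k. P (Suc j) * [:lin (?c (\<pi> (Suc j) * N) \<star> v):]) +
      (\<Sum>j<k. \<kappa> (\<theta> j) * P j * [:lin (?c (\<pi> j) \<star> v):])" .
    have "?X * s v = (\<Sum>j<k. P (Suc j) * [:lin (?c (\<pi> j) \<star> v):]) + (\<Sum>j<k. \<kappa> (\<theta> j) * P j * [:lin (?c (\<pi> j) \<star> v):])"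
      unfolding s_def sum_distrib_left mult.assoc[symmetric] XP by (simp only: distrib_right sum.distrib)
    then have "?X * s v = s (A \<star> v) + (\<Sum>j<k. P (Suc j) * [:lin (w j):])"
      unfolding sA w_def emap_diff[OF hc] app_diff lin_diff diff_pCons[symmetric]
      by (simp add: sum_subtractf right_diff_distrib smult_diff_left)
    moreover have "\<Psi> (P (Suc j) * ([:lin (w j):] * z)) = 0" for j
    proof (rule kill)
      fix l assume l: "Suc j \<le> l"
      have "N ^ l * e * (\<pi> j - \<pi> (Suc j) * N) = N ^ l * (\<pi> j - \<pi> (Suc j) * N)"
        by (simp only: mult.assoc right_diff_distrib js(2)) (simp only: mult.assoc[symmetric] js(2))
      also have "\<dots> = N ^ (l - Suc j) * (N ^ Suc j * (\<pi> j - \<pi> (Suc j) * N))"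
        using l by (simp only: mult.assoc[symmetric] power_add[symmetric]) simp
      finally have "N ^ l * e * (\<pi> j - \<pi> (Suc j) * N) = 0" by (simp only: js(6) mult_zero_right)
      then have "?c (N ^ l * e) \<star> w j = 0"
        unfolding w_def app_mult[symmetric] emap_mult[OF hc, symmetric] by (simp add: emap_0[OF hc])
      then show "ctr (w j) (g l) = 0" unfolding g by simp
    qed
    ultimately have "\<Psi> (?X * s v * z) = \<Psi> (s (A \<star> v) * z)"
      by (simp only: distrib_right sum_distrib_right add sum mult.assoc) simp
    then show "\<Psi> (s (A \<star> v) * z) = \<Psi> (?X * (s v * z))" by (simp only: mult.assoc)
  qed
  have s_e: "s (?c e \<star> v) = s v" for v
    unfolding s_def by (simp only: app_mult[symmetric] emap_mult[OF hc, symmetric] js(3))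
  have act_e: "acts_as \<sigma> (?c e) 1" by (simp add: acts_as_def vect s_e)
  define L where "L j = filter (\<lambda>i. i \<noteq> j) [0..<k]" for j
  define E where "E j = ?c e * prod_list (map (\<lambda>i. A - scal (\<theta> i)) (L j))" for j
  define m where "m j = 1 * prod_list (map (\<lambda>i. ?X - \<kappa> (\<theta> i)) (L j))" for j
  have actE: "acts_as \<sigma> (E j) (m j)" for j
    unfolding E_def m_def
    by (intro acts_as_mult act_e acts_as_prod_list acts_as_diff actA acts_as_scal)
  have setL: "set (L j) = {..<k} - {j}" "distinct (L j)" for j by (auto simp: L_def)
  have m: "m j = (\<Prod>i\<in>{..<k} - {j}. ?X - \<kappa> (\<theta> i))" for j
    unfolding m_def using prod.distinct_set_conv_list[OF setL(2)[of j], of "\<lambda>i. ?X - \<kappa> (\<theta> i)"] by (simp add: setL)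
  obtain r q where q: "q \<noteq> 0" and rq: "\<And>x. (\<Sum>j<k. \<kappa> (r j) * (\<Prod>i\<in>{..<k} - {j}. x - \<kappa> (\<theta> i))) = \<kappa> q"
    using separating_combination[OF h\<kappa> finite_lessThan _ \<theta>inj, of k] k(1) by (auto simp: lessThan_empty_iff)
  have "splitting_family d f e k (dform \<Psi> \<sigma> d) E r q"
  proof (rule splitting_family_dform)
    show "functional \<kappa> \<Psi>" by (rule functional_axioms)
    show "acts_as \<sigma> (E p) (m p)" for p by (rule actE)
    show "\<Psi> (m p * m p' * z) = 0" if "p < k" "p' < k" "p \<noteq> p'" for p p' z
    proof -
      have "m p' = (?X - \<kappa> (\<theta> p)) * (\<Prod>i\<in>{..<k} - {p'} - {p}. ?X - \<kappa> (\<theta> i))"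
        unfolding m using that by (intro prod.remove) auto
      moreover have "P k = (?X - \<kappa> (\<theta> p)) * m p"
        unfolding m P_def using that by (intro prod.remove) auto
      ultimately have "m p * m p' * z = P k * ((\<Prod>i\<in>{..<k} - {p'} - {p}. ?X - \<kappa> (\<theta> i)) * z)"
        by (simp only: ac_simps)
      then show ?thesis by (simp only: \<Psi>Pk)
    qed
    show "(\<Sum>p<k. \<kappa> (r p) * m p) = \<kappa> q" unfolding m by (rule rq)
    show "emap at0 (E p) \<noteq> 0" if "p < k" for p
    proof -
      have "emap at0 A = N"
        by (simp add: A_def emap_add[OF h0] emap_sum[OF h0] emap_mult[OF h0] emap_scal[OF h0] \<theta>0)
      then have "emap at0 (A - scal (\<theta> i)) = N" for i by (simp add: emap_diff[OF h0] emap_scal[OF h0] \<theta>0)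
      then have "emap at0 (E p) = e * N ^ length (L p)"
        by (simp add: E_def emap_mult[OF h0] emap_prod_list[OF h0] o_def prod_list_const_map)
      also have "length (L p) = k - 1"
        using distinct_card[OF setL(2)[of p]] that by (simp add: setL(1))
      also have "e * N ^ (k - 1) = N ^ (k - 1) * e" by (rule power_commute_endo[OF e(2), symmetric])
      finally show ?thesis using k(3) by simp
    qed
    show "?c e * E p = E p" for p
      by (simp only: E_def mult.assoc[symmetric] emap_mult[OF hc, symmetric] e(1))
    show "vect \<sigma> (?c e \<star> v) = vect \<sigma> v" for v by (simp only: vect s_e)
    fix v
    \<comment> \<open>At \<open>t = 0\<close> the representative of \<open>u\<close> may be replaced by \<open>u\<close> itself, one factor at a time.\<close>
    have sw: "at0 (\<Psi> (s u * z)) = at0 (\<Psi> ([:lin u:] * z))" for u z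
    proof -
      have "at0 (pair D (\<Sum>j<k. ctr (?c (\<pi> j) \<star> u) (newton \<theta> g n j))) = at0 (pair D (ctr u (newton \<theta> g n 0)))" for n D
      proof (rule pair_at0)
        let ?u = "vmap at0 u"
        have "vmap at0 (?c (\<pi> j) \<star> u) = \<pi> j \<star> ?u" for j
          by (simp only: emap_app[OF h0, symmetric] emap_at0_const)
        then have "fmapc at0 (\<Sum>j<k. ctr (?c (\<pi> j) \<star> u) (newton \<theta> g n j)) = (\<Sum>j<k. ctr (\<pi> j \<star> ?u) (fl (j + n)))"
          by (simp add: fmapc_sum[OF h0] fmapc_ctr[OF h0] newton_at0[OF \<theta>0] g_def)
        also have "\<dots> = ctr ((N ^ n * (\<Sum>j<k. N ^ j * \<pi> j)) \<star> ?u) f"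
        proof -
          have "(N ^ (j + n) * e) \<star> \<pi> j \<star> ?u = (N ^ n * (N ^ j * \<pi> j)) \<star> ?u" for j
          proof -
            have "N ^ (j + n) * e * \<pi> j = N ^ n * (N ^ j * \<pi> j)"
              by (simp only: mult.assoc js(2)) (simp only: mult.assoc[symmetric] power_add[symmetric] add.commute)
            then show ?thesis by (simp only: app_mult[symmetric])
          qed
          then show ?thesis by (simp only: fl sum_distrib_left app_sum ctr_vsum)
        qed
        also have "\<dots> = fmapc at0 (ctr u (newton \<theta> g n 0))"
          by (simp add: js(4) fmapc_ctr[OF h0] newton_at0[OF \<theta>0] g_def fl)
        finally show "fmapc at0 (\<Sum>j<k. ctr (?c (\<pi> j) \<star> u) (newton \<theta> g n j)) = fmapc at0 (ctr u (newton \<theta> g n 0))" .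
      qed
      note eq = this
      have "\<Psi> (s u * z) = (\<Sum>j<k. pfun (\<lambda>m E. pair E (ctr (?c (\<pi> j) \<star> u) (newton \<theta> g m j))) z)"
        unfolding s_def sum_distrib_right sum mult.assoc \<Psi>P \<Phi>_C ctr_def ..
      also have "\<dots> = (\<Sum>m\<le>degree z. pair (coeff z m) (\<Sum>j<k. ctr (?c (\<pi> j) \<star> u) (newton \<theta> g m j)))"
        unfolding pfun_def pair_sum by (rule sum.swap)
      finally have "at0 (\<Psi> (s u * z)) = (\<Sum>m\<le>degree z. at0 (pair (coeff z m) (ctr u (newton \<theta> g m 0))))"
        by (simp only: poly_sum eq)
      also have "\<dots> = at0 (\<Psi> ([:lin u:] * z))"
        unfolding \<Psi>_def \<Phi>_C pfun_def ctr_def poly_sum ..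
      finally show ?thesis .
    qed
    have "fmapc at0 (dform \<Psi> \<sigma> d) = fl 0"
    proof (rule poly_mapping_eqI)
      fix \<alpha>
      show "Poly_Mapping.lookup (fmapc at0 (dform \<Psi> \<sigma> d)) \<alpha> = Poly_Mapping.lookup (fl 0) \<alpha>"
      proof (cases "total_degree \<alpha> = d")
        case True
        have "at0 (\<Psi> ((\<Prod>i\<in>UNIV. \<sigma> i ^ Poly_Mapping.lookup \<alpha> i) * 1)) =
          at0 (\<Psi> ((\<Prod>i\<in>UNIV. [:lin (axis i 1):] ^ Poly_Mapping.lookup \<alpha> i) * 1))"
          by (rule prod_replace[where G = "\<lambda>x. at0 (\<Psi> x)"]) (simp_all only: \<sigma>_def sw finite)
        also have "(\<Prod>i\<in>UNIV. [:lin (axis i 1):] ^ Poly_Mapping.lookup \<alpha> i) * 1 = [:Poly_Mapping.single \<alpha> 1 :: ('k poly, 'r) diffop:]"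
        proof -
          have pw: "[:x:] ^ n = [:x ^ n:]" for x :: "('k poly, 'r) diffop" and n
            by (induction n) (simp_all add: one_pCons)
          have pr: "(\<Prod>i\<in>I. [:x i:]) = [:\<Prod>i\<in>I. x i:]" for x :: "'r \<Rightarrow> ('k poly, 'r) diffop" and I
            by (induction I rule: infinite_finite_induct) (simp_all add: one_pCons)
          show ?thesis by (simp only: pw pr prod_lin_axis mult_1_right)
        qed
        also have "\<Psi> [:Poly_Mapping.single \<alpha> 1:] = Poly_Mapping.lookup (g 0) \<alpha>"
          by (simp add: \<Psi>_def \<Phi>_def pfun_def pair_monomial)
        finally show ?thesis using True
          by (simp add: lookup_fmapc[OF h0] lookup_dform g_def lookup_fmapc[OF hc])
      next
        case False
        then show ?thesis using fl(1)[of 0] by (simp add: lookup_fmapc[OF h0] lookup_dform homogeneous_iff)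
      qed
    qed
    then show "ctr v (fmapc at0 (dform \<Psi> \<sigma> d)) = ctr (e \<star> v) f" by (simp add: fl)
  qed (use d q in auto)
  then show ?thesis by (auto simp: deforms_into_def)
qed

section \<open>The algebra of self-adjoint operators of a nondegenerate form\<close>

text \<open>
  A relation \<open>p(z) v = 0\<close> yields an eigenvector by splitting off linear factors of \<open>p\<close>. The
  idempotent \<open>e\<close> keeps track of the invariant subspace in which everything happens.
\<close>

lemma eigenvector_of_relation:
  fixes z e :: "('k::alg_closed_field, 'r::finite) endo"
  assumes ez: "e * z = z * e"
  shows "p \<noteq> 0 \<Longrightarrow> degree p \<le> n \<Longrightarrow> v \<noteq> 0 \<Longrightarrow> e \<star> v = v \<Longrightarrow>
    (\<Sum>i\<le>n. coeff p i *s (z ^ i) \<star> v) = 0 \<Longrightarrow> \<exists>c w. w \<noteq> 0 \<and> e \<star> w = w \<and> z \<star> w = c *s w"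
proof (induction n arbitrary: p)
  case 0
  then have "coeff p 0 \<noteq> 0" by (metis le_zero_eq leading_coeff_neq_0)
  then show ?case using 0 by simp
next
  case (Suc n)
  show ?case
  proof (cases "degree p = 0")
    case True
    then have p: "coeff p i = 0" if "i > 0" for i using that by (simp add: coeff_eq_0)
    have "(\<Sum>i\<le>Suc n. coeff p i *s (z ^ i) \<star> v) = (\<Sum>i\<le>Suc n. if i = 0 then coeff p 0 *s v else 0)"
      by (rule sum.cong) (auto simp: p)
    then have "coeff p 0 *s v = 0" using Suc.prems(5) by simp
    moreover have "coeff p 0 \<noteq> 0" using True Suc.prems(1) by (metis leading_coeff_neq_0)
    ultimately show ?thesis using Suc.prems(3) by simp
  next
    case False
    then obtain c where "poly p c = 0" using alg_closed_imp_poly_has_root[of p] by auto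
    then obtain q where pq: "p = [:-c, 1:] * q" by (auto simp: poly_eq_0_iff_dvd)
    then have p: "p = pCons 0 q - smult c q" and q: "q \<noteq> 0" using Suc.prems(1) by auto
    have "degree p = Suc (degree q)" unfolding pq using q by (subst degree_mult_eq) auto
    then have dq: "degree q \<le> n" using Suc.prems(2) by simp
    define w where "w = (\<Sum>i\<le>n. coeff q i *s (z ^ i) \<star> v)"
    have "(\<Sum>i\<le>Suc n. coeff p i *s (z ^ i) \<star> v) =
      (\<Sum>i\<le>Suc n. coeff (pCons 0 q) i *s (z ^ i) \<star> v) - (\<Sum>i\<le>Suc n. c *s (coeff q i *s (z ^ i) \<star> v))"
      unfolding sum_subtractf[symmetric] by (rule sum.cong) (simp_all add: p vec.scale_left_diff_distrib)
    also have "(\<Sum>i\<le>Suc n. coeff (pCons 0 q) i *s (z ^ i) \<star> v) = z \<star> w"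
      unfolding w_def app_vsum
      by (subst sum.atMost_Suc_shift) (simp add: app_vscale app_mult)
    also have "(\<Sum>i\<le>Suc n. c *s (coeff q i *s (z ^ i) \<star> v)) = c *s w"
      using dq by (simp add: w_def coeff_eq_0 vec.scale_sum_right)
    finally have zw: "z \<star> w = c *s w" using Suc.prems(5) by simp
    have "e \<star> (z ^ i) \<star> v = (z ^ i) \<star> v" for i
    proof -
      have "e * z ^ i = z ^ i * e" using power_commute_endo[of z e i] ez by simp
      then show ?thesis using Suc.prems(4) by (simp only: app_mult[symmetric]) (simp only: app_mult)
    qed
    then have ew: "e \<star> w = w" by (simp add: w_def app_vsum app_vscale)
    show ?thesis
    proof (cases "w = 0")
      case True
      then show ?thesis using Suc.IH[OF q dq Suc.prems(3,4)] by (simp add: w_def)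
    next
      case False
      then show ?thesis using ew zw by blast
    qed
  qed
qed

lemma eigenvector_exists:
  fixes z e :: "('k::alg_closed_field, 'r::finite) endo"
  assumes "e * z = z * e" "e * e = e" "e \<noteq> 0"
  obtains c w where "w \<noteq> 0" "e \<star> w = w" "z \<star> w = c *s w"
proof -
  obtain v where "e \<star> v \<noteq> 0" using assms(3) by (rule nonzero_app)
  define v0 where "v0 = e \<star> v"
  have v0: "v0 \<noteq> 0" "e \<star> v0 = v0" using \<open>e \<star> v \<noteq> 0\<close> assms(2) by (simp_all add: v0_def app_mult[symmetric])
  let ?n = "CARD('r)"
  have "\<not> indep (Suc ?n) (\<lambda>i. (z ^ i) \<star> v0)" using indep_le_card by fastforce
  then obtain c j where c: "(\<Sum>i<Suc ?n. c i *s (z ^ i) \<star> v0) = 0" "j < Suc ?n" "c j \<noteq> 0"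
    unfolding indep_def by blast
  define p where "p = (\<Sum>i\<le>?n. monom (c i) i)"
  have co: "coeff p i = (if i \<le> ?n then c i else 0)" for i
    by (auto simp: p_def coeff_sum)
  have "p \<noteq> 0" using c(2,3) co[of j] by auto
  moreover have "degree p \<le> ?n" by (rule degree_le) (simp add: co)
  moreover have "(\<Sum>i\<le>?n. coeff p i *s (z ^ i) \<star> v0) = 0"
    using c(1) by (simp add: co lessThan_Suc_atMost)
  ultimately obtain a w where "w \<noteq> 0 \<and> e \<star> w = w \<and> z \<star> w = a *s w"
    using eigenvector_of_relation[OF assms(1) _ _ v0, of p ?n] by blast
  then show ?thesis using that by blast
qed

text \<open>
  In a linear relation between powers of \<open>y\<close>, divide by the lowest coefficient that occurs. The
  last conclusion expresses that \<open>g\<close> is a polynomial in \<open>y\<close>: it lies in every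
  subalgebra that contains \<open>y\<close>.
\<close>

lemma power_divisible_by_next:
  fixes y :: "('k::field, 'r::finite) endo"
  obtains m g where "y ^ m = y ^ Suc m * g" "y * g = g * y"
    "\<And>S. 1 \<in> S \<Longrightarrow> 0 \<in> S \<Longrightarrow> y \<in> S \<Longrightarrow> (\<And>a b. a \<in> S \<Longrightarrow> b \<in> S \<Longrightarrow> a + b \<in> S) \<Longrightarrow>
       (\<And>a b. a \<in> S \<Longrightarrow> b \<in> S \<Longrightarrow> a * b \<in> S) \<Longrightarrow> (\<And>c. scal c \<in> S) \<Longrightarrow> g \<in> S"
proof -
  \<comment> \<open>Matrices as vectors, in order to count dimensions.\<close>
  define fl where "fl A = (\<chi> p. mat_of A $ fst p $ snd p)" for A :: "('k, 'r) endo"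
  have fl_inj: "A = B" if "fl A = fl B" for A B
  proof -
    have "fl A $ (i, j) = fl B $ (i, j)" for i j using that by simp
    then have "mat_of A = mat_of B" by (simp add: fl_def vec_eq_iff)
    then show ?thesis by (simp add: mat_of_inject)
  qed
  have fl_add: "fl (A + B) = fl A + fl B" for A B by (simp add: fl_def vec_eq_iff plus_endo.rep_eq)
  have fl_0: "fl 0 = 0" by (simp add: fl_def vec_eq_iff zero_endo.rep_eq)
  have mat_scal: "mat_of (scal c * A) $ i $ j = c * mat_of A $ i $ j" for c and A :: "('k, 'r) endo" and i j
  proof -
    have "mat_of B $ i $ j = (B \<star> axis j 1) $ i" for B :: "('k, 'r) endo"
      by (simp add: app_nth axis_def if_distrib cong: if_cong)
    then show ?thesis by (simp only: app_mult app_scal vector_smult_component)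
  qed
  have fl_scal: "fl (scal c * A) = c *s fl A" for c A by (simp add: fl_def vec_eq_iff mat_scal)
  have fl_sum: "fl (\<Sum>i\<in>I. A i) = (\<Sum>i\<in>I. fl (A i))" for A and I :: "nat set"
    by (induction I rule: infinite_finite_induct) (simp_all add: fl_add fl_0)
  define n where "n = Suc (CARD('r \<times> 'r))"
  have "\<not> indep n (\<lambda>i. fl (y ^ i))" using indep_le_card[of n "\<lambda>i. fl (y ^ i)"] unfolding n_def by auto
  then obtain c j where c: "(\<Sum>i<n. c i *s fl (y ^ i)) = 0" "j < n" "c j \<noteq> 0"
    unfolding indep_def by blast
  define m where "m = (LEAST j. c j \<noteq> 0)"
  have m: "c m \<noteq> 0" unfolding m_def by (rule LeastI) (rule c(3))
  have mn: "m < n" using Least_le[of "\<lambda>j. c j \<noteq> 0" j] c(2,3) by (simp add: m_def)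
  have below: "c i = 0" if "i < m" for i using not_less_Least[of i "\<lambda>j. c j \<noteq> 0"] that by (simp add: m_def)
  have "fl (\<Sum>i<n. scal (c i) * y ^ i) = fl 0" using c(1) by (simp only: fl_sum fl_scal fl_0)
  then have rel: "(\<Sum>i<n. scal (c i) * y ^ i) = 0" by (rule fl_inj)
  define g where "g = (\<Sum>i\<in>{Suc m..<n}. scal (- c i / c m) * y ^ (i - Suc m))"
  have yg: "y ^ Suc m * g = (\<Sum>i\<in>{Suc m..<n}. scal (- c i / c m) * y ^ i)"
    unfolding g_def sum_distrib_left
  proof (rule sum.cong[OF refl])
    fix i assume "i \<in> {Suc m..<n}"
    then have i: "Suc m + (i - Suc m) = i" by simp
    have "y ^ Suc m * (scal (- c i / c m) * y ^ (i - Suc m)) = scal (- c i / c m) * (y ^ Suc m * y ^ (i - Suc m))"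
      by (simp only: mult.assoc[symmetric] scal_commute)
    also have "y ^ Suc m * y ^ (i - Suc m) = y ^ i" by (simp only: power_add[symmetric] i)
    finally show "y ^ Suc m * (scal (- c i / c m) * y ^ (i - Suc m)) = scal (- c i / c m) * y ^ i" .
  qed
  have "(\<Sum>i<n. scal (c i) * y ^ i) = scal (c m) * y ^ m + (\<Sum>i\<in>{Suc m..<n}. scal (c i) * y ^ i)"
  proof -
    have "(\<Sum>i<n. scal (c i) * y ^ i) = (\<Sum>i\<in>{m..<n}. scal (c i) * y ^ i)"
      by (rule sum.mono_neutral_right) (auto simp: below not_le)
    also have "\<dots> = scal (c m) * y ^ m + (\<Sum>i\<in>{Suc m..<n}. scal (c i) * y ^ i)"
      using mn by (rule sum.atLeast_Suc_lessThan)
    finally show ?thesis .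
  qed
  then have "scal (1 / c m) * (scal (c m) * y ^ m + (\<Sum>i\<in>{Suc m..<n}. scal (c i) * y ^ i)) = 0"
    using rel by simp
  then have "y ^ m + (\<Sum>i\<in>{Suc m..<n}. scal (c i / c m) * y ^ i) = 0"
    using m by (simp add: distrib_left sum_distrib_left mult.assoc[symmetric] scal_mult[symmetric])
  moreover have "(\<Sum>i\<in>{Suc m..<n}. scal (c i / c m) * y ^ i) = - (y ^ Suc m * g)"
  proof -
    have "(scal (- x) :: ('k, 'r) endo) = - scal x" for x
      using scal_add[of x "- x"] by (simp add: eq_neg_iff_add_eq_0 add.commute)
    then show ?thesis unfolding yg by (simp add: sum_negf)
  qed
  ultimately have rel': "y ^ m = y ^ Suc m * g" by simp
  have comm: "y * g = g * y"
  proof -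
    have "y * (scal a * y ^ i) = scal a * y ^ i * y" for a i
      by (metis mult.assoc power_commutes scal_commute)
    then show ?thesis unfolding g_def sum_distrib_left sum_distrib_right by simp
  qed
  show thesis
  proof (rule that[OF rel' comm])
    fix S :: "('k, 'r) endo set"
    assume S: "1 \<in> S" "0 \<in> S" "y \<in> S" "\<And>a b. a \<in> S \<Longrightarrow> b \<in> S \<Longrightarrow> a + b \<in> S"
       "\<And>a b. a \<in> S \<Longrightarrow> b \<in> S \<Longrightarrow> a * b \<in> S" "\<And>c. scal c \<in> S"
    have pw: "y ^ i \<in> S" for i by (induction i) (simp_all add: S)
    have "(\<Sum>i\<in>I. scal (a i) * y ^ (b i)) \<in> S" for I :: "nat set" and a b
      by (induction I rule: infinite_finite_induct) (simp_all add: S pw)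
    then show "g \<in> S" unfolding g_def .
  qed
qed

lemma total_degree_eq_0: "total_degree \<alpha> = 0 \<longleftrightarrow> \<alpha> = 0"
proof
  assume "total_degree \<alpha> = 0"
  then have "Poly_Mapping.lookup \<alpha> i = 0" for i by (simp add: total_degree_def)
  then show "\<alpha> = 0" by (intro poly_mapping_eqI) simp
qed simp

locale nondegenerate_form =
  fixes f :: "('k::alg_closed_field, 'r::finite) dpower" and d :: nat
  assumes f: "f \<in> homogeneous d" and d: "d \<ge> 3" and nondeg: "nondegenerate f"
begin

abbreviation Z :: "('k, 'r) endo set" where "Z \<equiv> {A. self_adjoint A f}"

lemma ctr_eq_0D: "ctr v f = 0 \<Longrightarrow> v = 0"
  using nondeg by (simp add: nondegenerate_def)

text \<open>
  Nondegeneracy may be tested with two, or with three, free arguments of \<open>f\<close> because \<open>d \<ge> 3\<close>.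
\<close>

lemma ctr2_eq_0D:
  assumes "\<And>w. ctr w (ctr v f) = 0" shows "v = 0"
proof -
  have "ctr v f = 0"
    by (rule form_zeroI[OF homogeneous_ctr[OF f]]) (use d assms in auto)
  then show ?thesis by (rule ctr_eq_0D)
qed

lemma ctr3_eq_0D:
  assumes "\<And>w u. ctr u (ctr w (ctr v f)) = 0" shows "v = 0"
proof (rule ctr2_eq_0D)
  fix w
  show "ctr w (ctr v f) = 0"
    by (rule form_zeroI[OF homogeneous_ctr[OF homogeneous_ctr[OF f]]]) (use d assms in auto)
qed

lemma Z_sym: "A \<in> Z \<Longrightarrow> ctr (A \<star> v) (ctr w f) = ctr v (ctr (A \<star> w) f)"
  by (simp add: self_adjoint_def)

lemma Z_one: "1 \<in> Z" and Z_zero: "0 \<in> Z" and Z_scal: "scal c \<in> Z"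
  by (simp_all add: self_adjoint_def app_scal ctr_vscale ctr_fscale)

lemma Z_add: "A \<in> Z \<Longrightarrow> B \<in> Z \<Longrightarrow> A + B \<in> Z"
  by (simp add: self_adjoint_def app_add ctr_vadd ctr_add)

lemma Z_diff: "A \<in> Z \<Longrightarrow> B \<in> Z \<Longrightarrow> A - B \<in> Z"
  by (simp add: self_adjoint_def app_diff ctr_vdiff ctr_diff)

text \<open>
  \<open>A\<close> and \<open>B\<close> are moved around three arguments of \<open>f\<close>: from \<open>A\<close> and \<open>B\<close> both on \<open>v\<close>, move \<open>A\<close> to \<open>w\<close>, then
  \<open>B\<close> to \<open>u\<close>, then \<open>A\<close> back to \<open>v\<close> and \<open>B\<close> back to \<open>v\<close>. Now they are in the opposite order.
\<close>

lemma Z_commute: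
  assumes "A \<in> Z" "B \<in> Z" shows "A * B = B * A"
proof (rule endo_eqI)
  fix v
  have sw: "ctr a (ctr (C \<star> b) f) = ctr b (ctr (C \<star> a) f)" if "C \<in> Z" for C a b
    by (metis that Z_sym ctr_commute)
  have "ctr u (ctr w (ctr (A \<star> B \<star> v) f)) = ctr u (ctr w (ctr (B \<star> A \<star> v) f))" for u w
  proof -
    have "ctr u (ctr w (ctr (A \<star> B \<star> v) f)) = ctr u (ctr (B \<star> v) (ctr (A \<star> w) f))"
      by (simp only: sw[OF assms(1), of w])
    also have "\<dots> = ctr (A \<star> w) (ctr u (ctr (B \<star> v) f))"
      by (simp only: ctr_commute)
    also have "\<dots> = ctr (A \<star> w) (ctr v (ctr (B \<star> u) f))"
      by (simp only: sw[OF assms(2), of u])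
    also have "\<dots> = ctr (B \<star> u) (ctr v (ctr (A \<star> w) f))"
      by (simp only: ctr_commute)
    also have "\<dots> = ctr (B \<star> u) (ctr w (ctr (A \<star> v) f))"
      by (simp only: sw[OF assms(1), of w])
    also have "\<dots> = ctr w (ctr (A \<star> v) (ctr (B \<star> u) f))"
      by (simp only: ctr_commute)
    also have "\<dots> = ctr w (ctr u (ctr (B \<star> A \<star> v) f))"
      by (simp only: sw[OF assms(2), of u])
    also have "\<dots> = ctr u (ctr w (ctr (B \<star> A \<star> v) f))"
      by (rule ctr_commute)
    finally show ?thesis .
  qed
  then have "A \<star> B \<star> v - B \<star> A \<star> v = 0"
    by (intro ctr3_eq_0D) (simp add: ctr_vdiff ctr_diff)
  then show "(A * B) \<star> v = (B * A) \<star> v" by (simp add: app_mult)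
qed

lemma app_commute: "y \<in> Z \<Longrightarrow> z \<in> Z \<Longrightarrow> y \<star> z \<star> v = z \<star> y \<star> v"
  using Z_commute[of y z] by (simp only: app_mult[symmetric])

lemma Z_mult:
  assumes "A \<in> Z" "B \<in> Z" shows "A * B \<in> Z"
proof -
  have "ctr ((A * B) \<star> v) (ctr w f) = ctr v (ctr ((B * A) \<star> w) f)" for v w
    using Z_sym[OF assms(1)] Z_sym[OF assms(2)] by (simp add: app_mult)
  then show ?thesis by (simp add: self_adjoint_def Z_commute[OF assms])
qed

lemma Z_power: "A \<in> Z \<Longrightarrow> A ^ n \<in> Z"
  by (induction n) (use Z_one Z_mult in auto)

lemma Z_sum: "(\<And>i. i \<in> I \<Longrightarrow> A i \<in> Z) \<Longrightarrow> (\<Sum>i\<in>I. A i) \<in> Z"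
  by (induction I rule: infinite_finite_induct) (use Z_zero Z_add in auto)

text \<open>
  If the derivatives of \<open>f\<close> along \<open>u\<close> and along \<open>w\<close> both depend on one variable only, they are multiples
  of the same divided power of that variable. By nondegeneracy \<open>u\<close> and \<open>w\<close> are dependent.
\<close>

lemma one_direction_dependent:
  assumes span: "\<And>v. \<exists>c h. v = c *s e0 + h \<and> h \<in> H"
    and u: "\<And>h. h \<in> H \<Longrightarrow> ctr h (ctr u f) = 0" and w: "\<And>h. h \<in> H \<Longrightarrow> ctr h (ctr w f) = 0"
  obtains a b where "a *s u + b *s w = 0" "a \<noteq> 0 \<or> b \<noteq> 0"
proof -
  have vanish: "g = 0" if "g \<in> homogeneous n" "\<And>h. h \<in> H \<Longrightarrow> ctr h g = 0" "((ctr e0) ^^ n) g = 0" for g n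
    using that
  proof (induction n arbitrary: g)
    case (Suc n)
    have "ctr e0 g = 0"
    proof (rule Suc.IH)
      show "ctr e0 g \<in> homogeneous n" using homogeneous_ctr[OF Suc.prems(1)] by simp
      show "ctr h (ctr e0 g) = 0" if "h \<in> H" for h using Suc.prems(2)[OF that] by (simp add: ctr_commute[of h])
      show "((ctr e0) ^^ n) (ctr e0 g) = 0" using Suc.prems(3) by (simp add: funpow_swap1)
    qed
    have "ctr v g = 0" for v
    proof -
      obtain c h where "v = c *s e0 + h" "h \<in> H" using span by blast
      then show ?thesis using \<open>ctr e0 g = 0\<close> Suc.prems(2) by (simp add: ctr_vadd ctr_vscale)
    qed
    then show ?case using form_zeroI[OF Suc.prems(1)] by simp
  qed simp
  \<comment> \<open>The coefficient of that divided power in the derivative of \<open>f\<close> along \<open>x\<close>.\<close>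
  define c where "c x = Poly_Mapping.lookup (((ctr e0) ^^ (d - 1)) (ctr x f)) 0" for x
  have pow_add: "((ctr e0) ^^ n) (g + h) = ((ctr e0) ^^ n) g + ((ctr e0) ^^ n) h" for n g h
    by (induction n) (simp_all add: ctr_add)
  have pow_scale: "((ctr e0) ^^ n) (fscale a g) = fscale a (((ctr e0) ^^ n) g)" for n a g
    by (induction n) (simp_all add: ctr_fscale)
  have pow_hom: "((ctr e0) ^^ n) g \<in> homogeneous (m - n)" if "g \<in> homogeneous m" for n g m
    by (induction n) (use that homogeneous_ctr[of _ "m - n" for n] in \<open>auto simp: diff_Suc split: nat.splits dest: homogeneous_ctr\<close>)
  have key: "x = 0" if "c x = 0" "\<And>h. h \<in> H \<Longrightarrow> ctr h (ctr x f) = 0" for x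
  proof (rule ctr_eq_0D, rule vanish[of _ "d - 1"])
    show "ctr x f \<in> homogeneous (d - 1)" by (rule homogeneous_ctr[OF f])
    show "ctr h (ctr x f) = 0" if "h \<in> H" for h using that by fact
    have "((ctr e0) ^^ (d - 1)) (ctr x f) \<in> homogeneous 0"
      using pow_hom[OF homogeneous_ctr[OF f], of "d - 1"] by simp
    then show "((ctr e0) ^^ (d - 1)) (ctr x f) = 0"
    proof (intro poly_mapping_eqI)
      fix \<alpha> assume h: "((ctr e0) ^^ (d - 1)) (ctr x f) \<in> homogeneous 0"
      show "Poly_Mapping.lookup (((ctr e0) ^^ (d - 1)) (ctr x f)) \<alpha> = Poly_Mapping.lookup 0 \<alpha>"
      proof (cases "\<alpha> = 0")
        case True
        then show ?thesis using that(1) by (simp add: c_def)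
      next
        case False
        then show ?thesis using h by (simp add: homogeneous_iff total_degree_eq_0)
      qed
    qed
  qed
  have "c w *s u + (- c u) *s w = 0"
  proof (rule key)
    show "c (c w *s u + - c u *s w) = 0"
      by (simp only: c_def ctr_vadd ctr_vscale pow_add pow_scale lookup_add lookup_fscale) simp
    show "ctr h (ctr (c w *s u + - c u *s w) f) = 0" if "h \<in> H" for h
      by (simp only: ctr_vadd ctr_vscale ctr_add ctr_fscale u[OF that] w[OF that]) simp
  qed
  show thesis
  proof (cases "c u = 0")
    case True
    then have "u = 0" using key u by blast
    then show thesis using that[of 1 0] by simp
  next
    case False
    then show thesis using that[of "c w" "- c u"] \<open>c w *s u + (- c u) *s w = 0\<close> by simp
  qed
qed

definition primitive :: "('k, 'r) endo \<Rightarrow> bool" where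
  "primitive e \<longleftrightarrow> e \<in> Z \<and> e * e = e \<and> e \<noteq> 0 \<and> (\<forall>p\<in>Z. p * p = p \<longrightarrow> e * p = p \<longrightarrow> p = 0 \<or> p = e)"

text \<open>
  Local algebra: an element of \<open>eZ\<close> is invertible or nilpotent. From \<open>y\<^sup>m = y\<^sup>m\<^sup>+\<^sup>1 g\<close> one obtains
  the idempotent \<open>p = (yg)\<^sup>m\<close> with \<open>y\<^sup>m p = y\<^sup>m\<close>. If it is \<open>0\<close>, then \<open>y\<close> is nilpotent; it cannot be \<open>e\<close>,
  since \<open>y\<close> kills the vector \<open>w\<close> of \<open>eV\<close>.
\<close>

lemma primitive_nilpotent:
  assumes e: "primitive e" and y: "y \<in> Z" "e * y = y" and w: "w \<noteq> 0" "e \<star> w = w" "y \<star> w = 0"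
  obtains m where "m \<ge> 1" "y ^ m = 0"
proof -
  obtain m g where mg: "y ^ m = y ^ Suc m * g" "y * g = g * y" and gS: "\<And>S. 1 \<in> S \<Longrightarrow> 0 \<in> S \<Longrightarrow> y \<in> S \<Longrightarrow> (\<And>a b. a \<in> S \<Longrightarrow> b \<in> S \<Longrightarrow> a + b \<in> S) \<Longrightarrow>
       (\<And>a b. a \<in> S \<Longrightarrow> b \<in> S \<Longrightarrow> a * b \<in> S) \<Longrightarrow> (\<And>c. scal c \<in> S) \<Longrightarrow> g \<in> S"
    using power_divisible_by_next[of y] by metis
  have gZ: "g \<in> Z" by (rule gS[OF Z_one Z_zero y(1) Z_add Z_mult Z_scal])
  have m: "m \<ge> 1"
  proof (rule ccontr)
    assume "\<not> m \<ge> 1"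
    then have "m = 0" by simp
    then have "1 = g * y" using mg by simp
    then have "1 \<star> w = (g * y) \<star> w" by simp
    then have "1 \<star> w = g \<star> y \<star> w" by (simp only: app_mult)
    with w show False by simp
  qed
  have stable: "y ^ m = y ^ m * (y ^ j * g ^ j)" for j
  proof (induction j)
    case (Suc j)
    have "y ^ m * (y ^ Suc j * g ^ Suc j) = y ^ (m + Suc j) * (g * g ^ j)"
      by (simp only: mult.assoc[symmetric] power_add power_Suc)
    also have "m + Suc j = j + Suc m" by simp
    also have "y ^ (j + Suc m) * (g * g ^ j) = y ^ j * (y ^ Suc m * g) * g ^ j"
      by (simp only: mult.assoc power_add)
    also have "\<dots> = y ^ j * y ^ m * g ^ j" by (simp only: mg(1)[symmetric])
    also have "\<dots> = y ^ m * (y ^ j * g ^ j)"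
      by (simp only: mult.assoc[symmetric] power_add[symmetric] add.commute)
    finally show ?case using Suc by simp
  qed simp
  define p where "p = y ^ m * g ^ m"
  have pZ: "p \<in> Z" unfolding p_def by (rule Z_mult[OF Z_power[OF y(1)] Z_power[OF gZ]])
  have yp: "y ^ m * p = y ^ m" using stable[of m] by (simp add: p_def)
  have "p * p = p * y ^ m * g ^ m" by (simp add: p_def mult.assoc)
  also have "p * y ^ m = y ^ m * p" by (rule Z_commute[OF pZ Z_power[OF y(1)]])
  finally have pp: "p * p = p" using yp by (simp add: p_def)
  have "e * y ^ m = y ^ m" using y(2) m by (cases m) (simp_all add: mult.assoc[symmetric])
  then have "e * p = p" by (simp add: p_def mult.assoc[symmetric])
  then have "p = 0 \<or> p = e" using e pZ pp unfolding primitive_def by blast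
  then show thesis
  proof
    assume "p = 0"
    then show thesis using yp that[OF m] by simp
  next
    assume "p = e"
    have "p = g ^ m * y ^ m" unfolding p_def by (rule Z_commute[OF Z_power[OF y(1)] Z_power[OF gZ]])
    then have "e \<star> w = g ^ m \<star> (y ^ m) \<star> w" using \<open>p = e\<close> by (simp only: app_mult[symmetric])
    also have "(y ^ m) \<star> w = 0" using power_app_zero[of y 1 w m] w(3) m by simp
    finally show thesis using w by simp
  qed
qed

lemma primitive_decompose:
  assumes e: "primitive e" and z: "z \<in> Z" "e * z = z"
  obtains c y m where "z = scal c * e + y" "y \<in> Z" "e * y = y" "m \<ge> 1" "y ^ m = 0"
proof -
  have eZ: "e \<in> Z" "e * e = e" "e \<noteq> 0" using e by (auto simp: primitive_def)
  obtain c w where cw: "w \<noteq> 0" "e \<star> w = w" "z \<star> w = c *s w"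
    by (rule eigenvector_exists[OF Z_commute[OF eZ(1) z(1)] eZ(2,3)])
  define y where "y = z - scal c * e"
  have y: "y \<in> Z" "e * y = y" unfolding y_def
    by (rule Z_diff[OF z(1) Z_mult[OF Z_scal eZ(1)]])
       (simp add: right_diff_distrib z mult.assoc[symmetric] scal_commute, simp add: mult.assoc eZ)
  have "y \<star> w = 0" by (simp add: y_def app_simps cw)
  then obtain m where "m \<ge> 1" "y ^ m = 0" by (rule primitive_nilpotent[OF e y cw(1,2)])
  then show thesis using that[of c y m] y by (simp add: y_def)
qed

text \<open>
  Replaces \<open>dim eZ \<le> n\<close>: only upper bounds on dimensions are needed.
\<close>

definition spanned :: "('k, 'r) endo \<Rightarrow> nat \<Rightarrow> bool" where
  "spanned e n \<longleftrightarrow> (\<exists>b. \<forall>z\<in>Z. \<exists>c. e * z = (\<Sum>i<n. scal (c i) * b i))"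

lemma spanned_add:
  assumes "spanned e1 n1" "spanned e2 n2"
  shows "spanned (e1 + e2) (n1 + n2)"
proof -
  obtain b1 b2 where b: "\<And>z. z \<in> Z \<Longrightarrow> \<exists>c. e1 * z = (\<Sum>i<n1. scal (c i) * b1 i)"
    "\<And>z. z \<in> Z \<Longrightarrow> \<exists>c. e2 * z = (\<Sum>i<n2. scal (c i) * b2 i)"
    using assms unfolding spanned_def by blast
  define b' where "b' i = (if i < n1 then b1 i else b2 (i - n1))" for i
  have "\<exists>c. (e1 + e2) * z = (\<Sum>i<n1 + n2. scal (c i) * b' i)" if z: "z \<in> Z" for z
  proof -
    obtain c1 c2 where c: "e1 * z = (\<Sum>i<n1. scal (c1 i) * b1 i)" "e2 * z = (\<Sum>i<n2. scal (c2 i) * b2 i)"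
      using b[OF z] by blast
    have sp: "(\<Sum>p<n1 + n. h p) = (\<Sum>p<n1. h p) + (\<Sum>p<n. h (n1 + p))" for h :: "nat \<Rightarrow> ('k, 'r) endo" and n
      by (induction n) (simp_all add: add.assoc)
    have "(e1 + e2) * z = (\<Sum>i<n1 + n2. scal (if i < n1 then c1 i else c2 (i - n1)) * b' i)"
      unfolding sp by (simp add: b'_def distrib_right c)
    then show ?thesis by (intro exI[of _ "\<lambda>i. if i < n1 then c1 i else c2 (i - n1)"])
  qed
  then show ?thesis unfolding spanned_def by blast
qed

text \<open>
  The case \<open>x = 0\<close>, \<open>k = 1\<close> covers the idempotents \<open>e\<close> for which \<open>eZ\<close> is a line.
\<close>

lemma deforms_into_power:
  assumes "e \<in> Z" "e * e = e" "x \<in> Z" "k \<ge> 1" "x ^ k * e = 0" "x ^ (k - 1) * e \<noteq> 0"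
  shows "deforms_into d f e k"
proof (rule deforms_into_nilpotent[OF f])
  show "self_adjoint (x ^ l * e) f" for l using Z_mult[OF Z_power[OF assms(3)] assms(1)] by simp
qed (use d assms Z_commute in auto)

text \<open>
  Split idempotents until they are primitive; the ranks decrease.
\<close>

lemma reduction_to_primitive:
  assumes prim: "\<And>e. primitive e \<Longrightarrow> \<exists>n. spanned e n \<and> deforms_into d f e n"
  shows "e \<in> Z \<Longrightarrow> e * e = e \<Longrightarrow> e \<noteq> 0 \<Longrightarrow> \<exists>n. spanned e n \<and> deforms_into d f e n"
proof (induction "rank e" arbitrary: e rule: less_induct)
  case less
  show ?case
  proof (cases "primitive e")
    case True
    then show ?thesis by (rule prim)
  next
    case False
    then obtain p where p: "p \<in> Z" "p * p = p" "e * p = p" "p \<noteq> 0" "p \<noteq> e"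
      using less.prems unfolding primitive_def by blast
    have pe: "p * e = p" using p Z_commute[OF p(1) less.prems(1)] by simp
    define q where "q = e - p"
    have q: "q \<in> Z" "q * q = q" "e * q = q" "q * e = q" "q \<noteq> 0" "p * q = 0" "q * p = 0"
      using Z_diff[OF less.prems(1) p(1)] p pe less.prems by (simp_all add: q_def algebra_simps)
    have "q \<noteq> e" using p by (simp add: q_def)
    have "rank p < rank e" by (rule rank_less) (use p pe in auto)
    then obtain n1 where n1: "spanned p n1" "deforms_into d f p n1" using less.hyps[of p] p by blast
    have "rank q < rank e" by (rule rank_less) (use q \<open>q \<noteq> e\<close> in auto)
    then obtain n2 where n2: "spanned q n2" "deforms_into d f q n2" using less.hyps[of q] q by blast
    have "spanned (p + q) (n1 + n2)" by (rule spanned_add[OF n1(1) n2(1)])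
    moreover have "deforms_into d f (p + q) (n1 + n2)"
      by (rule deforms_into_add) (use d n1 n2 p q in auto)
    moreover have "p + q = e" by (simp add: q_def)
    ultimately show ?thesis by auto
  qed
qed

end

section \<open>Local blocks\<close>

text \<open>
  A nilpotent \<open>x\<close> of index \<open>k\<close> in \<open>eZ\<close> together with a chain of length \<open>k\<close> that
  starts at \<open>e0\<close>, and with the operator \<open>R\<close> of \<open>cyclic_functional\<close>. Below, \<open>P\<close> is the projection to the
  chain and \<open>W\<close> is its complement in \<open>eV\<close>.
\<close>

locale cyclic_block = nondegenerate_form f d
  for f :: "('k::alg_closed_field, 'r::finite) dpower" and d +
  fixes e x R :: "('k, 'r) endo" and k :: nat and e0 :: "'k ^ 'r"
  assumes e: "primitive e" and x: "x \<in> Z" "e * x = x" and k: "k \<ge> 2" "x ^ k = 0"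
    and e0: "e \<star> e0 = e0" "(x ^ (k - 1)) \<star> e0 \<noteq> 0"
    and R: "e * R = R" "R * e = R" "\<And>v. \<exists>c. R \<star> v = c *s e0"
      "\<And>i. R \<star> (x ^ i) \<star> e0 = (if i = k - 1 then e0 else 0)"
begin

definition P :: "('k, 'r) endo" where "P = (\<Sum>j<k. x ^ j * (R * x ^ (k - 1 - j)))"

definition W :: "('k ^ 'r) set" where "W = {w. e \<star> w = w \<and> P \<star> w = 0}"

lemma eZ: "e \<in> Z" "e * e = e" "e \<noteq> 0"
  using e by (auto simp: primitive_def)

lemma e_commute: "z \<in> Z \<Longrightarrow> e * z = z * e"
  by (rule Z_commute[OF eZ(1)])

lemma e_app: "z \<in> Z \<Longrightarrow> e \<star> z \<star> v = z \<star> e \<star> v"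
  using e_commute[of z] by (simp only: app_mult[symmetric])

lemma x_power_e: "e \<star> (x ^ i) \<star> e0 = (x ^ i) \<star> e0"
  using e_app[OF Z_power[OF x(1)]] e0(1) by simp

lemma x_power_zero: "k \<le> i \<Longrightarrow> (x ^ i) \<star> v = 0"
  using power_app_zero[of x k v i] k(2) by simp

lemma P_facts: "P * P = P" "x * P = P * x" "e * P = P" "P * e = P"
proof -
  have k1: "k \<ge> 1" "x ^ k * e = 0" using k by simp_all
  note c = cyclic_jordan_system[OF e_commute[OF x(1), symmetric] k1 order_refl R]
  show "P * P = P" "x * P = P * x" "e * P = P" "P * e = P"
    unfolding P_def by (rule c)+
qed

lemma P_form: "\<exists>c. P \<star> v = (\<Sum>i<k. c i *s (x ^ i) \<star> e0)"
proof -
  have "\<exists>c. \<forall>j. R \<star> (x ^ (k - 1 - j)) \<star> v = c j *s e0"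
    by (rule choice) (use R(3) in blast)
  then obtain c where c: "\<And>j. R \<star> (x ^ (k - 1 - j)) \<star> v = c j *s e0" by blast
  have "P \<star> v = (\<Sum>j<k. c j *s (x ^ j) \<star> e0)"
    unfolding P_def by (simp only: app_sum app_mult c app_vscale)
  then show ?thesis by blast
qed

lemma P_e0: "P \<star> (x ^ i) \<star> e0 = (x ^ i) \<star> e0"
proof -
  have "P \<star> e0 = (\<Sum>j<k. if j = 0 then e0 else 0)"
    unfolding P_def app_sum app_mult
  proof (rule sum.cong[OF refl])
    fix j assume "j \<in> {..<k}"
    then have "k - 1 - j = k - 1 \<longleftrightarrow> j = 0" using k(1) by auto
    then show "(x ^ j) \<star> R \<star> (x ^ (k - 1 - j)) \<star> e0 = (if j = 0 then e0 else 0)"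
      using R(4)[of "k - 1 - j"] by auto
  qed
  then have "P \<star> e0 = e0" using k(1) by simp
  moreover have "P * x ^ i = x ^ i * P" by (rule power_commute_endo[OF P_facts(2), symmetric])
  ultimately show ?thesis by (metis app_mult)
qed

lemma powers_indep: "indep k (\<lambda>i. (x ^ i) \<star> e0)"
  by (rule nilpotent_indep) (use x_power_zero e0 in auto)

lemma decompose:
  assumes "e \<star> v = v"
  obtains c w where "v = (\<Sum>i<k. c i *s (x ^ i) \<star> e0) + w" "w \<in> W"
proof -
  obtain c where c: "P \<star> v = (\<Sum>i<k. c i *s (x ^ i) \<star> e0)" using P_form by blast
  have "e \<star> P \<star> v = P \<star> v" "P \<star> P \<star> v = P \<star> v" using P_facts by (simp_all add: app_mult[symmetric])
  then have "v - P \<star> v \<in> W" by (simp add: W_def app_vdiff assms)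
  moreover have "v = (\<Sum>i<k. c i *s (x ^ i) \<star> e0) + (v - P \<star> v)" by (simp add: c)
  ultimately show thesis using that by blast
qed

lemma W_add: "v \<in> W \<Longrightarrow> w \<in> W \<Longrightarrow> v + w \<in> W"
  by (simp add: W_def app_vadd)

lemma W_scale: "w \<in> W \<Longrightarrow> c *s w \<in> W"
  by (simp add: W_def app_vscale)

lemma W_x: "w \<in> W \<Longrightarrow> x \<star> w \<in> W"
proof -
  assume "w \<in> W"
  moreover have "P \<star> x \<star> w = x \<star> P \<star> w" using P_facts(2) by (simp only: app_mult[symmetric])
  ultimately show "x \<star> w \<in> W" using e_app[OF x(1)] by (simp add: W_def)
qed

lemma W_e: "w \<in> W \<Longrightarrow> e \<star> w = w"
  by (simp add: W_def)

lemma independent_sum: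
  assumes "(\<Sum>i<k. c i *s (x ^ i) \<star> e0) + w = 0" "w \<in> W"
  shows "\<And>i. i < k \<Longrightarrow> c i = 0" "w = 0"
proof -
  have "P \<star> ((\<Sum>i<k. c i *s (x ^ i) \<star> e0) + w) = (\<Sum>i<k. c i *s (x ^ i) \<star> e0)"
    using assms(2) by (simp add: app_vadd app_vsum app_vscale P_e0 W_def)
  then have z: "(\<Sum>i<k. c i *s (x ^ i) \<star> e0) = 0" using assms(1) by simp
  then show "c i = 0" if "i < k" for i using indepD[OF powers_indep, of c i] that by blast
  show "w = 0" using assms(1) z by simp
qed

lemma block_eqI:
  assumes "A * e = A" "B * e = B" "\<And>i. i < k \<Longrightarrow> A \<star> (x ^ i) \<star> e0 = B \<star> (x ^ i) \<star> e0"
    "\<And>w. w \<in> W \<Longrightarrow> A \<star> w = B \<star> w"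
  shows "A = B"
proof (rule endo_eqI)
  fix v
  have "e \<star> e \<star> v = e \<star> v" using eZ by (simp add: app_mult[symmetric])
  then obtain c w where cw: "e \<star> v = (\<Sum>i<k. c i *s (x ^ i) \<star> e0) + w" "w \<in> W" by (rule decompose)
  have "A \<star> v = A \<star> e \<star> v" "B \<star> v = B \<star> e \<star> v" using assms(1,2) by (metis app_mult)+
  then show "A \<star> v = B \<star> v"
    unfolding cw(1) by (simp add: app_vadd app_vsum app_vscale assms(3,4) cw(2))
qed

text \<open>
  For \<open>u\<close> in \<open>eV\<close> the derivative of \<open>f\<close> along \<open>u\<close> does not see vectors outside \<open>eV\<close>.
\<close>

lemma outside: "z \<in> Z \<Longrightarrow> e \<star> u = u \<Longrightarrow> ctr (v - e \<star> v) (ctr u f) = 0"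
proof -
  assume u: "e \<star> u = u"
  have "ctr (v - e \<star> v) (ctr u f) = ctr (e \<star> (v - e \<star> v)) (ctr u f)"
    using Z_sym[OF eZ(1), of "v - e \<star> v" u] u by simp
  also have "e \<star> (v - e \<star> v) = 0" using eZ(2) by (simp add: app_vdiff app_mult[symmetric])
  finally show ?thesis by simp
qed

lemma block_vector_zero:
  assumes u: "e \<star> u = u" and p: "\<And>i. i < k \<Longrightarrow> ctr ((x ^ i) \<star> e0) (ctr u f) = 0"
    and w: "\<And>w. w \<in> W \<Longrightarrow> ctr w (ctr u f) = 0"
  shows "u = 0"
proof (rule ctr2_eq_0D)
  fix v
  have "e \<star> e \<star> v = e \<star> v" using eZ by (simp add: app_mult[symmetric])
  then obtain c w' where cw: "e \<star> v = (\<Sum>i<k. c i *s (x ^ i) \<star> e0) + w'" "w' \<in> W" by (rule decompose)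
  have "ctr (e \<star> v) (ctr u f) = 0"
    unfolding cw(1) by (simp add: ctr_vadd ctr_vsum ctr_vscale p w[OF cw(2)])
  then show "ctr v (ctr u f) = 0"
    using outside[OF eZ(1) u, of v] by (simp add: ctr_vdiff)
qed

text \<open>
  Subtracting a polynomial in \<open>x\<close> from an element of \<open>eZ\<close>, its value on \<open>e0\<close> is moved into \<open>W\<close>. If only
  \<open>0\<close> is left, then \<open>eZ\<close> is generated by \<open>x\<close>, and the deformation along \<open>x\<close> has enough pieces.
\<close>

lemma spanned_by_powers:
  assumes "\<And>y. y \<in> Z \<Longrightarrow> e * y = y \<Longrightarrow> y \<star> e0 \<in> W \<Longrightarrow> y = 0"
  shows "\<exists>n. spanned e n \<and> deforms_into d f e n"
proof (intro exI conjI)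
  have "\<exists>c. e * z = (\<Sum>i<k. scal (c i) * (x ^ i * e))" if z: "z \<in> Z" for z
  proof -
    have ez: "e * z \<in> Z" "e * (e * z) = e * z" using Z_mult[OF eZ(1) z] eZ by (simp_all add: mult.assoc[symmetric])
    have "e \<star> (e * z) \<star> e0 = (e * z) \<star> e0" using ez(2) by (simp only: app_mult[symmetric])
    then obtain c w where cw: "(e * z) \<star> e0 = (\<Sum>i<k. c i *s (x ^ i) \<star> e0) + w" "w \<in> W" by (rule decompose)
    define y where "y = e * z - (\<Sum>i<k. scal (c i) * (x ^ i * e))"
    have xe: "x ^ i * e \<in> Z" "e * (x ^ i * e) = x ^ i * e" for i
      using Z_mult[OF Z_power[OF x(1)] eZ(1)] e_commute[OF Z_power[OF x(1)], of i] eZ(2)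
      by (simp_all add: mult.assoc[symmetric]) (simp add: mult.assoc)
    have "y \<in> Z" unfolding y_def by (intro Z_diff ez Z_sum Z_mult Z_scal xe)
    moreover have "e * y = y"
      unfolding y_def right_diff_distrib ez(2) sum_distrib_left
      by (simp add: mult.assoc[symmetric] scal_commute[of e]) (simp add: mult.assoc xe)
    moreover have "y \<star> e0 = w"
      unfolding y_def by (simp add: app_diff cw(1) app_sum) (simp add: app_mult app_scal e0)
    ultimately have "y = 0" using assms cw(2) by blast
    then show ?thesis by (auto simp: y_def)
  qed
  then show "spanned e k" unfolding spanned_def by (intro exI[of _ "\<lambda>i. x ^ i * e"]) blast
  have "(x ^ (k - 1) * e) \<star> e0 \<noteq> 0" using e0 by (simp add: app_mult)
  then have "x ^ (k - 1) * e \<noteq> 0" by auto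
  then show "deforms_into d f e k"
    by (intro deforms_into_power[OF eZ(1,2) x(1)]) (use k in auto)
qed

text \<open>
  Assume that \<open>x\<close> kills \<open>W\<close>. If \<open>y\<close> kills the chain, \<open>y w\<close> is orthogonal to
  the chain; being a multiple of the end of the chain it is also orthogonal to \<open>W\<close>, hence zero.
\<close>

lemma socle_zero:
  assumes xW: "\<And>w. w \<in> W \<Longrightarrow> x \<star> w = 0" and y: "y \<in> Z" "e * y = y" "y \<star> e0 = 0"
    and yW: "\<And>w. w \<in> W \<Longrightarrow> \<exists>\<mu>. y \<star> w = \<mu> *s (x ^ (k - 1)) \<star> e0"
  shows "y = 0"
proof (rule block_eqI)
  show "y * e = y" using e_commute[OF y(1)] y(2) by simp
  show "0 * e = 0" by simp
  have yx: "y \<star> (x ^ i) \<star> e0 = 0" for i using app_commute[OF y(1) Z_power[OF x(1)]] y(3) by simp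
  then show "y \<star> (x ^ i) \<star> e0 = 0 \<star> (x ^ i) \<star> e0" for i by simp
  fix w assume w: "w \<in> W"
  have "y \<star> w = 0"
  proof (rule block_vector_zero)
    show "e \<star> y \<star> w = y \<star> w" using y(2) by (simp only: app_mult[symmetric])
    show "ctr ((x ^ i) \<star> e0) (ctr (y \<star> w) f) = 0" for i
      using Z_sym[OF y(1), of "(x ^ i) \<star> e0" w] yx by simp
    fix w' assume w': "w' \<in> W"
    obtain \<mu> where \<mu>: "y \<star> w = \<mu> *s (x ^ (k - 1)) \<star> e0" using yW[OF w] by blast
    have "(x ^ (k - 1)) \<star> w' = 0" using power_app_zero[of x 1 w' "k - 1"] xW[OF w'] k(1) by simp
    then have "ctr w' (ctr ((x ^ (k - 1)) \<star> e0) f) = 0"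
      using Z_sym[OF Z_power[OF x(1)], of "k - 1" w' e0] by simp
    then show "ctr w' (ctr (y \<star> w) f) = 0" by (simp add: \<mu> ctr_vscale ctr_fscale)
  qed
  then show "y \<star> w = 0 \<star> w" by simp
qed

text \<open>
  Both the end \<open>u\<close> of the chain and \<open>y e0\<close> would be vectors along which the derivative of \<open>f\<close> depends on
  the coordinate of \<open>e0\<close> only: moving \<open>x\<^sup>k\<^sup>-\<^sup>1\<close>, respectively \<open>y\<close>, to the other argument kills the rest of the
  chain and \<open>W\<close>. But such vectors are dependent by \<open>one_direction_dependent\<close>.
\<close>

lemma no_second_direction:
  assumes xW: "\<And>w. w \<in> W \<Longrightarrow> x \<star> w = 0" and y: "y \<in> Z" "y \<star> e0 \<in> W" "y \<star> e0 \<noteq> 0"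
    and yW: "\<And>w. w \<in> W \<Longrightarrow> y \<star> w = 0"
  shows False
proof -
  define u where "u = (x ^ (k - 1)) \<star> e0"
  define w0 where "w0 = y \<star> e0"
  have eu: "e \<star> u = u" "e \<star> w0 = w0" using x_power_e y(2) W_e by (simp_all add: u_def w0_def)
  \<comment> \<open>The directions invisible to both derivatives; together with \<open>e0\<close> they span \<open>V\<close>.\<close>
  define H where "H = {h. ctr h (ctr u f) = 0 \<and> ctr h (ctr w0 f) = 0}"
  have H_add: "g + h \<in> H" if "g \<in> H" "h \<in> H" for g h using that by (simp add: H_def ctr_vadd)
  have H_scale: "c *s h \<in> H" if "h \<in> H" for c h using that by (simp add: H_def ctr_vscale)
  have H_sum: "(\<Sum>i\<in>I. h i) \<in> H" if "\<And>i. i \<in> I \<Longrightarrow> h i \<in> H" for I :: "nat set" and h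
    using that
  proof (induction I rule: infinite_finite_induct)
    case (insert i I)
    then have "h i + sum h I \<in> H" by (intro H_add) auto
    then show ?case using insert by simp
  qed (simp_all add: H_def)
  have Hx: "(x ^ i) \<star> e0 \<in> H" if "i \<ge> 1" for i
  proof -
    have "ctr ((x ^ i) \<star> e0) (ctr u f) = ctr e0 (ctr ((x ^ (i + (k - 1))) \<star> e0) f)"
      using Z_sym[OF Z_power[OF x(1)], of i e0 u] by (simp add: u_def power_app_add)
    then have 1: "ctr ((x ^ i) \<star> e0) (ctr u f) = 0" using x_power_zero[of "i + (k - 1)" e0] that by simp
    have "(x ^ i) \<star> w0 = 0" using power_app_zero[of x 1 w0 i] xW y(2) that by (simp add: w0_def)
    then have "ctr ((x ^ i) \<star> e0) (ctr w0 f) = 0" using Z_sym[OF Z_power[OF x(1)], of i e0 w0] by simp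
    with 1 show ?thesis by (simp add: H_def)
  qed
  have HW: "w \<in> H" if w: "w \<in> W" for w
  proof -
    have "(x ^ (k - 1)) \<star> w = 0" using power_app_zero[of x 1 w "k - 1"] xW[OF w] k(1) by simp
    then have "ctr w (ctr u f) = 0" using Z_sym[OF Z_power[OF x(1)], of "k - 1" w e0] by (simp add: u_def)
    moreover have "ctr w (ctr w0 f) = 0" using Z_sym[OF y(1), of w e0] yW[OF w] by (simp add: w0_def)
    ultimately show ?thesis by (simp add: H_def)
  qed
  have "\<exists>c h. v = c *s e0 + h \<and> h \<in> H" for v
  proof -
    have "e \<star> e \<star> v = e \<star> v" using eZ by (simp add: app_mult[symmetric])
    then obtain c w where cw: "e \<star> v = (\<Sum>i<k. c i *s (x ^ i) \<star> e0) + w" "w \<in> W" by (rule decompose)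
    obtain k' where k': "k = Suc k'" using k(1) by (cases k) auto
    have "(\<Sum>i<k. c i *s (x ^ i) \<star> e0) = c 0 *s e0 + (\<Sum>i<k'. c (Suc i) *s (x ^ Suc i) \<star> e0)"
      unfolding k' by (subst sum.lessThan_Suc_shift) simp
    then have v: "v = c 0 *s e0 + ((\<Sum>i<k'. c (Suc i) *s (x ^ Suc i) \<star> e0) + w + (v - e \<star> v))"
      using cw(1) by (simp add: algebra_simps)
    have "v - e \<star> v \<in> H" using outside[OF eZ(1)] eu by (simp add: H_def)
    moreover have "(\<Sum>i<k'. c (Suc i) *s (x ^ Suc i) \<star> e0) \<in> H"
      by (intro H_sum H_scale Hx) simp
    ultimately have "(\<Sum>i<k'. c (Suc i) *s (x ^ Suc i) \<star> e0) + w + (v - e \<star> v) \<in> H"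
      using HW[OF cw(2)] H_add by blast
    with v show ?thesis by blast
  qed
  then obtain a b where ab: "a *s u + b *s w0 = 0" "a \<noteq> 0 \<or> b \<noteq> 0"
    by (rule one_direction_dependent[of e0 H u w0]) (auto simp: H_def)
  have "P \<star> (a *s u + b *s w0) = a *s u"
    using y(2) by (simp add: app_vadd app_vscale u_def P_e0 w0_def W_def)
  then have "a *s u = 0" using ab(1) by simp
  moreover have "u \<noteq> 0" using e0(2) by (simp add: u_def)
  ultimately have "a = 0" by simp
  then show False using ab y(3) by (simp add: w0_def)
qed

lemma nilpotent_if_kills:
  assumes "y \<in> Z" "e * y = y" "y \<star> w = 0" "e \<star> w = w" "w \<noteq> 0"
  obtains m where "m \<ge> 1" "y ^ m = 0"
  using primitive_nilpotent[OF e assms(1,2,5,4,3)] by blast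

end

text \<open>
  Square zero and rank at least two: the exceptional case, in which no single nilpotent need
  generate the block.
\<close>

definition (in nondegenerate_form) special :: "('k, 'r) endo \<Rightarrow> ('k, 'r) endo \<Rightarrow> bool" where
  "special e \<epsilon> \<longleftrightarrow> \<epsilon> \<in> Z \<and> e * \<epsilon> = \<epsilon> \<and> \<epsilon> * \<epsilon> = 0 \<and>
     (\<exists>u1 u2. \<forall>a b. a *s (\<epsilon> \<star> u1) + b *s (\<epsilon> \<star> u2) = 0 \<longrightarrow> a = 0 \<and> b = 0)"

context cyclic_block
begin

text \<open>
  All nilpotents have square zero and, no \<open>\<epsilon>\<close> being special, rank at most one. Applied to \<open>x\<close> this
  gives \<open>x W = 0\<close>. An element \<open>y\<close> with \<open>y e0 \<in> W\<close> is compared with \<open>x + y\<close>: since both have rank at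
  most one, \<open>y\<close> maps \<open>W\<close> to the end of the chain if \<open>y e0 = 0\<close>, and to zero otherwise.
\<close>

lemma index_two:
  assumes k2: "k = 2"
    and max: "\<And>y m. y \<in> Z \<Longrightarrow> e * y = y \<Longrightarrow> y ^ m = 0 \<Longrightarrow> y * y = 0"
    and ns: "\<And>\<epsilon>. \<not> special e \<epsilon>"
  shows "\<exists>n. spanned e n \<and> deforms_into d f e n"
proof -
  have dep: "\<exists>a b. a *s (y \<star> u1) + b *s (y \<star> u2) = 0 \<and> (a \<noteq> 0 \<or> b \<noteq> 0)"
    if "y \<in> Z" "e * y = y" "y ^ m = 0" for y m u1 u2
    using ns[of y] that max[OF that] unfolding special_def by blast
  have xe0: "x \<star> e0 \<noteq> 0" "P \<star> x \<star> e0 = x \<star> e0" using e0(2) P_e0[of 1] k2 by simp_all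
  have xW: "x \<star> w = 0" if w: "w \<in> W" for w
  proof -
    obtain a b where ab: "a *s (x \<star> e0) + b *s (x \<star> w) = 0" "a \<noteq> 0 \<or> b \<noteq> 0"
      using dep[OF x k(2)] by blast
    have "P \<star> (a *s (x \<star> e0) + b *s (x \<star> w)) = a *s (x \<star> e0)"
      using W_x[OF w] by (simp add: app_vadd app_vscale xe0 W_def)
    then have "a = 0" using ab(1) xe0 by simp
    then show ?thesis using ab by simp
  qed
  show ?thesis
  proof (rule spanned_by_powers)
    fix y assume y: "y \<in> Z" "e * y = y" "y \<star> e0 \<in> W"
    have yx: "y \<star> x \<star> e0 = 0" using app_commute[OF y(1) x(1)] xW[OF y(3)] by simp
    have ex: "e \<star> x \<star> e0 = x \<star> e0" using x_power_e[of 1] by simp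
    obtain m where m: "y ^ m = 0" using nilpotent_if_kills[OF y(1,2) yx ex xe0(1)] by blast
    have xy: "x + y \<in> Z" "e * (x + y) = x + y" using Z_add x y by (auto simp: distrib_left)
    have "(x + y) \<star> x \<star> e0 = 0" using x_power_zero[of 2 e0] k2 yx by (simp add: app_add power2_eq_square app_mult)
    then obtain m' where m': "(x + y) ^ m' = 0" using nilpotent_if_kills[OF xy _ ex xe0(1)] by blast
    show "y = 0"
    proof (cases "y \<star> e0 = 0")
      case True
      have "\<exists>\<mu>. y \<star> w = \<mu> *s (x ^ (k - 1)) \<star> e0" if w: "w \<in> W" for w
      proof -
        obtain a b where ab: "a *s ((x + y) \<star> e0) + b *s ((x + y) \<star> w) = 0" "a \<noteq> 0 \<or> b \<noteq> 0"
          using dep[OF xy m'] by blast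
        then have ab': "a *s (x \<star> e0) + b *s (y \<star> w) = 0" by (simp add: app_add True xW[OF w])
        then have "b \<noteq> 0" using ab(2) xe0 by auto
        then have "y \<star> w = (- a / b) *s (x \<star> e0)"
          using ab' by (simp add: vec_eq_iff eq_divide_eq field_simps eq_neg_iff_add_eq_0)
        then show ?thesis using k2 by (intro exI[of _ "- a / b"]) simp
      qed
      then show ?thesis using socle_zero[OF xW y(1,2) True] by blast
    next
      case False
      have "y \<star> w = 0" if w: "w \<in> W" for w
      proof -
        obtain a b where ab: "a *s (y \<star> e0) + b *s (y \<star> w) = 0" "a \<noteq> 0 \<or> b \<noteq> 0"
          using dep[OF y(1,2) m] by blast
        then have b: "b \<noteq> 0" using False by auto
        have yw: "y \<star> w = (- a / b) *s (y \<star> e0)"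
          using ab(1) b by (simp add: vec_eq_iff eq_divide_eq field_simps eq_neg_iff_add_eq_0)
        have ywW: "y \<star> w \<in> W" unfolding yw by (rule W_scale[OF y(3)])
        obtain a' b' where ab': "a' *s ((x + y) \<star> e0) + b' *s ((x + y) \<star> w) = 0" "a' \<noteq> 0 \<or> b' \<noteq> 0"
          using dep[OF xy m'] by blast
        then have eq: "a' *s (x \<star> e0) + (a' *s (y \<star> e0) + b' *s (y \<star> w)) = 0"
          by (simp add: app_add xW[OF w] vec.scale_right_distrib add.assoc)
        have "P \<star> (a' *s (x \<star> e0) + (a' *s (y \<star> e0) + b' *s (y \<star> w))) = a' *s (x \<star> e0)"
          using y(3) ywW by (simp add: app_vadd app_vscale xe0 W_def)
        then have "a' = 0" using eq xe0 by simp
        then show ?thesis using eq ab'(2) by simp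
      qed
      then show ?thesis using no_second_direction[OF xW y(1,3) False] by blast
    qed
  qed
qed

lemma dimension_bound:
  assumes "w \<in> W" "w \<noteq> 0"
  shows "Suc k \<le> CARD('r)"
proof -
  define b where "b i = (if i < k then (x ^ i) \<star> e0 else w)" for i
  have "indep (Suc k) b" unfolding indep_def
  proof (intro allI impI)
    fix c i assume s: "(\<Sum>i<Suc k. c i *s b i) = 0" and i: "i < Suc k"
    have "(\<Sum>i<Suc k. c i *s b i) = (\<Sum>i<k. c i *s (x ^ i) \<star> e0) + c k *s w"
      by (simp add: b_def)
    note ind = independent_sum[OF this[unfolded s, symmetric] W_scale[OF assms(1)]]
    then show "c i = 0" using i assms(2) by (cases "i < k") (auto simp: less_Suc_eq)
  qed
  then show ?thesis by (rule indep_le_card)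
qed

text \<open>
  The chain occupies \<open>k\<close> dimensions, so that at most one is left for \<open>W\<close>.
\<close>

lemma one_dimensional:
  assumes "CARD('r) \<le> Suc k" "w \<in> W" "w \<noteq> 0" "w' \<in> W"
  obtains c where "w' = c *s w"
proof -
  define b where "b i = (if i < k then (x ^ i) \<star> e0 else if i = k then w else w')" for i
  have "\<not> indep (Suc (Suc k)) b" using indep_le_card[of "Suc (Suc k)" b] assms(1) by auto
  then obtain c j where c: "(\<Sum>i<Suc (Suc k). c i *s b i) = 0" "j < Suc (Suc k)" "c j \<noteq> 0"
    unfolding indep_def by blast
  have "(\<Sum>i<Suc (Suc k). c i *s b i) = (\<Sum>i<k. c i *s (x ^ i) \<star> e0) + (c k *s w + c (Suc k) *s w')"
    by (simp add: b_def add.assoc)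
  note ind = independent_sum[OF this[unfolded c(1), symmetric] W_add[OF W_scale[OF assms(2)] W_scale[OF assms(4)]]]
  have "c (Suc k) \<noteq> 0"
  proof
    assume z: "c (Suc k) = 0"
    then have "c k = 0" using ind(2) assms(3) by simp
    then have "c j = 0" using z ind(1)[of j] c(2) by (auto simp: less_Suc_eq)
    with c(3) show False by simp
  qed
  then have "w' = (- c k / c (Suc k)) *s w"
    using ind(2) by (simp add: vec_eq_iff eq_divide_eq field_simps eq_neg_iff_add_eq_0)
  then show thesis by (rule that)
qed

text \<open>
  Now \<open>W\<close> is at most a line, and it is killed by \<open>x\<close>. For \<open>y\<close> with \<open>w\<^sub>0 = y e0 \<in> W\<close> nonzero, \<open>y w\<^sub>0 = \<mu> x\<^sup>2 e0\<close>. If \<open>\<mu> = 0\<close>,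
  \<open>no_second_direction\<close> applies. Otherwise \<open>\<epsilon> = x + \<kappa> y\<close> with \<open>1 + \<kappa>\<^sup>2\<mu> = 0\<close> has square zero and rank two, so it is special.
\<close>

lemma index_three:
  assumes k3: "k = 3" and card: "CARD('r) \<le> 4" and ns: "\<And>\<epsilon>. \<not> special e \<epsilon>"
  shows "\<exists>n. spanned e n \<and> deforms_into d f e n"
proof -
  let ?x2 = "(x ^ 2) \<star> e0"
  have card': "CARD('r) \<le> Suc k" using card k3 by simp
  have x2: "?x2 \<noteq> 0" "e \<star> ?x2 = ?x2" using e0(2) x_power_e[of 2] k3 by simp_all
  have x3: "(x ^ 3) \<star> v = 0" for v using x_power_zero[of 3 v] k3 by simp
  have eigen0: "c = 0" if "z ^ m = 0" "z \<star> v = c *s v" "v \<noteq> 0"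
    for z :: "('k, 'r) endo" and m and c :: 'k and v
  proof -
    have "(z ^ n) \<star> v = (c ^ n) *s v" for n
      by (induction n) (simp_all add: app_mult app_vscale that(2) vector_smult_assoc mult.commute)
    from this[of m] have "c ^ m *s v = 0" by (simp add: that(1))
    then show "c = 0" using that(3) by (simp add: vec.scale_eq_0_iff)
  qed
  have xW: "x \<star> w = 0" if w: "w \<in> W" for w
  proof (cases "w = 0")
    case False
    obtain c where c: "x \<star> w = c *s w" using one_dimensional[OF card' w False W_x[OF w]] by blast
    then have "c = 0" using eigen0[OF k(2) c False] by simp
    then show ?thesis using c by simp
  qed simp
  show ?thesis
  proof (rule spanned_by_powers)
    fix y assume y: "y \<in> Z" "e * y = y" "y \<star> e0 \<in> W"
    have yx: "y \<star> (x ^ i) \<star> e0 = 0" if "i \<ge> 1" for i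
      using app_commute[OF y(1) Z_power[OF x(1)]] power_app_zero[of x 1 "y \<star> e0" i] xW[OF y(3)] that by simp
    obtain m where m: "y ^ m = 0" using nilpotent_if_kills[OF y(1,2) yx[of 2] x2(2,1)] by auto
    \<comment> \<open>As \<open>x\<close> kills \<open>y w\<close>, only the end of the chain and \<open>W\<close> can contribute to \<open>y w\<close>.\<close>
    have yW: "\<exists>\<mu>. y \<star> w = \<mu> *s ?x2" if w: "w \<in> W" for w
    proof -
      have "e \<star> y \<star> w = y \<star> w" using y(2) by (simp only: app_mult[symmetric])
      then obtain c w' where cw: "y \<star> w = (\<Sum>i<k. c i *s (x ^ i) \<star> e0) + w'" "w' \<in> W" by (rule decompose)
      have yw: "y \<star> w = c 0 *s e0 + c 1 *s (x \<star> e0) + c 2 *s ?x2 + w'"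
        using cw(1) by (simp add: k3 eval_nat_numeral app_mult)
      have "x \<star> y \<star> w = 0" using app_commute[OF x(1) y(1)] xW[OF w] by simp
      moreover have "x \<star> y \<star> w = c 0 *s (x \<star> e0) + c 1 *s ?x2"
        unfolding yw using xW[OF cw(2)] x3[of e0]
        by (simp add: app_vadd app_vscale eval_nat_numeral app_mult)
      ultimately have s: "(\<Sum>i<k. (if i = 1 then c 0 else if i = 2 then c 1 else 0) *s (x ^ i) \<star> e0) + 0 = 0"
        by (simp add: k3 eval_nat_numeral app_mult)
      have W0: "0 \<in> W" by (simp add: W_def)
      have c01: "c 0 = 0" "c 1 = 0"
        using independent_sum(1)[OF s W0, of 1] independent_sum(1)[OF s W0, of 2] k3 by simp_all
      show ?thesis
      proof (cases "w = 0")
        case True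
        then show ?thesis by (intro exI[of _ 0]) simp
      next
        case False
        obtain a where a: "w' = a *s w" using one_dimensional[OF card' w False cw(2)] by blast
        have yw': "y \<star> w = c 2 *s ?x2 + a *s w" using yw c01 a by simp
        then have "y \<star> y \<star> w = a *s (y \<star> w)" using yx[of 2] by (simp add: app_vadd app_vscale)
        then have "y \<star> w = 0 \<or> a = 0" using eigen0[OF m, of "y \<star> w" a] by blast
        then show ?thesis
        proof
          assume "y \<star> w = 0" then show ?thesis by (intro exI[of _ 0]) simp
        next
          assume "a = 0" then show ?thesis using yw' by auto
        qed
      qed
    qed
    show "y = 0"
    proof (cases "y \<star> e0 = 0")
      case True
      then show ?thesis using socle_zero[OF xW y(1,2) True] yW k3 by auto
    next
      case False
      define w0 where "w0 = y \<star> e0"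
      have w0: "w0 \<in> W" "w0 \<noteq> 0" using y(3) False by (simp_all add: w0_def)
      obtain \<mu> where \<mu>: "y \<star> w0 = \<mu> *s ?x2" using yW[OF w0(1)] by blast
      show ?thesis
      proof (cases "\<mu> = 0")
        case True
        have "y \<star> w = 0" if "w \<in> W" for w
          using one_dimensional[OF card' w0 that] \<mu> True by (metis app_vscale vec.scale_zero_left vec.scale_zero_right)
        then show ?thesis using no_second_direction[OF xW y(1,3) False] by blast
      next
        case False
        obtain \<kappa> where \<kappa>: "\<kappa> ^ 2 = - 1 / \<mu>" using nth_root_exists[of 2 "- 1 / \<mu>"] by auto
        define \<epsilon> where "\<epsilon> = x + scal \<kappa> * y"
        have \<epsilon>: "\<epsilon> \<in> Z" "e * \<epsilon> = \<epsilon>"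
          unfolding \<epsilon>_def using Z_add[OF x(1) Z_mult[OF Z_scal y(1)]] x(2) y(2)
          by (simp_all add: distrib_left mult.assoc[symmetric] scal_commute[of e]) (simp add: mult.assoc)
        have \<epsilon>a: "\<epsilon> \<star> v = x \<star> v + \<kappa> *s (y \<star> v)" for v by (simp add: \<epsilon>_def app_simps)
        have \<epsilon>x: "\<epsilon> \<star> (x ^ i) \<star> e0 = (x ^ Suc i) \<star> e0" if "i \<ge> 1" for i
          using yx[OF that] by (simp add: \<epsilon>a app_mult)
        have \<epsilon>0: "\<epsilon> \<star> e0 = x \<star> e0 + \<kappa> *s w0" by (simp add: \<epsilon>a w0_def)
        have \<epsilon>w0: "\<epsilon> \<star> w0 = (\<kappa> * \<mu>) *s ?x2" using xW[OF w0(1)] \<mu> by (simp add: \<epsilon>a)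
        have \<epsilon>\<epsilon>0: "\<epsilon> \<star> \<epsilon> \<star> e0 = 0"
        proof -
          have "\<epsilon> \<star> \<epsilon> \<star> e0 = ?x2 + (\<kappa> ^ 2 * \<mu>) *s ?x2"
            using \<epsilon>x[of 1] by (simp add: \<epsilon>0 app_vadd app_vscale \<epsilon>w0 eval_nat_numeral mult.assoc)
          then show ?thesis using \<kappa> False by (simp add: vec.scale_left_distrib[symmetric])
        qed
        have "\<epsilon> * \<epsilon> = 0"
        proof (rule block_eqI)
          show "\<epsilon> * \<epsilon> * e = \<epsilon> * \<epsilon>" using e_commute[OF \<epsilon>(1)] \<epsilon>(2) by (simp add: mult.assoc)
          show "(\<epsilon> * \<epsilon>) \<star> (x ^ i) \<star> e0 = 0 \<star> (x ^ i) \<star> e0" if "i < k" for i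
          proof (cases "i = 0")
            case True then show ?thesis using \<epsilon>\<epsilon>0 by (simp add: app_mult)
          next
            case False
            then show ?thesis using \<epsilon>x[of i] \<epsilon>x[of "Suc i"] x_power_zero[of "Suc (Suc i)" e0] k3
              by (simp add: app_mult[of \<epsilon> \<epsilon>] del: power_Suc)
          qed
          show "(\<epsilon> * \<epsilon>) \<star> w = 0 \<star> w" if wW: "w \<in> W" for w
          proof -
            obtain c where "w = c *s w0" using one_dimensional[OF card' w0 wW] by blast
            then show ?thesis using \<epsilon>w0 \<epsilon>x[of 2] x3[of e0] by (simp add: app_mult[of \<epsilon> \<epsilon>] app_vscale numeral_3_eq_3[symmetric] del: power_Suc)
          qed
        qed simp
        moreover have "a = 0 \<and> b = 0" if ab: "a *s (\<epsilon> \<star> e0) + b *s (\<epsilon> \<star> x \<star> e0) = 0" for a b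
        proof -
          have "(\<Sum>i<k. (if i = 1 then a else if i = 2 then b else 0) *s (x ^ i) \<star> e0) + (a * \<kappa>) *s w0 = 0"
            using ab \<epsilon>x[of 1] by (simp add: \<epsilon>0 k3 eval_nat_numeral app_mult vec.scale_right_distrib add_ac)
          note ind = independent_sum(1)[OF this W_scale[OF w0(1)]]
          show ?thesis using ind[of 1] ind[of 2] k3 by simp
        qed
        ultimately have "special e \<epsilon>" unfolding special_def using \<epsilon> by blast
        with ns show ?thesis by blast
      qed
    qed
  qed
qed

lemma index_large:
  assumes "CARD('r) \<le> k"
  shows "\<exists>n. spanned e n \<and> deforms_into d f e n"
proof (rule spanned_by_powers)
  fix y assume y: "y \<in> Z" "e * y = y" "y \<star> e0 \<in> W"
  have W0: "w = 0" if "w \<in> W" for w using dimension_bound[OF that] assms by fastforce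
  show "y = 0"
  proof (rule block_eqI)
    show "y * e = y" using e_commute[OF y(1)] y(2) by simp
    show "y \<star> (x ^ i) \<star> e0 = 0 \<star> (x ^ i) \<star> e0" for i
      using app_commute[OF y(1) Z_power[OF x(1)]] W0[OF y(3)] by simp
    show "y \<star> w = 0 \<star> w" if "w \<in> W" for w using W0[OF that] by simp
  qed simp
qed

end

context nondegenerate_form
begin

lemma power_zero_mono:
  assumes "(y :: ('k, 'r) endo) ^ m = 0" "m \<le> n" shows "y ^ n = 0"
proof -
  have "y ^ (m + (n - m)) = 0" unfolding power_add assms(1) by simp
  then show ?thesis using assms(2) by simp
qed

lemma nilpotent_index:
  assumes "(x :: ('k, 'r) endo) ^ m = 0" "x \<noteq> 0"
  obtains k where "k \<ge> 2" "x ^ k = 0" "x ^ (k - 1) \<noteq> 0" "k \<le> CARD('r)"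
proof -
  define k where "k = (LEAST k. x ^ k = 0)"
  have k: "x ^ k = 0" unfolding k_def by (rule LeastI) (rule assms(1))
  have k1: "k \<noteq> 0" using k by (cases k) auto
  have "k \<noteq> 1" using k assms(2) by auto
  then have k2: "k \<ge> 2" using k1 by linarith
  have k': "x ^ (k - 1) \<noteq> 0" using not_less_Least[of "k - 1" "\<lambda>k. x ^ k = 0"] k2 unfolding k_def by linarith
  then obtain v where "(x ^ (k - 1)) \<star> v \<noteq> 0" by (rule nonzero_app)
  then have "indep k (\<lambda>i. (x ^ i) \<star> v)" by (intro nilpotent_indep) (simp_all add: k)
  then have "k \<le> CARD('r)" by (rule indep_le_card)
  with that k k2 k' show thesis by blast
qed

text \<open>
  Choose \<open>x\<close> nilpotent in \<open>eZ\<close> of the largest index \<open>k\<close>. If there is none except \<open>0\<close>, then \<open>eZ\<close> is a line. By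
  \<open>r \<le> 4\<close> the index is \<open>2\<close>, \<open>3\<close>, or \<open>k \<ge> r\<close>, in which case the complement \<open>W\<close> of the chain is zero. In
  the exceptional case, which is left to the assumption \<open>special\<close>, all cubes of nilpotents vanish.
\<close>

theorem primitive_case:
  assumes card: "CARD('r) \<le> 4" and e: "primitive e"
    and special: "\<And>\<epsilon>. special e \<epsilon> \<Longrightarrow> (\<And>y m. y \<in> Z \<Longrightarrow> e * y = y \<Longrightarrow> y ^ m = 0 \<Longrightarrow> y ^ 3 = 0) \<Longrightarrow>
      \<exists>n. spanned e n \<and> deforms_into d f e n"
  shows "\<exists>n. spanned e n \<and> deforms_into d f e n"
proof -
  have eZ: "e \<in> Z" "e * e = e" "e \<noteq> 0" using e by (auto simp: primitive_def)
  define S where "S k \<longleftrightarrow> (\<exists>x\<in>Z. e * x = x \<and> k \<ge> 2 \<and> x ^ k = 0 \<and> x ^ (k - 1) \<noteq> 0)" for k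
  show ?thesis
  proof (cases "\<exists>k. S k \<and> k \<le> CARD('r)")
    case False
    have nil0: "y = 0" if nil: "y \<in> Z" "e * y = y" "y ^ m = 0" for y m
    proof (rule ccontr)
      assume "y \<noteq> 0"
      obtain k where "k \<ge> 2" "y ^ k = 0" "y ^ (k - 1) \<noteq> 0" "k \<le> CARD('r)"
        by (rule nilpotent_index[OF nil(3) \<open>y \<noteq> 0\<close>])
      then show False using False nil unfolding S_def by blast
    qed
    have "\<exists>c. e * z = (\<Sum>i<(1::nat). scal (c i) * e)" if z: "z \<in> Z" for z
    proof -
      have "e * z \<in> Z" "e * (e * z) = e * z" using Z_mult[OF eZ(1) z] eZ by (simp_all add: mult.assoc[symmetric])
      then obtain c y m where "e * z = scal c * e + y" "y \<in> Z" "e * y = y" "y ^ m = 0"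
        by (rule primitive_decompose[OF e])
      then have "e * z = scal c * e" using nil0 by auto
      moreover have "(\<Sum>i<(1::nat). scal c * e) = scal c * e"
        using sum.lessThan_Suc[of "\<lambda>_. scal c * e" 0] by (simp only: One_nat_def lessThan_0 sum.empty add_0_left)
      ultimately show ?thesis by (intro exI[of _ "\<lambda>_. c"]) simp
    qed
    then have "spanned e 1" unfolding spanned_def by (intro exI[of _ "\<lambda>_. e"]) blast
    moreover have "deforms_into d f e 1"
      by (rule deforms_into_power[OF eZ(1,2) Z_zero]) (use eZ in auto)
    ultimately show ?thesis by blast
  next
    case True
    then obtain k1 where k1: "S k1 \<and> k1 \<le> CARD('r)" by (elim exE)
    have "\<exists>k. (S k \<and> k \<le> CARD('r)) \<and> (\<forall>k'. S k' \<and> k' \<le> CARD('r) \<longrightarrow> k' \<le> k)"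
      using k1 by (rule ex_has_greatest_nat[where b = "Suc CARD('r)" and f = "\<lambda>k. k" and k = k1 and P = "\<lambda>k. S k \<and> k \<le> CARD('r)"]) simp
    then obtain k where k: "S k" "k \<le> CARD('r)" and max': "\<forall>k'. S k' \<and> k' \<le> CARD('r) \<longrightarrow> k' \<le> k"
      by (elim exE conjE)
    have max: "k' \<le> k" if "S k'" "k' \<le> CARD('r)" for k'
      using max'[rule_format, of k'] that by simp
    obtain x where xf: "x \<in> Z" "e * x = x" "k \<ge> 2" "x ^ k = 0" "x ^ (k - 1) \<noteq> 0" using k(1) unfolding S_def by blast
    have bound: "y ^ k = 0" if nil: "y \<in> Z" "e * y = y" "y ^ m = 0" for y m
    proof (cases "y = 0")
      case True then show ?thesis using xf(3) by (cases k) simp_all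
    next
      case False
      obtain k' where k': "k' \<ge> 2" "y ^ k' = 0" "y ^ (k' - 1) \<noteq> 0" "k' \<le> CARD('r)"
        by (rule nilpotent_index[OF nil(3) False])
      have "S k'" unfolding S_def using nil(1,2) k'(1-3) by blast
      then have "k' \<le> k" by (rule max) (rule k'(4))
      then show ?thesis by (rule power_zero_mono[OF k'(2)])
    qed
    have xe: "x ^ (k - 1) * e = x ^ (k - 1)"
    proof -
      have "x * e = x" using Z_commute[OF eZ(1) xf(1)] xf(2) by simp
      moreover obtain j where "k - 1 = Suc j" using xf(3) by (cases "k - 1") simp_all
      ultimately show ?thesis by (simp add: power_Suc2 mult.assoc del: power_Suc)
    qed
    obtain v where v: "(x ^ (k - 1)) \<star> v \<noteq> 0" by (rule nonzero_app[OF xf(5)])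
    define e0 where "e0 = e \<star> v"
    have e0: "e \<star> e0 = e0" "(x ^ (k - 1)) \<star> e0 \<noteq> 0"
      using v eZ xe by (simp_all add: e0_def app_mult[symmetric])
    obtain R where R: "e * R = R" "R * e = R" "\<And>v. \<exists>c. R \<star> v = c *s e0"
      "\<And>i. R \<star> (x ^ i) \<star> e0 = (if i = k - 1 then e0 else 0)"
      by (rule cyclic_functional[OF eZ(2) Z_commute[OF xf(1) eZ(1)] _ _ e0]) (use xf in \<open>simp_all\<close>)
    interpret cyclic_block f d e x R k e0
      by unfold_locales (use e xf e0 R in auto)
    show ?thesis
    proof (cases "k \<le> 3 \<and> (\<exists>\<epsilon>. special e \<epsilon>)")
      case True
      then obtain \<epsilon> where "special e \<epsilon>" by blast
      moreover have "y ^ 3 = 0" if "y \<in> Z" "e * y = y" "y ^ m = 0" for y m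
        by (rule power_zero_mono[OF bound[OF that]]) (use True in simp)
      ultimately show ?thesis using special by blast
    next
      case False
      consider "k = 2" | "k = 3" | "k \<ge> 4" using xf(3) by linarith
      then show ?thesis
      proof cases
        case 1
        show ?thesis
        proof (rule index_two[OF 1])
          show "y * y = 0" if "y \<in> Z" "e * y = y" "y ^ m = 0" for y m
            using bound[OF that] 1 by (simp add: power2_eq_square)
        qed (use 1 False in auto)
      next
        case 2
        then show ?thesis using index_three[OF 2 card] False by auto
      next
        case 3
        then show ?thesis using index_large card by simp
      qed
    qed
  qed
qed

end

section \<open>Frames of an operator of square zero\<close>

lemma prod_list_concat_replicate:
  "prod_list (map h (concat (map (\<lambda>i. replicate (n i) i) xs))) = prod_list (map (\<lambda>i. h i ^ n i) xs)"
  by (induction xs) (simp_all add: prod_list_replicate)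

text \<open>
  A monomial as a product over a list of variables. The two statements differ in
  the type of the values of \<open>h\<close>: the list is used for operators and for elements of an algebra at once.
\<close>

lemma exponent_list:
  fixes \<alpha> :: "'r::finite exponent"
  obtains "is" where "length is = total_degree \<alpha>"
    "\<And>h :: 'r \<Rightarrow> 'a::comm_monoid_mult. prod_list (map h is) = (\<Prod>i\<in>UNIV. h i ^ Poly_Mapping.lookup \<alpha> i)"
    "\<And>h :: 'r \<Rightarrow> 'b::comm_monoid_mult. prod_list (map h is) = (\<Prod>i\<in>UNIV. h i ^ Poly_Mapping.lookup \<alpha> i)"
proof -
  obtain xs :: "'r list" where xs: "set xs = UNIV" "distinct xs"
    using finite_distinct_list[of "UNIV :: 'r set"] finite by blast
  let ?is = "concat (map (\<lambda>i. replicate (Poly_Mapping.lookup \<alpha> i) i) xs)"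
  have "length ?is = sum_list (map (Poly_Mapping.lookup \<alpha>) xs)"
    by (simp add: length_concat o_def)
  also have "\<dots> = total_degree \<alpha>"
    using sum_list_distinct_conv_sum_set[OF xs(2), of "Poly_Mapping.lookup \<alpha>"] by (simp add: total_degree_def xs(1))
  finally show thesis
  proof (rule that)
    show "prod_list (map h ?is) = (\<Prod>i\<in>UNIV. h i ^ Poly_Mapping.lookup \<alpha> i)" for h :: "'r \<Rightarrow> 'a"
      using prod.distinct_set_conv_list[OF xs(2), of "\<lambda>i. h i ^ Poly_Mapping.lookup \<alpha> i"]
      by (simp add: prod_list_concat_replicate xs(1))
    show "prod_list (map h ?is) = (\<Prod>i\<in>UNIV. h i ^ Poly_Mapping.lookup \<alpha> i)" for h :: "'r \<Rightarrow> 'b"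
      using prod.distinct_set_conv_list[OF xs(2), of "\<lambda>i. h i ^ Poly_Mapping.lookup \<alpha> i"]
      by (simp add: prod_list_concat_replicate xs(1))
  qed
qed

text \<open>
  The functional on \<open>K[t][y][\<epsilon>]\<close> with value \<open>w i j\<close> on \<open>y\<^sup>i\<epsilon>\<^sup>j\<close>; the inner polynomial variable
  is \<open>y\<close> and the outer one is \<open>\<epsilon>\<close>.
\<close>

definition wfun :: "(nat \<Rightarrow> nat \<Rightarrow> 'a::comm_ring_1) \<Rightarrow> 'a poly poly \<Rightarrow> 'a" where
  "wfun w h = pfun (\<lambda>j. pfun (\<lambda>i c. c * w i j)) h"

lemma pfun_0_poly: "pfun \<phi> 0 = \<phi> 0 0"
  by (simp add: pfun_def)

lemma wfun_add: "wfun w (g + h) = wfun w g + wfun w h"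
  unfolding wfun_def by (rule pfun_add) (simp_all add: pfun_0_poly pfun_add distrib_right)

lemma wfun_eps: "wfun w ([:0, 1:] * h) = wfun (\<lambda>i j. w i (Suc j)) h"
  unfolding wfun_def by (simp add: pfun_pCons pfun_0_poly)

lemma wfun_smult: "wfun w (smult a h) = pfun (\<lambda>j c. pfun (\<lambda>i c. c * w i j) (a * c)) h"
  unfolding wfun_def by (rule pfun_smult) (simp add: pfun_0_poly)

lemma wfun_y: "wfun w ([:[:0, 1:]:] * h) = wfun (\<lambda>i j. w (Suc i) j) h"
  by (simp add: wfun_smult) (simp add: wfun_def pfun_pCons)

lemma wfun_const: "wfun w ([:[:a:]:] * h) = a * wfun w h"
proof -
  have "pfun (\<lambda>i c. c * w i j) ([:a:] * c) = a * pfun (\<lambda>i c. c * w i j) c" for j c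
  proof -
    have "pfun (\<lambda>i c. c * w i j) (smult a c) = pfun (\<lambda>i x. (a * x) * w i j) c" by (rule pfun_smult) simp
    then show ?thesis by (simp add: mult.assoc pfun_mult_fun)
  qed
  then have "wfun w (smult [:a:] h) = a * wfun w h"
    unfolding wfun_smult by (simp only: pfun_mult_fun wfun_def)
  then show ?thesis by simp
qed

lemma wfun_one: "wfun w 1 = w 0 0"
  by (simp add: wfun_def pfun_def one_pCons)

lemma wfun_monomial: "wfun w ([:[:0, 1:]:] ^ i * [:0, 1:] ^ j) = w i j"
proof (induction i arbitrary: w)
  case 0
  show ?case
    by (induction j arbitrary: w) (simp_all add: wfun_one wfun_eps del: mult_pCons_left)
next
  case (Suc i)
  then show ?case by (simp add: mult.assoc wfun_y del: mult_pCons_left)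
qed

lemma is_hom_const2: "is_hom (\<lambda>c. [:[:c:]:])"
  by (rule is_hom_comp[OF is_hom_const_poly is_hom_const_poly])

lemma functional_wfun: "functional (\<lambda>c. [:[:c:]:]) (wfun w)"
  by unfold_locales (simp_all only: is_hom_const2 wfun_add wfun_const)

text \<open>
  An operator of square zero together with two vectors whose images are independent. Then \<open>e0, e1, \<epsilon>e0, \<epsilon>e1\<close> are
  independent, and in at most four dimensions they are a basis, with the kernel of
  \<open>\<epsilon>\<close> equal to its image.
\<close>

locale frame = nondegenerate_form f d
  for f :: "('k::alg_closed_field, 'r::finite) dpower" and d +
  fixes \<epsilon> :: "('k, 'r) endo" and e0 e1 :: "'k ^ 'r"
  assumes \<epsilon>: "\<epsilon> \<in> Z" "\<epsilon> * \<epsilon> = 0"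
    and ind: "\<And>a b. a *s (\<epsilon> \<star> e0) + b *s (\<epsilon> \<star> e1) = 0 \<Longrightarrow> a = 0 \<and> b = 0"
    and card: "CARD('r) \<le> 4"
begin

definition b :: "nat \<Rightarrow> 'k ^ 'r" where
  "b j = (if j = 0 then e0 else if j = 1 then e1 else if j = 2 then \<epsilon> \<star> e0 else \<epsilon> \<star> e1)"

lemma b_simps [simp]: "b 0 = e0" "b (Suc 0) = e1" "b 2 = \<epsilon> \<star> e0" "b 3 = \<epsilon> \<star> e1"
  by (simp_all add: b_def)

lemma \<epsilon>\<epsilon>: "\<epsilon> \<star> \<epsilon> \<star> v = 0"
  using \<epsilon>(2) by (simp add: app_mult[symmetric])

lemma sum4: "(\<Sum>j<4. h j) = h 0 + h 1 + h 2 + h (3::nat)" for h :: "nat \<Rightarrow> 'x::comm_monoid_add"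
  by (simp add: eval_nat_numeral add.assoc)

lemma all4: "(\<forall>j<4. Q j) \<longleftrightarrow> Q 0 \<and> Q 1 \<and> Q 2 \<and> Q (3::nat)"
  by (auto simp: eval_nat_numeral less_Suc_eq)

lemma indep_b: "indep 4 b"
  unfolding indep_def
proof (intro allI impI)
  fix c i assume s: "(\<Sum>i<4. c i *s b i) = 0" and i: "i < (4::nat)"
  have s': "c 0 *s e0 + c 1 *s e1 + c 2 *s (\<epsilon> \<star> e0) + c 3 *s (\<epsilon> \<star> e1) = 0" using s by (simp add: sum4)
  then have "\<epsilon> \<star> (c 0 *s e0 + c 1 *s e1 + c 2 *s (\<epsilon> \<star> e0) + c 3 *s (\<epsilon> \<star> e1)) = 0" by simp
  then have "c 0 *s (\<epsilon> \<star> e0) + c 1 *s (\<epsilon> \<star> e1) = 0" by (simp add: app_vadd app_vscale \<epsilon>\<epsilon>)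
  then have z: "c 0 = 0 \<and> c 1 = 0" by (rule ind)
  then have "c 2 *s (\<epsilon> \<star> e0) + c 3 *s (\<epsilon> \<star> e1) = 0" using s' by simp
  then have "c 2 = 0 \<and> c 3 = 0" by (rule ind)
  with z have "\<forall>i<4. c i = 0" by (simp add: all4)
  with i show "c i = 0" by blast
qed

definition coords :: "'r \<Rightarrow> nat \<Rightarrow> 'k" where
  "coords i = (SOME c. axis i 1 = (\<Sum>j<4. c j *s b j))"

lemma coords: "axis i 1 = (\<Sum>j<4. coords i j *s b j)"
  proof -
  obtain c where "axis i 1 = (\<Sum>j<4. c j *s b j)" by (rule indep_spans[OF indep_b card])
  then show ?thesis unfolding coords_def
    by (rule someI[where P = "\<lambda>c. axis i 1 = (\<Sum>j<4. c j *s b j)"])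
qed

definition coord :: "nat \<Rightarrow> 'k ^ 'r \<Rightarrow> 'k" where
  "coord j v = (\<Sum>i\<in>UNIV. v $ i * coords i j)"

lemma expand: "v = (\<Sum>j<4. coord j v *s b j)"
proof -
  have "v = (\<Sum>i\<in>UNIV. v $ i *s (\<Sum>j<4. coords i j *s b j))"
    by (subst vec_expand[of v]) (simp only: coords[symmetric])
  also have "\<dots> = (\<Sum>j<4. coord j v *s b j)"
    unfolding vec.scale_sum_right by (subst sum.swap) (simp add: coord_def vec.scale_sum_left)
  finally show ?thesis .
qed

lemma coord_b: "j < 4 \<Longrightarrow> l < 4 \<Longrightarrow> coord l (b j) = (if l = j then 1 else 0)"
proof -
  assume j: "j < 4" and l: "l < 4"
  have "(\<Sum>i<4. (coord i (b j) - (if i = j then 1 else 0)) *s b i) = (\<Sum>i<4. coord i (b j) *s b i) - (\<Sum>i<4. (if i = j then 1 else 0) *s b i)"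
    by (simp add: vec.scale_left_diff_distrib sum_subtractf)
  also have "(\<Sum>i<4. (if i = j then 1 else 0) *s b i) = (\<Sum>i<4. if i = j then b j else 0)"
    by (rule sum.cong) auto
  also have "\<dots> = b j" using j by simp
  finally have "(\<Sum>i<4. (coord i (b j) - (if i = j then 1 else 0)) *s b i) = 0"
    using expand[of "b j"] by simp
  from indepD[OF indep_b this l] show ?thesis by simp
qed

abbreviation (input) Y :: "'k poly poly poly" where "Y \<equiv> [:[:0, 1:]:]"
abbreviation (input) T :: "'k poly poly poly" where "T \<equiv> [:0, 1:]"
abbreviation (input) K :: "'k poly \<Rightarrow> 'k poly poly poly" where "K c \<equiv> [:[:c:]:]"

text \<open>
  In \<open>K[t][y][\<epsilon>]\<close> the basis vectors are represented by \<open>1, y, \<epsilon>, \<epsilon>y\<close>. Here \<open>Y\<close> and \<open>T\<close> are the variables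
  \<open>y\<close> and \<open>\<epsilon>\<close>, and \<open>K\<close> embeds the scalars.
\<close>

definition mono :: "nat \<Rightarrow> 'k poly poly poly" where
  "mono j = (if j = 0 then 1 else if j = 1 then Y else if j = 2 then T else Y * T)"

lemma mono_simps: "mono 0 = 1" "mono (Suc 0) = Y" "mono 2 = T" "mono 3 = Y * T"
  by (simp_all add: mono_def)

definition \<sigma> :: "'r \<Rightarrow> 'k poly poly poly" where
  "\<sigma> i = (\<Sum>j<4. K [:coords i j:] * mono j)"

definition cc :: "nat \<Rightarrow> ('k poly) ^ 'r \<Rightarrow> 'k poly" where
  "cc j v = (\<Sum>i\<in>UNIV. v $ i * [:coords i j:])"

lemma vect_\<sigma>: "functional.vect (\<lambda>c. K c) \<sigma> v = (\<Sum>j<4. K (cc j v) * mono j)"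
proof -
  interpret functional "\<lambda>c. K c" "wfun (\<lambda>_ _. 0 :: 'k poly)" by (rule functional_wfun)
  have "vect \<sigma> v = (\<Sum>j<4. \<Sum>i\<in>UNIV. K (v $ i) * (K [:coords i j:] * mono j))"
    unfolding vect_def \<sigma>_def sum_distrib_left by (rule sum.swap)
  also have "\<dots> = (\<Sum>j<4. (\<Sum>i\<in>UNIV. K (v $ i * [:coords i j:])) * mono j)"
    unfolding sum_distrib_right by (simp only: is_homD[OF is_hom_const2] mult.assoc)
  finally show ?thesis unfolding cc_def hom_sum[OF is_hom_const2] .
qed

definition bb :: "nat \<Rightarrow> ('k poly) ^ 'r" where "bb j = vmap const (b j)"

lemma cc_const: "cc j (vmap const v) = [:coord j v:]"
proof -
  have "[:coord j v:] = (\<Sum>i\<in>UNIV. [:v $ i * coords i j:])"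
    unfolding coord_def by (rule hom_sum) (rule is_hom_const_poly)
  then show ?thesis by (simp add: cc_def mult.commute)
qed

lemma cc_bb: "j < 4 \<Longrightarrow> l < 4 \<Longrightarrow> cc l (bb j) = (if l = j then 1 else 0)"
  by (simp add: bb_def cc_const coord_b one_pCons)

definition from_images :: "(nat \<Rightarrow> ('k poly) ^ 'r) \<Rightarrow> ('k poly, 'r) endo" where
  "from_images w = of_cols (\<lambda>i. \<Sum>j<4. [:coords i j:] *s w j)"

lemma from_images_app: "from_images w \<star> v = (\<Sum>j<4. cc j v *s w j)"
proof -
  have "from_images w \<star> v = (\<Sum>j<4. \<Sum>i\<in>UNIV. v $ i *s ([:coords i j:] *s w j))"
    unfolding from_images_def of_cols_app vec_eq_iff
    by (simp add: sum_distrib_left sum_distrib_right) (intro allI, rule sum.swap)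
  then show ?thesis by (simp add: cc_def vec_eq_iff sum_distrib_right mult.assoc)
qed

lemma from_images_bb: "j < 4 \<Longrightarrow> from_images w \<star> bb j = w j"
proof -
  assume j: "j < 4"
  have "from_images w \<star> bb j = (\<Sum>l<4. if l = j then w j else 0)"
    unfolding from_images_app by (rule sum.cong) (use j in \<open>auto simp: cc_bb\<close>)
  then show ?thesis using j by simp
qed

lemma at0_from_images: "j < 4 \<Longrightarrow> emap at0 (from_images w) \<star> b j = vmap at0 (w j)"
proof -
  assume j: "j < 4"
  have "b j = vmap at0 (bb j)" by (simp add: bb_def vec_eq_iff)
  then show ?thesis using emap_app[OF is_hom_eval0, of "from_images w" "bb j"] from_images_bb[OF j] by simp
qed

lemma acts_from_images:
  assumes func: "functional (\<lambda>c. K c) \<Psi>"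
    and w: "\<And>j z. j < 4 \<Longrightarrow> \<Psi> (functional.vect (\<lambda>c. K c) \<sigma> (w j) * z) = \<Psi> (m * (mono j * z))"
  shows "functional.acts_as (\<lambda>c. K c) \<Psi> \<sigma> (from_images w) m"
proof -
  interpret functional "\<lambda>c. K c" \<Psi> by (rule func)
  have vs: "vect \<sigma> (\<Sum>j\<in>I. v j) = (\<Sum>j\<in>I. vect \<sigma> (v j))" for I :: "nat set" and v
    by (induction I rule: infinite_finite_induct) (simp_all add: vect_add, simp_all add: vect_def)
  show ?thesis unfolding acts_as_def
  proof (intro allI)
    fix v z
    have "\<Psi> (vect \<sigma> (from_images w \<star> v) * z) = (\<Sum>j<4. cc j v * \<Psi> (vect \<sigma> (w j) * z))"
      unfolding from_images_app vs vect_scale sum_distrib_right sum by (simp only: mult.assoc scale)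
    also have "\<dots> = (\<Sum>j<4. cc j v * \<Psi> (m * (mono j * z)))"
      by (rule sum.cong) (simp_all add: w)
    also have "\<dots> = \<Psi> (m * (vect \<sigma> v * z))"
      unfolding vect_\<sigma> sum_distrib_right sum_distrib_left sum
      by (simp only: mult.left_commute[of m] mult.assoc scale)
    finally show "\<Psi> (vect \<sigma> (from_images w \<star> v) * z) = \<Psi> (m * (vect \<sigma> v * z))" .
  qed
qed

lemma vect_bb: "j < 4 \<Longrightarrow> functional.vect (\<lambda>c. K c) \<sigma> (bb j) = mono j"
proof -
  assume j: "j < 4"
  have "functional.vect (\<lambda>c. K c) \<sigma> (bb j) = (\<Sum>l<4. if l = j then mono j else 0)"
    unfolding vect_\<sigma> by (rule sum.cong) (use j in \<open>auto simp: cc_bb one_pCons[symmetric]\<close>)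
  then show ?thesis using j by simp
qed

lemma kernel:
  assumes "\<epsilon> \<star> v = 0" obtains u where "v = \<epsilon> \<star> u"
proof -
  have v: "v = coord 0 v *s e0 + coord 1 v *s e1 + coord 2 v *s (\<epsilon> \<star> e0) + coord 3 v *s (\<epsilon> \<star> e1)"
    using expand[of v] by (simp add: sum4)
  have "\<epsilon> \<star> (coord 0 v *s e0 + coord 1 v *s e1 + coord 2 v *s (\<epsilon> \<star> e0) + coord 3 v *s (\<epsilon> \<star> e1)) =
      coord 0 v *s (\<epsilon> \<star> e0) + coord 1 v *s (\<epsilon> \<star> e1)"
    by (simp add: app_vadd app_vscale \<epsilon>\<epsilon>)
  then have "coord 0 v *s (\<epsilon> \<star> e0) + coord 1 v *s (\<epsilon> \<star> e1) = 0" using assms v by simp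
  then have "coord 0 v = 0 \<and> coord 1 v = 0" by (rule ind)
  then have "v = \<epsilon> \<star> (coord 2 v *s e0 + coord 3 v *s e1)" using v by (simp add: app_vadd app_vscale)
  then show thesis by (rule that)
qed

lemma image: "\<epsilon> \<star> v = coord 0 v *s (\<epsilon> \<star> e0) + coord 1 v *s (\<epsilon> \<star> e1)"
proof -
  have "\<epsilon> \<star> v = \<epsilon> \<star> (coord 0 v *s e0 + coord 1 v *s e1 + coord 2 v *s (\<epsilon> \<star> e0) + coord 3 v *s (\<epsilon> \<star> e1))"
    using expand[of v] by (simp add: sum4)
  then show ?thesis by (simp add: app_vadd app_vscale \<epsilon>\<epsilon>)
qed

lemma frame_eqI:
  assumes "A \<star> e0 = B \<star> e0" "A \<star> e1 = B \<star> e1"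
    "A \<star> \<epsilon> \<star> e0 = B \<star> \<epsilon> \<star> e0" "A \<star> \<epsilon> \<star> e1 = B \<star> \<epsilon> \<star> e1"
  shows "A = B"
proof (rule endo_eqI)
  fix v
  have "A \<star> (\<Sum>j<4. coord j v *s b j) = B \<star> (\<Sum>j<4. coord j v *s b j)"
    by (simp add: sum4 app_vadd app_vscale assms)
  then show "A \<star> v = B \<star> v" using expand[of v] by simp
qed

end

lemma (in nondegenerate_form) pair_move:
  assumes "A \<in> Z" shows "pair (lin (A \<star> v) * lin w * X) f = pair (lin v * lin (A \<star> w) * X) f"
  using Z_sym[OF assms, of v w] by (simp add: pair_mult ctr_def contract_mult pair_def mult.commute[of _ X])

text \<open>
  The additional condition says that the derivative of \<open>f\<close> along \<open>\<epsilon>e1\<close> sees \<open>e1\<close> as \<open>\<rho>e0\<close>. Then \<open>f\<close> is determined by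
  its values on \<open>e0, e1\<close> and the two values \<open>p0, q0\<close> involving \<open>\<epsilon>\<close>.
\<close>

locale double_frame = frame f d \<epsilon> e0 e1
  for f :: "('k::alg_closed_field, 'r::finite) dpower" and d \<epsilon> e0 e1 +
  fixes \<rho> :: 'k
  assumes rho: "\<And>X. pair (lin (\<epsilon> \<star> e1) * lin e1 * X) f = \<rho> * pair (lin (\<epsilon> \<star> e1) * lin e0 * X) f"
begin

definition val :: "nat \<Rightarrow> 'k" where "val i = pair (lin e0 ^ (d - i) * lin e1 ^ i) f"
definition p0 :: 'k where "p0 = pair (lin (\<epsilon> \<star> e0) * lin e0 ^ (d - 1)) f"
definition q0 :: 'k where "q0 = pair (lin (\<epsilon> \<star> e1) * lin e0 ^ (d - 1)) f"

text \<open>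
  What the functional \<open>wfun w\<close> has to be at \<open>t = 0\<close>: the value of \<open>f\<close> on
  \<open>d\<close> basis vectors that are represented by monomials with product \<open>y\<^sup>i\<epsilon>\<^sup>j\<close>. It only depends on the
  product since \<open>\<epsilon>\<close> may be moved between arguments, and it vanishes for \<open>j \<ge> 2\<close>.
\<close>

definition target :: "nat \<Rightarrow> nat \<Rightarrow> 'k" where
  "target i j = (if j = 0 then val i else if j = 1 then (if i = 0 then p0 else \<rho> ^ (i - 1) * q0) else 0)"

lemma table_E1: "a + c + 1 = d \<Longrightarrow> pair (lin (\<epsilon> \<star> e1) * (lin e0 ^ a * lin e1 ^ c)) f = \<rho> ^ c * q0"
proof (induction c arbitrary: a)
  case 0
  then show ?case by (simp add: q0_def) (metis add_diff_cancel_right' One_nat_def Suc_eq_plus1)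
next
  case (Suc c)
  have "pair (lin (\<epsilon> \<star> e1) * (lin e0 ^ a * lin e1 ^ Suc c)) f = pair (lin (\<epsilon> \<star> e1) * lin e1 * (lin e0 ^ a * lin e1 ^ c)) f"
    by (simp only: power_Suc ac_simps)
  also have "\<dots> = \<rho> * pair (lin (\<epsilon> \<star> e1) * lin e0 * (lin e0 ^ a * lin e1 ^ c)) f" by (rule rho)
  also have "lin (\<epsilon> \<star> e1) * lin e0 * (lin e0 ^ a * lin e1 ^ c) = lin (\<epsilon> \<star> e1) * (lin e0 ^ Suc a * lin e1 ^ c)"
    by (simp only: power_Suc ac_simps)
  finally show ?case using Suc.IH[of "Suc a"] Suc.prems by simp
qed

lemma table:
  assumes "a + c + a' + c' = d"
  shows "pair (lin e0 ^ a * lin e1 ^ c * lin (\<epsilon> \<star> e0) ^ a' * lin (\<epsilon> \<star> e1) ^ c') f = target (c + c') (a' + c')"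
proof -
  have zz: "pair (lin (\<epsilon> \<star> u) * lin (\<epsilon> \<star> v) * X) f = 0" for u v X
    using pair_move[OF \<epsilon>(1), of u "\<epsilon> \<star> v" X] by (simp add: \<epsilon>\<epsilon>)
  consider "a' + c' = 0" | "a' = 1" "c' = 0" | "a' = 0" "c' = 1" | a'' where "a' = Suc (Suc a'')"
    | c'' where "c' = Suc (Suc c'')" | a'' c'' where "a' = Suc a''" "c' = Suc c''"
    by (metis One_nat_def add_is_0 not0_implies_Suc)
  then show ?thesis
  proof cases
    case 1
    then have "a = d - c" using assms by simp
    then show ?thesis using 1 by (simp add: target_def val_def)
  next
    case 2
    show ?thesis
    proof (cases c)
      case 0
      then have "a = d - 1" using 2 assms by simp
      then show ?thesis using 0 2 by (simp add: target_def p0_def mult.commute)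
    next
      case (Suc c1)
      have "pair (lin e0 ^ a * lin e1 ^ c * lin (\<epsilon> \<star> e0) ^ a' * lin (\<epsilon> \<star> e1) ^ c') f =
        pair (lin (\<epsilon> \<star> e0) * lin e1 * (lin e0 ^ a * lin e1 ^ c1)) f"
        using 2 Suc by (simp add: ac_simps)
      also have "\<dots> = pair (lin e0 * lin (\<epsilon> \<star> e1) * (lin e0 ^ a * lin e1 ^ c1)) f" by (rule pair_move[OF \<epsilon>(1)])
      also have "lin e0 * lin (\<epsilon> \<star> e1) * (lin e0 ^ a * lin e1 ^ c1) = lin (\<epsilon> \<star> e1) * (lin e0 ^ Suc a * lin e1 ^ c1)"
        by (simp only: power_Suc ac_simps)
      also have "pair \<dots> f = \<rho> ^ c1 * q0" using 2 Suc assms by (intro table_E1) simp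
      finally show ?thesis using 2 Suc by (simp add: target_def)
    qed
  next
    case 3
    have "pair (lin e0 ^ a * lin e1 ^ c * lin (\<epsilon> \<star> e0) ^ a' * lin (\<epsilon> \<star> e1) ^ c') f =
        pair (lin (\<epsilon> \<star> e1) * (lin e0 ^ a * lin e1 ^ c)) f"
      using 3 by (simp add: ac_simps)
    also have "\<dots> = \<rho> ^ c * q0" using 3 assms by (intro table_E1) simp
    finally show ?thesis using 3 by (simp add: target_def)
  next
    case 4
    have "lin e0 ^ a * lin e1 ^ c * lin (\<epsilon> \<star> e0) ^ a' * lin (\<epsilon> \<star> e1) ^ c' =
      lin (\<epsilon> \<star> e0) * lin (\<epsilon> \<star> e0) * (lin e0 ^ a * lin e1 ^ c * lin (\<epsilon> \<star> e0) ^ a'' * lin (\<epsilon> \<star> e1) ^ c')"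
      unfolding 4 by (simp only: power_Suc ac_simps)
    then show ?thesis using 4 by (simp only: zz) (simp add: target_def)
  next
    case 5
    have "lin e0 ^ a * lin e1 ^ c * lin (\<epsilon> \<star> e0) ^ a' * lin (\<epsilon> \<star> e1) ^ c' =
      lin (\<epsilon> \<star> e1) * lin (\<epsilon> \<star> e1) * (lin e0 ^ a * lin e1 ^ c * lin (\<epsilon> \<star> e0) ^ a' * lin (\<epsilon> \<star> e1) ^ c'')"
      unfolding 5 by (simp only: power_Suc ac_simps)
    then show ?thesis using 5 by (simp only: zz) (simp add: target_def)
  next
    case 6
    have "lin e0 ^ a * lin e1 ^ c * lin (\<epsilon> \<star> e0) ^ a' * lin (\<epsilon> \<star> e1) ^ c' =
      lin (\<epsilon> \<star> e0) * lin (\<epsilon> \<star> e1) * (lin e0 ^ a * lin e1 ^ c * lin (\<epsilon> \<star> e0) ^ a'' * lin (\<epsilon> \<star> e1) ^ c'')"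
      unfolding 6 by (simp only: power_Suc ac_simps)
    then show ?thesis using 6 by (simp only: zz) (simp add: target_def)
  qed
qed

lemma pair_add_mult: "pair (lin (\<Sum>j<(4::nat). c j *s v j) * X) f = (\<Sum>j<4. c j * pair (lin (v j) * X) f)"
proof -
  have "pair (Poly_Mapping.single 0 a * D) f = a * pair D f" for a D
    by (simp add: mult.commute[of "Poly_Mapping.single 0 a"] pair_def contract_mult contract_const contract_fscale lookup_fscale)
  moreover have "pair (\<Sum>i\<in>I. D i) f = (\<Sum>i\<in>I. pair (D i) f)" for I :: "nat set" and D
    by (induction I rule: infinite_finite_induct) (simp_all add: pair_add)
  ultimately show ?thesis
    by (simp only: lin_sum lin_scale sum_distrib_right mult.assoc)
qed

text \<open>
  The arguments of \<open>f\<close> are replaced by basis vectors one after the other; \<open>?M a c a' c'\<close> collects the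
  basis vectors that have been inserted already.
\<close>

lemma specialization:
  assumes w: "\<And>i j. i \<le> d \<Longrightarrow> j \<le> d \<Longrightarrow> at0 (w i j) = target i j"
  shows "fmapc at0 (dform (wfun w) \<sigma> d) = f"
proof (rule poly_mapping_eqI)
  fix \<alpha>
  note h0 = is_hom_eval0[where 'a='k]
  interpret functional "\<lambda>c. K c" "wfun w" by (rule functional_wfun)
  let ?M = "\<lambda>a c a' c'. lin e0 ^ a * lin e1 ^ c * lin (\<epsilon> \<star> e0) ^ a' * lin (\<epsilon> \<star> e1) ^ c'"
  have key: "length is + (a + c + a' + c') = d \<Longrightarrow>
    pair (prod_list (map (\<lambda>i. lin (axis i 1)) is) * ?M a c a' c') f =
    at0 (wfun w (prod_list (map \<sigma> is) * (Y ^ (c + c') * T ^ (a' + c'))))" for "is" a c a' c'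
  proof (induction "is" arbitrary: a c a' c')
    case Nil
    then have d': "a + c + a' + c' = d" by simp
    have "pair (?M a c a' c') f = target (c + c') (a' + c')" by (rule table[OF d'])
    moreover have "at0 (wfun w (Y ^ (c + c') * T ^ (a' + c'))) = target (c + c') (a' + c')"
      unfolding wfun_monomial using d' by (intro w) auto
    ultimately show ?case by (simp del: power_mult_distrib)
  next
    case (Cons i "is")
    let ?L = "prod_list (map (\<lambda>i. lin (axis i 1)) is)" and ?S = "prod_list (map \<sigma> is)"
    have len: "length is + (Suc a + c + a' + c') = d" "length is + (a + Suc c + a' + c') = d"
      "length is + (a + c + Suc a' + c') = d" "length is + (a + c + a' + Suc c') = d"
      using Cons.prems by simp_all
    have "pair (prod_list (map (\<lambda>i. lin (axis i 1)) (i # is)) * ?M a c a' c') f =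
      pair (lin (\<Sum>j<4. coords i j *s b j) * (?L * ?M a c a' c')) f"
      by (simp only: coords[symmetric] list.map prod_list.Cons mult.assoc)
    also have "\<dots> = coords i 0 * pair (?L * ?M (Suc a) c a' c') f + coords i 1 * pair (?L * ?M a (Suc c) a' c') f
       + coords i 2 * pair (?L * ?M a c (Suc a') c') f + coords i 3 * pair (?L * ?M a c a' (Suc c')) f"
      unfolding pair_add_mult unfolding sum4 by (simp only: b_simps One_nat_def power_Suc ac_simps)
    also have "\<dots> = coords i 0 * at0 (wfun w (?S * (Y ^ (c + c') * T ^ (a' + c')))) +
        coords i 1 * at0 (wfun w (?S * (Y ^ (Suc c + c') * T ^ (a' + c')))) +
        coords i 2 * at0 (wfun w (?S * (Y ^ (c + c') * T ^ (Suc a' + c')))) +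
        coords i 3 * at0 (wfun w (?S * (Y ^ (c + Suc c') * T ^ (a' + Suc c'))))"
      by (simp only: Cons.IH[OF len(1)] Cons.IH[OF len(2)] Cons.IH[OF len(3)] Cons.IH[OF len(4)])
    also have "\<dots> = at0 (wfun w (\<sigma> i * (?S * (Y ^ (c + c') * T ^ (a' + c')))))"
    proof -
      let ?z = "?S * (Y ^ (c + c') * T ^ (a' + c'))"
      have "wfun w (\<sigma> i * ?z) = (\<Sum>j<4. [:coords i j:] * wfun w (mono j * ?z))"
        unfolding \<sigma>_def sum_distrib_right sum by (simp only: mult.assoc scale)
      then have "at0 (wfun w (\<sigma> i * ?z)) = (\<Sum>j<4. coords i j * at0 (wfun w (mono j * ?z)))"
        by (simp add: poly_sum)
      moreover have "mono 0 * ?z = ?z" "mono 1 * ?z = ?S * (Y ^ (Suc c + c') * T ^ (a' + c'))"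
        "mono 2 * ?z = ?S * (Y ^ (c + c') * T ^ (Suc a' + c'))" "mono 3 * ?z = ?S * (Y ^ (c + Suc c') * T ^ (a' + Suc c'))"
        unfolding One_nat_def mono_simps add_Suc add_Suc_right power_Suc by (simp_all only: ac_simps mult_1_left)
      ultimately show ?thesis by (simp only: sum4)
    qed
    finally show ?case by (simp only: list.map prod_list.Cons mult.assoc)
  qed
  show "Poly_Mapping.lookup (fmapc at0 (dform (wfun w) \<sigma> d)) \<alpha> = Poly_Mapping.lookup f \<alpha>"
  proof (cases "total_degree \<alpha> = d")
    case True
    obtain "is" where len: "length is = total_degree \<alpha>"
      and ia: "\<And>h :: 'r \<Rightarrow> 'k poly poly poly. prod_list (map h is) = (\<Prod>i\<in>UNIV. h i ^ Poly_Mapping.lookup \<alpha> i)"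
      and ib: "\<And>h :: 'r \<Rightarrow> ('k, 'r) diffop. prod_list (map h is) = (\<Prod>i\<in>UNIV. h i ^ Poly_Mapping.lookup \<alpha> i)"
      by (rule exponent_list[of \<alpha>]) blast
    have "Poly_Mapping.lookup f \<alpha> = pair (prod_list (map (\<lambda>i. lin (axis i 1)) is) * ?M 0 0 0 0) f"
      by (simp add: ib prod_lin_axis pair_monomial)
    also have "\<dots> = at0 (wfun w (prod_list (map \<sigma> is) * (Y ^ (0 + 0) * T ^ (0 + 0))))"
      by (rule key) (simp add: len True)
    also have "\<dots> = at0 (wfun w (\<Prod>i\<in>UNIV. \<sigma> i ^ Poly_Mapping.lookup \<alpha> i))" by (simp add: ia)
    finally show ?thesis using True by (simp add: lookup_fmapc[OF h0] lookup_dform)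
  next
    case False
    then show ?thesis using f by (simp add: lookup_fmapc[OF h0] lookup_dform homogeneous_iff)
  qed
qed

end

section \<open>Deformations of a double frame\<close>

context double_frame
begin

text \<open>
  The weights for which the functional vanishes on the multiples of \<open>\<epsilon>(\<epsilon> - t)\<close>, see \<open>kill_eps\<close>. On the branch
  \<open>\<epsilon> = t\<close>, i.e. on multiples of \<open>\<epsilon>\<close>, it is given by \<open>y\<^sup>i \<mapsto> H\<^sub>i\<close>; on the branch \<open>\<epsilon> = 0\<close>, i.e. on
  multiples of \<open>t - \<epsilon>\<close>, by \<open>y\<^sup>i \<mapsto> t G\<^sub>i - H\<^sub>i\<close>. If one of these sequences is geometric with ratio \<open>\<theta>\<close> from \<open>i = 1\<close> on,
  then \<open>y(y - \<theta>) = 0\<close> holds on that branch, so that it has two points.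
\<close>

definition weight :: "(nat \<Rightarrow> 'k poly) \<Rightarrow> (nat \<Rightarrow> 'k poly) \<Rightarrow> nat \<Rightarrow> nat \<Rightarrow> 'k poly" where
  "weight G H i j = (case j of 0 \<Rightarrow> G i | Suc j' \<Rightarrow> monom 1 j' * H i)"

abbreviation (input) tt :: "'k poly" where "tt \<equiv> [:0, 1:]"

lemma weight_simps: "weight G H i 0 = G i" "weight G H i (Suc 0) = H i"
    "weight G H i (Suc (Suc j)) = tt * weight G H i (Suc j)"
  by (simp_all add: weight_def monom_0 one_pCons[symmetric] monom_Suc)

lemma wfun_diff_fun: "wfun (\<lambda>i j. w i j - w' i j) z = wfun w z - wfun w' z"
  by (simp add: wfun_def pfun_def right_diff_distrib sum_subtractf)

lemma wfun_mult_fun: "wfun (\<lambda>i j. c * w i j) z = c * wfun w z"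
  by (simp add: wfun_def pfun_def mult.left_commute sum_distrib_left)

lemma wfun_zero_fun: "(\<And>i j. w i j = 0) \<Longrightarrow> wfun w z = 0"
  by (simp add: wfun_def pfun_def)

lemma kill_eps: "wfun (weight G H) (T * (T - K tt) * z) = 0"
proof -
  interpret functional "\<lambda>c. K c" "wfun w" for w :: "nat \<Rightarrow> nat \<Rightarrow> 'k poly" by (rule functional_wfun)
  have "wfun (weight G H) (T * (T - K tt) * z) =
    wfun (\<lambda>i j. weight G H i (Suc (Suc j))) z - tt * wfun (\<lambda>i j. weight G H i (Suc j)) z"
    by (simp only: mult.assoc wfun_eps left_diff_distrib diff scale)
  also have "\<dots> = wfun (\<lambda>i j. weight G H i (Suc (Suc j)) - tt * weight G H i (Suc j)) z"
    by (simp only: wfun_diff_fun wfun_mult_fun)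
  also have "\<dots> = 0" by (rule wfun_zero_fun) (simp only: weight_simps diff_self)
  finally show ?thesis .
qed

lemma kill_at_0:
  assumes "\<And>i. tt * G (i + 2) - H (i + 2) = \<theta> * (tt * G (i + 1) - H (i + 1))"
  shows "wfun (weight G H) ((K tt - T) * (Y * (Y - K \<theta>)) * z) = 0"
proof -
  interpret functional "\<lambda>c. K c" "wfun w" for w :: "nat \<Rightarrow> nat \<Rightarrow> 'k poly" by (rule functional_wfun)
  define u where "u i j = tt * weight G H i j - weight G H i (Suc j)" for i j
  have u0: "u i 0 = tt * G i - H i" and uS: "u i (Suc j) = 0" for i j
    by (simp_all only: u_def weight_simps diff_self)
  have "wfun (weight G H) ((K tt - T) * (Y * (Y - K \<theta>)) * z) = wfun u (Y * (Y * z) - K \<theta> * (Y * z))"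
  proof -
    have e: "(k - t) * (y * (y - c)) * z = k * (y * (y * z) - c * (y * z)) - t * (y * (y * z) - c * (y * z))"
      for k t y c z :: "'k poly poly poly" by (simp add: algebra_simps)
    show ?thesis unfolding e[of "K tt" T Y "K \<theta>" z] u_def by (simp only: diff[of _ "K tt * _"] scale wfun_eps wfun_diff_fun wfun_mult_fun)
  qed
  also have "\<dots> = wfun (\<lambda>i j. u (Suc (Suc i)) j - \<theta> * u (Suc i) j) z"
    by (simp only: diff scale wfun_y wfun_diff_fun wfun_mult_fun)
  also have "\<dots> = 0"
  proof (rule wfun_zero_fun)
    show "u (Suc (Suc i)) j - \<theta> * u (Suc i) j = 0" for i j
      using assms[of i] by (cases j) (simp_all add: u0 uS)
  qed
  finally show ?thesis .
qed

lemma kill_at_t: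
  assumes "\<And>i. H (i + 2) = \<theta>' * H (i + 1)"
  shows "wfun (weight G H) (T * (Y * (Y - K \<theta>')) * z) = 0"
proof -
  interpret functional "\<lambda>c. K c" "wfun w" for w :: "nat \<Rightarrow> nat \<Rightarrow> 'k poly" by (rule functional_wfun)
  have e: "T * (Y * (Y - K \<theta>')) * z = T * (Y * (Y * z) - K \<theta>' * (Y * z))"
    by (simp only: left_diff_distrib right_diff_distrib mult.assoc mult.left_commute[of Y "K \<theta>'"])
  have "wfun (weight G H) (T * (Y * (Y - K \<theta>')) * z) =
    wfun (\<lambda>i j. weight G H (Suc (Suc i)) (Suc j) - \<theta>' * weight G H (Suc i) (Suc j)) z"
    unfolding e by (simp only: wfun_eps diff scale wfun_y wfun_diff_fun wfun_mult_fun)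
  also have "\<dots> = 0"
  proof (rule wfun_zero_fun)
    show "weight G H (Suc (Suc i)) (Suc j) - \<theta>' * weight G H (Suc i) (Suc j) = 0" for i j
      using assms[of i] by (simp add: weight_def algebra_simps)
  qed
  finally show ?thesis .
qed

lemma less4: "j < 4 \<Longrightarrow> j = 0 \<or> j = 1 \<or> j = 2 \<or> j = (3::nat)"
  by auto

text \<open>
  Operators that act as \<open>\<epsilon>\<close>, as \<open>(t - \<epsilon>)y\<close> and as \<open>\<epsilon>y\<close>. The last two exist because of the relations
  \<open>y\<^sup>2 = \<theta>y\<close> on the branches \<open>\<epsilon> = 0\<close> and \<open>\<epsilon> = t\<close>.
\<close>

definition eps_op :: "('k poly, 'r) endo" where
  "eps_op = from_images (\<lambda>j. if j = 0 then bb 2 else if j = 1 then bb 3 else if j = 2 then tt *s bb 2 else tt *s bb 3)"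

definition op_at_0 :: "'k poly \<Rightarrow> ('k poly, 'r) endo" where
  "op_at_0 \<theta> = from_images (\<lambda>j. if j = 0 then tt *s bb 1 - bb 3 else if j = 1 then \<theta> *s (tt *s bb 1 - bb 3) else 0)"

definition op_at_t :: "'k poly \<Rightarrow> ('k poly, 'r) endo" where
  "op_at_t \<theta>' = from_images (\<lambda>j. if j = 0 then bb 3 else if j = 1 then \<theta>' *s bb 3 else if j = 2 then tt *s bb 3
      else (tt * \<theta>') *s bb 3)"

context
  fixes G H :: "nat \<Rightarrow> 'k poly"
begin

interpretation func: functional "\<lambda>c. K c" "wfun (weight G H)"
  by (rule functional_wfun)

lemma vect_bb1: "func.vect \<sigma> (bb 1) = Y" and vect_bb3: "func.vect \<sigma> (bb 3) = Y * T"
  using vect_bb[of 1] vect_bb[of 3] by (simp_all add: mono_def del: mult_pCons_left mult_pCons_right)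

lemma acts_eps: "func.acts_as \<sigma> eps_op T"
  unfolding eps_op_def
proof (rule acts_from_images[OF functional_wfun])
  fix j z assume "j < (4::nat)"
  have k: "wfun (weight G H) (K tt * T * m * z) = wfun (weight G H) (T * (T * m * z))" for m
  proof -
    have "wfun (weight G H) (T * (T - K tt) * (m * z)) = 0" by (rule kill_eps)
    moreover have "T * (T - K tt) * (m * z) = T * (T * m * z) - K tt * T * m * z"
      by (simp only: left_diff_distrib right_diff_distrib ac_simps)
    ultimately show ?thesis by (simp only: func.diff) simp
  qed
  show "wfun (weight G H) (func.vect \<sigma> (if j = 0 then bb 2 else if j = 1 then bb 3 else if j = 2 then tt *s bb 2 else tt *s bb 3) * z) =
    wfun (weight G H) (T * (mono j * z))"
    using less4[OF \<open>j < 4\<close>]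
  proof (elim disjE)
    assume j: "j = 0" show ?thesis unfolding j by (simp add: vect_bb mono_simps)
  next
    assume j: "j = 1" show ?thesis unfolding j by (simp add: vect_bb mono_simps ac_simps del: mult_pCons_left mult_pCons_right)
  next
    assume j: "j = 2" show ?thesis unfolding j using k[of 1] 
      by (simp add: vect_bb mono_simps func.vect_scale ac_simps del: mult_pCons_left mult_pCons_right)
  next
    assume j: "j = 3" show ?thesis unfolding j using k[of Y]
      by (simp add: vect_bb mono_simps func.vect_scale ac_simps del: mult_pCons_left mult_pCons_right)
  qed
qed

lemma acts_at_0:
  assumes c: "\<And>i. tt * G (i + 2) - H (i + 2) = \<theta> * (tt * G (i + 1) - H (i + 1))"
  shows "func.acts_as \<sigma> (op_at_0 \<theta>) ((K tt - T) * Y)"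
  unfolding op_at_0_def
proof (rule acts_from_images[OF functional_wfun])
  fix j z assume "j < (4::nat)"
  have v: "func.vect \<sigma> (tt *s bb 1 - bb 3) = (K tt - T) * Y"
    unfolding func.vect_diff func.vect_scale vect_bb1 vect_bb3 by (simp only: left_diff_distrib mult.commute[of T Y])
  have v0: "func.vect \<sigma> 0 = 0" using func.vect_scale[of \<sigma> 0 0] by simp
  have k1: "wfun (weight G H) (K \<theta> * ((K tt - T) * Y) * z) = wfun (weight G H) ((K tt - T) * Y * (Y * z))"
  proof -
    have "wfun (weight G H) ((K tt - T) * (Y * (Y - K \<theta>)) * z) = 0" by (rule kill_at_0[OF c])
    moreover have "(K tt - T) * (Y * (Y - K \<theta>)) * z = (K tt - T) * Y * (Y * z) - K \<theta> * ((K tt - T) * Y) * z"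
      by (simp only: right_diff_distrib left_diff_distrib ac_simps)
    ultimately show ?thesis by (simp only: func.diff) simp
  qed
  have k2: "wfun (weight G H) ((K tt - T) * Y * (T * m * z)) = 0" for m
  proof -
    have "wfun (weight G H) (T * (T - K tt) * (- (Y * m * z))) = 0" by (rule kill_eps)
    moreover have "T * (T - K tt) * (- (Y * m * z)) = (K tt - T) * Y * (T * m * z)"
      by (simp only: right_diff_distrib left_diff_distrib ac_simps mult_minus_right) simp
    ultimately show ?thesis by simp
  qed
  show "wfun (weight G H) (func.vect \<sigma> (if j = 0 then tt *s bb 1 - bb 3 else if j = 1 then \<theta> *s (tt *s bb 1 - bb 3) else 0) * z) =
    wfun (weight G H) ((K tt - T) * Y * (mono j * z))"
    using less4[OF \<open>j < 4\<close>]
  proof (elim disjE)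
    assume j: "j = 0"
    have "wfun (weight G H) (func.vect \<sigma> (tt *s bb 1 - bb 3) * z) = wfun (weight G H) ((K tt - T) * Y * (mono 0 * z))"
      by (simp only: v mono_simps mult_1_left)
    then show ?thesis unfolding j by simp
  next
    assume j: "j = 1"
    have "wfun (weight G H) (func.vect \<sigma> (\<theta> *s (tt *s bb 1 - bb 3)) * z) = wfun (weight G H) ((K tt - T) * Y * (mono (Suc 0) * z))"
      by (simp only: func.vect_scale v mono_simps k1)
    then show ?thesis unfolding j by simp
  next
    assume j: "j = 2"
    have "wfun (weight G H) ((K tt - T) * Y * (mono 2 * z)) = 0"
      using k2[of 1] by (simp only: mono_simps mult_1_right)
    then show ?thesis unfolding j by (simp add: v0)
  next
    assume j: "j = 3"
    have "wfun (weight G H) ((K tt - T) * Y * (mono 3 * z)) = 0"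
      using k2[of Y] by (simp only: mono_simps mult.commute[of Y T])
    then show ?thesis unfolding j by (simp add: v0)
  qed
qed

lemma acts_at_t:
  assumes c: "\<And>i. H (i + 2) = \<theta>' * H (i + 1)"
  shows "func.acts_as \<sigma> (op_at_t \<theta>') (T * Y)"
  unfolding op_at_t_def
proof (rule acts_from_images[OF functional_wfun])
  fix j z assume "j < (4::nat)"
  have k1: "wfun (weight G H) (K \<theta>' * (Y * T) * z) = wfun (weight G H) (T * Y * (Y * z))" for z
  proof -
    have "wfun (weight G H) (T * (Y * (Y - K \<theta>')) * z) = 0" by (rule kill_at_t[OF c])
    moreover have "T * (Y * (Y - K \<theta>')) * z = T * Y * (Y * z) - K \<theta>' * (Y * T) * z"
      by (simp only: right_diff_distrib left_diff_distrib ac_simps)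
    ultimately show ?thesis by (simp only: func.diff) simp
  qed
  have k2: "wfun (weight G H) (K tt * (Y * T) * z) = wfun (weight G H) (T * Y * (T * z))" for z
  proof -
    have "wfun (weight G H) (T * (T - K tt) * (Y * z)) = 0" by (rule kill_eps)
    moreover have "T * (T - K tt) * (Y * z) = T * Y * (T * z) - K tt * (Y * T) * z"
      by (simp only: right_diff_distrib left_diff_distrib ac_simps)
    ultimately show ?thesis by (simp only: func.diff) simp
  qed
  show "wfun (weight G H) (func.vect \<sigma> (if j = 0 then bb 3 else if j = 1 then \<theta>' *s bb 3 else if j = 2 then tt *s bb 3
      else (tt * \<theta>') *s bb 3) * z) = wfun (weight G H) (T * Y * (mono j * z))"
    using less4[OF \<open>j < 4\<close>]
  proof (elim disjE)
    assume j: "j = 0"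
    have "wfun (weight G H) (func.vect \<sigma> (bb 3) * z) = wfun (weight G H) (T * Y * (mono 0 * z))"
      by (simp only: vect_bb3 mono_simps mult_1_left mult.commute[of T Y])
    then show ?thesis unfolding j by simp
  next
    assume j: "j = 1"
    have "wfun (weight G H) (func.vect \<sigma> (\<theta>' *s bb 3) * z) = wfun (weight G H) (T * Y * (mono (Suc 0) * z))"
      by (simp only: func.vect_scale vect_bb3 mono_simps k1)
    then show ?thesis unfolding j by simp
  next
    assume j: "j = 2"
    have "wfun (weight G H) (func.vect \<sigma> (tt *s bb 3) * z) = wfun (weight G H) (T * Y * (mono 2 * z))"
      by (simp only: func.vect_scale vect_bb3 mono_simps k2)
    then show ?thesis unfolding j by simp
  next
    assume j: "j = 3"
    have "wfun (weight G H) (func.vect \<sigma> ((tt * \<theta>') *s bb 3) * z) = wfun (weight G H) (K tt * (Y * T) * (K \<theta>' * z))"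
      by (simp only: func.vect_scale vect_bb3 mono_simps is_homD(4)[OF is_hom_const2] ac_simps)
    also have "\<dots> = wfun (weight G H) (K \<theta>' * (Y * T) * (T * z))"
      unfolding k2 by (simp only: ac_simps)
    also have "\<dots> = wfun (weight G H) (T * Y * (mono 3 * z))"
      unfolding k1 mono_simps by (simp only: ac_simps)
    finally show ?thesis unfolding j by simp
  qed
qed

end

lemma vmap_simps:
  "vmap at0 (bb j) = b j" "vmap at0 (c *s v) = at0 c *s vmap at0 v" "vmap at0 (v - w) = vmap at0 v - vmap at0 w"
  "vmap at0 0 = 0"
  for v w :: "'k poly ^ 'r"
  by (simp_all add: bb_def vec_eq_iff)

lemma at0_eps_op: "emap at0 eps_op \<star> e0 = \<epsilon> \<star> e0"
  using at0_from_images[of 0] by (simp add: eps_op_def vmap_simps)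

lemma at0_op_at_0: "emap at0 (op_at_0 \<theta>) \<star> e0 = - (\<epsilon> \<star> e1)"
  using at0_from_images[of 0] by (simp add: op_at_0_def vmap_simps)

lemma at0_op_at_t: "emap at0 (op_at_t \<theta>') \<star> e0 = \<epsilon> \<star> e1"
  using at0_from_images[of 0] by (simp add: op_at_t_def vmap_simps)

lemma frame_nonzero: "\<epsilon> \<star> e0 \<noteq> 0" "\<epsilon> \<star> e1 \<noteq> 0" "a *s (\<epsilon> \<star> e0) + \<epsilon> \<star> e1 \<noteq> 0"
proof -
  show "\<epsilon> \<star> e0 \<noteq> 0"
  proof
    assume "\<epsilon> \<star> e0 = 0"
    then have "1 *s (\<epsilon> \<star> e0) + 0 *s (\<epsilon> \<star> e1) = 0" by simp
    from ind[OF this] show False by simp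
  qed
  show n: "a *s (\<epsilon> \<star> e0) + \<epsilon> \<star> e1 \<noteq> 0" for a
  proof
    assume "a *s (\<epsilon> \<star> e0) + \<epsilon> \<star> e1 = 0"
    then have "a *s (\<epsilon> \<star> e0) + 1 *s (\<epsilon> \<star> e1) = 0" by simp
    from ind[OF this] show False by simp
  qed
  show "\<epsilon> \<star> e1 \<noteq> 0" using n[of 0] by simp
qed

text \<open>
  Acts as \<open>(t - \<epsilon>)(\<theta> - y)\<close>, the complement of \<open>(t - \<epsilon>)y\<close> on the branch \<open>\<epsilon> = 0\<close>.
\<close>

definition op_rest :: "'k poly \<Rightarrow> ('k poly, 'r) endo" where
  "op_rest \<theta> = scal (tt * \<theta>) - scal \<theta> * eps_op - op_at_0 \<theta>"

lemma at0_op_rest: "emap at0 (op_rest \<theta>) \<star> e0 = - (at0 \<theta> *s (\<epsilon> \<star> e0)) + \<epsilon> \<star> e1"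
  by (simp add: op_rest_def emap_simps is_hom_eval0 app_simps at0_eps_op at0_op_at_0)

context
  fixes G H :: "nat \<Rightarrow> 'k poly" and \<theta> :: "'k poly"
  assumes c: "\<And>i. tt * G (i + 2) - H (i + 2) = \<theta> * (tt * G (i + 1) - H (i + 1))"
    and target: "\<And>i j. i \<le> d \<Longrightarrow> j \<le> d \<Longrightarrow> at0 (weight G H i j) = target i j"
    and \<theta>: "\<theta> \<noteq> 0"
begin

interpretation func: functional "\<lambda>c. K c" "wfun (weight G H)"
  by (rule functional_wfun)

lemma F0: "ctr v (fmapc at0 (dform (wfun (weight G H)) \<sigma> d)) = ctr (1 \<star> v) f"
  by (simp add: specialization[OF target])

lemma acts_rest: "func.acts_as \<sigma> (op_rest \<theta>) (K (tt * \<theta>) - K \<theta> * T - (K tt - T) * Y)"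
  unfolding op_rest_def
  by (intro func.acts_as_diff func.acts_as_mult func.acts_as_scal acts_eps acts_at_0[OF c])

lemma rest_eq: "K (tt * \<theta>) - K \<theta> * T - (K tt - T) * Y = - ((K tt - T) * (Y - K \<theta>))"
  by (simp only: left_diff_distrib right_diff_distrib is_homD(4)[OF is_hom_const2] ac_simps) simp

lemma kill_T_rest: "wfun (weight G H) (T * (K tt - T) * z) = 0"
proof -
  have e: "t * (k - t) * z = t * (t - k) * (- z)" for t k z :: "'k poly poly poly" by (simp add: algebra_simps)
  show ?thesis unfolding e[of T "K tt" z] by (rule kill_eps)
qed

lemma kill_0_rest: "wfun (weight G H) ((K tt - T) * Y * (- ((K tt - T) * (Y - K \<theta>))) * z) = 0"
proof -
  have e: "u * y * (- (u * x)) * z = u * (y * x) * (- (u * z))" for u x y z :: "'k poly poly poly"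
    by (simp add: algebra_simps)
  show ?thesis unfolding e[of "K tt - T" Y "Y - K \<theta>" z] by (rule kill_at_0[OF c])
qed

lemma less3: "p < 3 \<Longrightarrow> p = 0 \<or> p = 1 \<or> p = (2::nat)" by auto

lemma sum3: "(\<Sum>j<3. h j) = h 0 + h 1 + h (2::nat)" for h :: "nat \<Rightarrow> 'x::comm_monoid_add"
  by (simp add: eval_nat_numeral)

text \<open>
  The pieces belong to \<open>\<epsilon>\<close>, \<open>(t - \<epsilon>)y\<close> and \<open>(t - \<epsilon>)(\<theta> - y)\<close>, whose products vanish and which satisfy
  \<open>\<theta>\<epsilon> + (t - \<epsilon>)y + (t - \<epsilon>)(\<theta> - y) = t\<theta>\<close>.
\<close>

lemma three_pieces: "deforms_into d f 1 3"
proof -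
  define E where "E p = (if p = 0 then eps_op else if p = 1 then op_at_0 \<theta> else op_rest \<theta>)" for p :: nat
  define m where "m p = (if p = 0 then T else if p = 1 then (K tt - T) * Y else - ((K tt - T) * (Y - K \<theta>)))" for p :: nat
  define r where "r p = (if p = 0 then \<theta> else 1)" for p :: nat
  have orth: "wfun (weight G H) (m p * m p' * z) = 0" if "p < p'" "p' < 3" for p p' z
  proof -
    have "wfun (weight G H) (T * ((K tt - T) * Y) * z) = 0"
      using kill_T_rest[of "Y * z"] by (simp only: mult.assoc)
    moreover have "wfun (weight G H) (T * (- ((K tt - T) * (Y - K \<theta>))) * z) = 0"
      using kill_T_rest[of "- ((Y - K \<theta>) * z)"] by (simp only: mult.assoc mult_minus_left mult_minus_right)
    moreover have "p = 0 \<and> p' = 1 \<or> p = 0 \<and> p' = 2 \<or> p = 1 \<and> p' = 2" using that by auto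
    ultimately show ?thesis using kill_0_rest[of z] unfolding m_def by (elim disjE conjE) (simp_all only: if_True if_False, simp_all)
  qed
  have "splitting_family d f 1 3 (dform (wfun (weight G H)) \<sigma> d) E r (tt * \<theta>)"
  proof (rule splitting_family_dform[where m = m])
    show "functional (\<lambda>c. K c) (wfun (weight G H))" by (rule functional_wfun)
    show "d \<ge> 2" using d by simp
    show "func.acts_as \<sigma> (E p) (m p)" if "p < 3" for p
      using acts_eps[of G H] acts_at_0[OF c] acts_rest[unfolded rest_eq] less3[OF that]
      unfolding E_def m_def by (elim disjE) (simp_all only: if_True if_False, simp_all)
    show "wfun (weight G H) (m p * m p' * z) = 0" if "p < 3" "p' < 3" "p \<noteq> p'" for p p' z
    proof (cases "p < p'")
      case True then show ?thesis using orth that by blast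
    next
      case False
      then show ?thesis using orth[of p' p z] that by (simp only: mult.commute[of "m p"])
    qed
    show "(\<Sum>p<3. K (r p) * m p) = K (tt * \<theta>)"
    proof -
      have "(\<Sum>p<3. K (r p) * m p) = K \<theta> * T + (K tt - T) * Y + (- ((K tt - T) * (Y - K \<theta>)))"
      proof -
        have "m 0 = T" "m 1 = (K tt - T) * Y" "m 2 = - ((K tt - T) * (Y - K \<theta>))" "r 0 = \<theta>" "r 1 = 1" "r 2 = 1"
          unfolding m_def r_def by simp_all
        then show ?thesis unfolding sum3 by (simp only: is_homD(2)[OF is_hom_const2] mult_1_left)
      qed
      also have "\<dots> = K tt * K \<theta>" by (simp only: left_diff_distrib right_diff_distrib ac_simps) simp
      finally show ?thesis by (simp only: is_homD(4)[OF is_hom_const2])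
    qed
    show "tt * \<theta> \<noteq> 0" using \<theta> by simp
    show "emap at0 (E p) \<noteq> 0" if "p < 3" for p
    proof
      assume "emap at0 (E p) = 0"
      then have z: "emap at0 (E p) \<star> e0 = 0" by simp
      show False using less3[OF that]
      proof (elim disjE)
        assume "p = 0" then show False using z at0_eps_op frame_nonzero(1) by (simp add: E_def)
      next
        assume "p = 1" then show False using z at0_op_at_0 frame_nonzero(2) by (simp add: E_def)
      next
        assume "p = 2" then show False using z at0_op_rest frame_nonzero(3)[of "- at0 \<theta>"] by (simp add: E_def)
      qed
    qed
    show "emap const 1 * E p = E p" for p by (simp add: emap_1[OF is_hom_const_poly])
    show "func.vect \<sigma> (emap const 1 \<star> v) = func.vect \<sigma> v" for v by (simp add: emap_1[OF is_hom_const_poly])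
  qed (rule F0)
  then show ?thesis unfolding deforms_into_def by blast
qed

text \<open>
  With a second relation \<open>y(y - \<theta>') = 0\<close> on the branch \<open>\<epsilon> = t\<close>, the piece of \<open>\<epsilon>\<close> is divided further into those of
  \<open>\<epsilon>y\<close> and \<open>\<epsilon>(\<theta>' - y)\<close>.
\<close>

lemma four_pieces:
  assumes c': "\<And>i. H (i + 2) = \<theta>' * H (i + 1)" and \<theta>': "\<theta>' \<noteq> 0" "at0 \<theta>' = 0"
  shows "deforms_into d f 1 4"
proof -
  define E where "E p = (if p = 0 then op_at_t \<theta>' else if p = 1 then scal \<theta>' * eps_op - op_at_t \<theta>'
    else if p = 2 then op_at_0 \<theta> else op_rest \<theta>)" for p :: nat
  define m where "m p = (if p = 0 then T * Y else if p = 1 then K \<theta>' * T - T * Y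
    else if p = 2 then (K tt - T) * Y else - ((K tt - T) * (Y - K \<theta>)))" for p :: nat
  define r where "r p = (if p = 0 then \<theta> else if p = 1 then \<theta> else \<theta>')" for p :: nat
  have a1: "func.acts_as \<sigma> (scal \<theta>' * eps_op - op_at_t \<theta>') (K \<theta>' * T - T * Y)"
    by (intro func.acts_as_diff func.acts_as_mult func.acts_as_scal acts_eps acts_at_t[OF c'])
  have orth: "wfun (weight G H) (m p * m p' * z) = 0" if "p < p'" "p' < 4" for p p' z
  proof -
    have "wfun (weight G H) (T * Y * (K \<theta>' * T - T * Y) * z) = 0"
    proof -
      have "wfun (weight G H) (T * (Y * (Y - K \<theta>')) * (- (T * z))) = 0" by (rule kill_at_t[OF c'])
      moreover have "T * (Y * (Y - K \<theta>')) * (- (T * z)) = T * Y * (K \<theta>' * T - T * Y) * z"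
        by (simp only: left_diff_distrib right_diff_distrib mult_minus_right ac_simps) simp
      ultimately show ?thesis by simp
    qed
    moreover have tr: "wfun (weight G H) (T * x * ((K tt - T) * x') * z) = 0" for x x'
    proof -
      have "T * x * ((K tt - T) * x') * z = T * (K tt - T) * (x * x' * z)" by (simp only: ac_simps)
      then show ?thesis by (simp only: kill_T_rest)
    qed
    have m1: "K \<theta>' * T - T * Y = T * (K \<theta>' - Y)" by (simp only: right_diff_distrib mult.commute)
    have m3: "- ((K tt - T) * (Y - K \<theta>)) = (K tt - T) * (- (Y - K \<theta>))" by (simp only: mult_minus_right)
    have "wfun (weight G H) (T * Y * ((K tt - T) * Y) * z) = 0" by (rule tr)
    moreover have "wfun (weight G H) (T * Y * (- ((K tt - T) * (Y - K \<theta>))) * z) = 0" unfolding m3 by (rule tr)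
    moreover have "wfun (weight G H) ((K \<theta>' * T - T * Y) * ((K tt - T) * Y) * z) = 0" unfolding m1 by (rule tr)
    moreover have "wfun (weight G H) ((K \<theta>' * T - T * Y) * (- ((K tt - T) * (Y - K \<theta>))) * z) = 0" unfolding m1 m3 by (rule tr)
    moreover have "p = 0 \<and> p' = 1 \<or> p = 0 \<and> p' = 2 \<or> p = 0 \<and> p' = 3 \<or> p = 1 \<and> p' = 2 \<or> p = 1 \<and> p' = 3 \<or> p = 2 \<and> p' = 3"
      using that by auto
    ultimately show ?thesis using kill_0_rest[of z] unfolding m_def
      by (elim disjE conjE) (simp_all only: if_True if_False, simp_all)
  qed
  have "splitting_family d f 1 4 (dform (wfun (weight G H)) \<sigma> d) E r (tt * \<theta> * \<theta>')"
  proof (rule splitting_family_dform[where m = m])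
    show "functional (\<lambda>c. K c) (wfun (weight G H))" by (rule functional_wfun)
    show "d \<ge> 2" using d by simp
    show "func.acts_as \<sigma> (E p) (m p)" if "p < 4" for p
      using a1 acts_at_t[OF c', of G] acts_at_0[OF c] acts_rest[unfolded rest_eq] less4[OF that]
      unfolding E_def m_def by (elim disjE) (simp_all only: if_True if_False, simp_all)
    show "wfun (weight G H) (m p * m p' * z) = 0" if "p < 4" "p' < 4" "p \<noteq> p'" for p p' z
    proof (cases "p < p'")
      case True then show ?thesis using orth that by blast
    next
      case False
      then show ?thesis using orth[of p' p z] that by (simp only: mult.commute[of "m p"])
    qed
    show "(\<Sum>p<4. K (r p) * m p) = K (tt * \<theta> * \<theta>')"
    proof -
      have "(\<Sum>p<4. K (r p) * m p) = K \<theta> * (T * Y) + K \<theta> * (K \<theta>' * T - T * Y) + K \<theta>' * ((K tt - T) * Y)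
          + K \<theta>' * (- ((K tt - T) * (Y - K \<theta>)))"
      proof -
        have "m 0 = T * Y" "m 1 = K \<theta>' * T - T * Y" "m 2 = (K tt - T) * Y" "m 3 = - ((K tt - T) * (Y - K \<theta>))"
          "r 0 = \<theta>" "r 1 = \<theta>" "r 2 = \<theta>'" "r 3 = \<theta>'"
          unfolding m_def r_def by simp_all
        then show ?thesis unfolding sum4 by (simp only:)
      qed
      also have "\<dots> = K tt * K \<theta> * K \<theta>'" by (simp only: left_diff_distrib right_diff_distrib mult_minus_right ac_simps) simp
      finally show ?thesis by (simp only: is_homD(4)[OF is_hom_const2])
    qed
    show "tt * \<theta> * \<theta>' \<noteq> 0" using \<theta> \<theta>' by simp
    show "emap at0 (E p) \<noteq> 0" if "p < 4" for p
    proof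
      assume "emap at0 (E p) = 0"
      then have z: "emap at0 (E p) \<star> e0 = 0" by simp
      have o1: "emap at0 (scal \<theta>' * eps_op - op_at_t \<theta>') \<star> e0 = - (\<epsilon> \<star> e1)"
        by (simp add: emap_simps is_hom_eval0 app_simps at0_op_at_t \<theta>')
      show False using less4[OF that]
      proof (elim disjE)
        assume "p = 0" then show False using z at0_op_at_t frame_nonzero(2) by (simp add: E_def)
      next
        assume "p = 1" then show False using z o1 frame_nonzero(2) by (simp add: E_def)
      next
        assume "p = 2" then show False using z at0_op_at_0 frame_nonzero(2) by (simp add: E_def)
      next
        assume "p = 3" then show False using z at0_op_rest frame_nonzero(3)[of "- at0 \<theta>"] by (simp add: E_def)
      qed
    qed
    show "emap const 1 * E p = E p" for p by (simp add: emap_1[OF is_hom_const_poly])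
    show "func.vect \<sigma> (emap const 1 \<star> v) = func.vect \<sigma> v" for v by (simp add: emap_1[OF is_hom_const_poly])
  qed (rule F0)
  then show ?thesis unfolding deforms_into_def by blast
qed

end

text \<open>
  On the branch \<open>\<epsilon> = 0\<close> the functional is \<open>-\<gamma>\<close>, where \<open>\<gamma>\<close> deforms the geometric sequence
  \<open>p0, q0, \<rho>q0, \<rho>\<^sup>2q0, \<dots>\<close> by changing the ratio to \<open>\<theta> = \<rho> + t\<close>; the summand \<open>t\<close> makes the ratio
  nonzero even if \<open>\<rho> = 0\<close>. The remaining values \<open>val\<close> stay constant.
\<close>

theorem frame_three: "deforms_into d f 1 3"
proof (rule three_pieces)
  let ?\<theta> = "[:\<rho>, 1:]"
  define \<gamma> where "\<gamma> i = (if i = 0 then [:p0:] else ?\<theta> ^ (i - 1) * [:q0:])" for i :: nat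
  define G where "G i = [:val i:]" for i
  define H where "H i = \<gamma> i + tt * G i" for i
  have "tt * G i - H i = - \<gamma> i" for i by (simp only: H_def) simp
  moreover have "\<gamma> (i + 2) = ?\<theta> * \<gamma> (i + 1)" for i by (simp only: \<gamma>_def) simp
  ultimately show "tt * G (i + 2) - H (i + 2) = ?\<theta> * (tt * G (i + 1) - H (i + 1))" for i
    by (simp only: mult_minus_right)
  show "at0 (weight G H i j) = target i j" if "i \<le> d" "j \<le> d" for i j
  proof -
    consider "j = 0" | "j = 1" | j' where "j = Suc (Suc j')" by (metis One_nat_def not0_implies_Suc)
    then show ?thesis
    proof cases
      case 1 then show ?thesis by (simp add: weight_simps target_def G_def)
    next
      case 2 then show ?thesis by (simp add: weight_simps target_def H_def \<gamma>_def)
    next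
      case 3 then show ?thesis by (simp add: weight_simps target_def)
    qed
  qed
  show "?\<theta> \<noteq> 0" by simp
qed

text \<open>
  With \<open>H\<close> geometric of ratio \<open>\<theta>'\<close>, the sequence \<open>t G - H\<close> is geometric of ratio \<open>\<theta>\<close> as soon as \<open>G\<close> satisfies
  \<open>t G\<^sub>i\<^sub>+\<^sub>2 = \<theta> t G\<^sub>i\<^sub>+\<^sub>1 + (\<theta>' - \<theta>) H\<^sub>i\<^sub>+\<^sub>1\<close>. For this to be solvable over \<open>K[t]\<close> the difference \<open>\<theta>' - \<theta>\<close>
  has to be divisible by \<open>t\<close>; the choice \<open>\<theta>' - \<theta> = a t\<close> makes \<open>G\<^sub>2\<close> equal to \<open>a H\<^sub>1\<close> at \<open>t = 0\<close>, the given value.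
  Taking \<open>\<theta> = t\<^sup>2\<close> keeps \<open>\<theta>'\<close> nonzero for every \<open>a\<close>.
\<close>

theorem frame_four:
  assumes \<rho>: "\<rho> = 0" and v2: "val 2 = a * q0" and v3: "\<And>i. i \<ge> 3 \<Longrightarrow> i \<le> d \<Longrightarrow> val i = 0"
  shows "deforms_into d f 1 4"
proof -
  let ?\<theta> = "monom (1::'k) 2" and ?\<theta>' = "monom (1::'k) 2 + tt * [:a:]"
  define H where "H i = (if i = 0 then [:p0:] else ?\<theta>' ^ (i - 1) * [:q0:])" for i :: nat
  define G where "G = rec_nat [:val 0:] (\<lambda>i g. if i = 0 then [:val 1:] else ?\<theta> * g + [:a:] * H i)"
  have G: "G 0 = [:val 0:]" "G (Suc 0) = [:val 1:]" "G (Suc (Suc i)) = ?\<theta> * G (Suc i) + [:a:] * H (Suc i)" for i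
    by (simp_all add: G_def)
  have H: "H (i + 2) = ?\<theta>' * H (i + 1)" for i by (simp add: H_def)
  show ?thesis
  proof (rule four_pieces[of G H ?\<theta> ?\<theta>'])
    show "tt * G (i + 2) - H (i + 2) = ?\<theta> * (tt * G (i + 1) - H (i + 1))" for i
      unfolding H using G(3)[of i] by (simp add: algebra_simps del: mult_pCons_left mult_pCons_right)
    show "H (i + 2) = ?\<theta>' * H (i + 1)" for i by (rule H)
    have \<theta>0: "at0 ?\<theta> = 0" "at0 ?\<theta>' = 0" by (simp_all add: poly_monom)
    have aH: "at0 (H 0) = p0" "at0 (H (Suc 0)) = q0" "at0 (H (Suc (Suc i))) = 0" for i
      using \<theta>0 by (simp_all add: H_def)
    have aG: "at0 (G 2) = a * q0" "at0 (G (Suc (Suc (Suc i)))) = 0" for i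
    proof -
      have "G 2 = G (Suc (Suc 0))" by (simp only: numeral_2_eq_2)
      then show "at0 (G 2) = a * q0" by (simp add: G(3) \<theta>0 aH)
      show "at0 (G (Suc (Suc (Suc i)))) = 0" by (simp add: G(3) \<theta>0 aH)
    qed
    show "at0 (weight G H i j) = target i j" if "i \<le> d" "j \<le> d" for i j
    proof -
      consider "j = 0" | "j = 1" | j' where "j = Suc (Suc j')" by (metis One_nat_def not0_implies_Suc)
      then show ?thesis
      proof cases
        case 1
        consider "i = 0" | "i = 1" | "i = 2" | i' where "i = Suc (Suc (Suc i'))"
          by (metis One_nat_def Suc_1 not0_implies_Suc)
        then show ?thesis
        proof cases
          case 4
          then have "val i = 0" using v3[of i] that by simp
          then show ?thesis using 4 1 by (simp add: weight_simps target_def aG)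
        qed (use 1 in \<open>simp_all add: weight_simps target_def G aG(1) v2\<close>)
      next
        case 2
        consider "i = 0" | "i = 1" | i' where "i = Suc (Suc i')" by (metis One_nat_def not0_implies_Suc)
        then show ?thesis using 2 unfolding target_def by cases (simp_all add: weight_simps aH \<rho>)
      next
        case 3 then show ?thesis by (simp add: weight_simps target_def)
      qed
    qed
    show "?\<theta> \<noteq> 0" by (simp add: monom_eq_0_iff)
    show "?\<theta>' \<noteq> 0"
    proof
      assume "?\<theta>' = 0"
      then have "coeff ?\<theta>' 2 = 0" by simp
      then show False by (simp add: eval_nat_numeral coeff_pCons)
    qed
    show "at0 ?\<theta>' = 0" by (rule \<theta>0)
  qed
qed

end

section \<open>The exceptional case of four variables\<close>

context nondegenerate_form
begin

lemma spanned_oneI: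
  assumes "\<And>z. z \<in> Z \<Longrightarrow> \<exists>c. z = (\<Sum>i<n. scal (c i) * g i)"
  shows "spanned 1 n"
  unfolding spanned_def by (intro exI[of _ g]) (use assms in auto)

end

context frame
begin

lemma image_unscale:
  assumes "a *s v = \<epsilon> \<star> w'" "a \<noteq> 0" shows "\<exists>w. v = \<epsilon> \<star> w"
proof -
  have "v = (1 / a) *s (a *s v)" using assms(2) by simp
  also have "\<dots> = \<epsilon> \<star> ((1 / a) *s w')" by (simp only: assms(1) app_vscale)
  finally show ?thesis by blast
qed

lemma image_stable: "z \<in> Z \<Longrightarrow> z \<star> \<epsilon> \<star> v = \<epsilon> \<star> z \<star> v"
  by (rule app_commute[OF _ \<epsilon>(1)])

text \<open>
  Modulo the image of \<open>\<epsilon>\<close> the operator \<open>y\<close> is a nonzero nilpotent on a plane. So there is a vector \<open>b0\<close>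
  for which \<open>b0, y b0, \<epsilon> b0, \<epsilon> y b0\<close> is a basis and \<open>y\<^sup>2 b0\<close> lies in the image; the
  vanishing of \<open>y\<^sup>3\<close> leaves \<open>y\<^sup>2 b0 = a \<epsilon> y b0\<close>. Elements of \<open>Z\<close> commute with \<open>y\<close> and \<open>\<epsilon>\<close>, so they are
  determined by their value on \<open>b0\<close>.
\<close>

theorem four_pieces_outside_image:
  assumes y: "y \<in> Z" "y ^ m = 0" "y ^ 3 = 0" and out: "\<nexists>w. y \<star> v = \<epsilon> \<star> w"
  shows "spanned 1 4 \<and> deforms_into d f 1 4"
proof -
  define k where "k = (LEAST i. \<exists>w. (y ^ i) \<star> v = \<epsilon> \<star> w)"
  have ex: "\<exists>w. (y ^ m) \<star> v = \<epsilon> \<star> w" using y(2) by (intro exI[of _ 0]) simp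
  have k: "\<exists>w. (y ^ k) \<star> v = \<epsilon> \<star> w" unfolding k_def by (rule LeastI) (rule ex)
  have "k \<noteq> 1" using k out by auto
  moreover have "k \<noteq> 0"
  proof
    assume "k = 0"
    then obtain w where "v = \<epsilon> \<star> w" using k by auto
    then have "y \<star> v = \<epsilon> \<star> y \<star> w" using image_stable[OF y(1)] by simp
    then show False using out by blast
  qed
  ultimately obtain k' where k': "k = Suc (Suc k')" by (metis One_nat_def not0_implies_Suc)
  define b0 where "b0 = (y ^ k') \<star> v"
  have nr: "\<nexists>w. y \<star> b0 = \<epsilon> \<star> w"
    using not_less_Least[of "Suc k'" "\<lambda>i. \<exists>w. (y ^ i) \<star> v = \<epsilon> \<star> w"] k' by (simp add: k_def[symmetric] b0_def app_mult)
  obtain w where w: "y \<star> y \<star> b0 = \<epsilon> \<star> w" using k by (auto simp: k' b0_def app_mult)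
  have ind': "a = 0 \<and> b = 0" if ab: "a *s (\<epsilon> \<star> b0) + b *s (\<epsilon> \<star> y \<star> b0) = 0" for a b
  proof -
    have "\<epsilon> \<star> (a *s b0 + b *s (y \<star> b0)) = 0" using ab by (simp add: app_vadd app_vscale)
    then obtain u where u: "a *s b0 + b *s (y \<star> b0) = \<epsilon> \<star> u" by (rule kernel)
    then have "y \<star> (a *s b0 + b *s (y \<star> b0)) = \<epsilon> \<star> y \<star> u" using image_stable[OF y(1)] by simp
    then have "a *s (y \<star> b0) = \<epsilon> \<star> (y \<star> u - b *s w)"
      by (simp add: app_vadd app_vscale w app_vdiff algebra_simps)
    then have a: "a = 0" using image_unscale nr by blast
    then have "b *s (y \<star> b0) = \<epsilon> \<star> u" using u by simp
    then have "b = 0" using image_unscale nr by blast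
    with a show ?thesis by simp
  qed
  interpret fr: frame f d \<epsilon> b0 "y \<star> b0" by unfold_locales (use \<epsilon> card ind' in auto)
  obtain c0 c1 where c: "y \<star> y \<star> b0 = c0 *s (\<epsilon> \<star> b0) + c1 *s (\<epsilon> \<star> y \<star> b0)"
    unfolding w using fr.image[of w] by blast
  have "y \<star> y \<star> y \<star> b0 = c0 *s (\<epsilon> \<star> y \<star> b0) + c1 *s (\<epsilon> \<star> y \<star> y \<star> b0)"
    using c by (simp add: app_vadd app_vscale image_stable[OF y(1)])
  also have "\<epsilon> \<star> y \<star> y \<star> b0 = 0" by (simp add: w fr.\<epsilon>\<epsilon>)
  finally have "c0 *s (\<epsilon> \<star> y \<star> b0) = y \<star> y \<star> y \<star> b0" by simp
  also have "\<dots> = (y ^ 3) \<star> b0" by (simp add: eval_nat_numeral app_mult)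
  also have "\<dots> = 0" using y(3) by simp
  finally have "c0 = 0" using ind'[of 0 c0] by simp
  then have yy: "y \<star> y \<star> b0 = c1 *s (\<epsilon> \<star> y \<star> b0)" using c by simp
  have lin_yy: "lin (y \<star> y \<star> b0) = Poly_Mapping.single 0 c1 * lin (\<epsilon> \<star> y \<star> b0)" by (simp only: yy lin_scale)
  have pull: "pair (lin x * (Poly_Mapping.single 0 c1 * D) * X) f = c1 * pair (lin x * D * X) f" for x D X
  proof -
    have "lin x * (Poly_Mapping.single 0 c1 * D) * X = lin x * D * X * Poly_Mapping.single 0 c1" by (simp only: ac_simps)
    then show ?thesis by (simp add: pair_def contract_mult contract_const contract_fscale lookup_fscale)
  qed
  have rho: "pair (lin (\<epsilon> \<star> y \<star> b0) * lin (y \<star> b0) * X) f = 0 * pair (lin (\<epsilon> \<star> y \<star> b0) * lin b0 * X) f" for X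
  proof -
    have "pair (lin (\<epsilon> \<star> y \<star> b0) * lin (y \<star> b0) * X) f = pair (lin (\<epsilon> \<star> b0) * lin (y \<star> y \<star> b0) * X) f"
      using pair_move[OF y(1), of "\<epsilon> \<star> b0" "y \<star> b0" X] by (simp only: image_stable[OF y(1)])
    also have "\<dots> = c1 * pair (lin (\<epsilon> \<star> b0) * lin (\<epsilon> \<star> y \<star> b0) * X) f" by (simp only: lin_yy pull)
    also have "pair (lin (\<epsilon> \<star> b0) * lin (\<epsilon> \<star> y \<star> b0) * X) f = pair (lin b0 * lin (\<epsilon> \<star> \<epsilon> \<star> y \<star> b0) * X) f"
      by (rule pair_move[OF \<epsilon>(1)])
    finally show ?thesis by (simp add: fr.\<epsilon>\<epsilon>)
  qed
  interpret df: double_frame f d \<epsilon> b0 "y \<star> b0" 0 by unfold_locales (rule rho)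
  have sq: "pair (lin (y \<star> b0) * lin (y \<star> b0) * X) f = c1 * pair (lin b0 * lin (\<epsilon> \<star> y \<star> b0) * X) f" for X
    using pair_move[OF y(1), of b0 "y \<star> b0" X] by (simp only: lin_yy pull)
  have "deforms_into d f 1 4"
  proof (rule df.frame_four[of c1])
    obtain d' where d': "d = Suc (Suc d')" using d by (metis Suc_le_D numeral_3_eq_3 Suc_le_mono)
    have "lin b0 ^ (d - 2) * lin (y \<star> b0) ^ 2 = lin (y \<star> b0) * lin (y \<star> b0) * lin b0 ^ d'"
      by (simp add: d' power2_eq_square mult.commute)
    then have "df.val 2 = c1 * pair (lin b0 * lin (\<epsilon> \<star> y \<star> b0) * lin b0 ^ d') f"
      by (simp only: df.val_def sq)
    also have "lin b0 * lin (\<epsilon> \<star> y \<star> b0) * lin b0 ^ d' = lin (\<epsilon> \<star> y \<star> b0) * lin b0 ^ (d - 1)"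
      by (simp add: d' ac_simps)
    finally show "df.val 2 = c1 * df.q0" by (simp only: df.q0_def)
    fix i assume i: "3 \<le> i" "i \<le> d"
    then obtain i' where i': "i = Suc (Suc (Suc i'))" by (metis Suc_le_D numeral_3_eq_3 Suc_le_mono)
    have "lin b0 ^ (d - i) * lin (y \<star> b0) ^ i = lin (y \<star> b0) * lin (y \<star> b0) * (lin (y \<star> b0) * (lin b0 ^ (d - i) * lin (y \<star> b0) ^ i'))"
      unfolding i' power_Suc by (simp only: ac_simps)
    then have "df.val i = c1 * pair (lin b0 * lin (\<epsilon> \<star> y \<star> b0) * (lin (y \<star> b0) * (lin b0 ^ (d - i) * lin (y \<star> b0) ^ i'))) f"
      by (simp only: df.val_def sq)
    also have "lin b0 * lin (\<epsilon> \<star> y \<star> b0) * (lin (y \<star> b0) * (lin b0 ^ (d - i) * lin (y \<star> b0) ^ i')) =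
      lin (\<epsilon> \<star> y \<star> b0) * lin (y \<star> b0) * (lin b0 * (lin b0 ^ (d - i) * lin (y \<star> b0) ^ i'))"
      by (simp only: ac_simps)
    finally show "df.val i = 0" by (simp only: rho) simp
  qed simp
  moreover have "spanned 1 4"
  proof (rule spanned_oneI)
    fix z assume z: "z \<in> Z"
    define g where "g j = (if j = 0 then 1 else if j = 1 then y else if j = 2 then \<epsilon> else \<epsilon> * y)" for j :: nat
    have gZ: "g j \<in> Z" for j using Z_one y(1) \<epsilon>(1) Z_mult by (simp add: g_def)
    have gb: "g j \<star> b0 = fr.b j" for j by (simp add: g_def fr.b_def app_mult)
    define x where "x = z - (\<Sum>j<4. scal (fr.coord j (z \<star> b0)) * g j)"
    have xZ: "x \<in> Z" unfolding x_def by (intro Z_diff z Z_sum Z_mult Z_scal gZ)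
    have x0: "x \<star> b0 = 0"
      using fr.expand[of "z \<star> b0"] by (simp add: x_def app_diff app_sum app_mult app_scal gb)
    have "x = 0"
      by (rule fr.frame_eqI) (simp_all add: app_commute[OF xZ y(1)] app_commute[OF xZ \<epsilon>(1)] x0)
    then have "z = (\<Sum>j<4. scal (fr.coord j (z \<star> b0)) * g j)" by (simp add: x_def)
    then show "\<exists>c. z = (\<Sum>i<(4::nat). scal (c i) * (\<lambda>j. if j = 0 then 1 else if j = 1 then y else if j = 2 then \<epsilon> else \<epsilon> * y) i)"
      unfolding g_def by (rule exI[of _ "\<lambda>j. fr.coord j (z \<star> b0)"])
  qed
  ultimately show ?thesis by (rule conjI[rotated])
qed

lemma maps_into_image_kills_image:
  assumes "\<And>v. \<exists>w. y \<star> v = \<epsilon> \<star> w" "y \<in> Z"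
  shows "y \<star> \<epsilon> \<star> v = 0"
proof -
  obtain w where "y \<star> v = \<epsilon> \<star> w" using assms(1) by blast
  then show ?thesis by (simp add: image_stable[OF assms(2)] \<epsilon>\<epsilon>)
qed

text \<open>
  If all nilpotents map into the image of \<open>\<epsilon>\<close>, they also vanish on it, and they are maps from the
  plane \<open>V/\<epsilon>V\<close> to the plane \<open>\<epsilon>V\<close>. As \<open>y\<close> is not a multiple of \<open>\<epsilon>\<close>, there is a vector \<open>b0\<close> with \<open>\<epsilon> b0, y b0\<close>
  independent. Subtracting a multiple of \<open>\<epsilon>\<close>, chosen as a root of a quadratic equation, \<open>y\<close> becomes \<open>x\<close> with
  \<open>x b0 = \<epsilon> b1\<close> and \<open>x b1 = \<rho> \<epsilon> b1\<close>. Then \<open>1, \<epsilon>, x\<close> span \<open>Z\<close>: a nilpotent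
  \<open>s\<close> with \<open>s b0 = 0\<close> also kills \<open>b1\<close>, because the derivative of \<open>f\<close> along \<open>s b1\<close> vanishes in the directions \<open>b0\<close>
  and \<open>\<epsilon> v\<close>, and its second derivative along \<open>b1\<close> is, by moving \<open>x\<close>, a multiple of
  a derivative along \<open>b0\<close>.
\<close>

theorem three_pieces_inside_image:
  assumes decomp: "\<And>z. z \<in> Z \<Longrightarrow> \<exists>c y m. z = scal c + y \<and> y \<in> Z \<and> y ^ m = 0"
    and img: "\<And>y m v. y \<in> Z \<Longrightarrow> y ^ m = 0 \<Longrightarrow> \<exists>w. y \<star> v = \<epsilon> \<star> w"
    and y: "y \<in> Z" "y ^ m = 0" "\<And>c. y \<noteq> scal c * \<epsilon>"
  shows "spanned 1 3 \<and> deforms_into d f 1 3"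
proof -
  have yi: "\<exists>w. y \<star> v = \<epsilon> \<star> w" for v by (rule img[OF y(1,2)])
  have y\<epsilon>0: "y \<star> \<epsilon> \<star> v = 0" for v by (rule maps_into_image_kills_image[OF yi y(1)])
  have "\<exists>v. \<forall>a b. a *s (\<epsilon> \<star> v) + b *s (y \<star> v) = 0 \<longrightarrow> a = 0 \<and> b = 0"
  proof (rule ccontr)
    assume "\<not> ?thesis"
    then have dep: "\<exists>a b. a *s (\<epsilon> \<star> v) + b *s (y \<star> v) = 0 \<and> (a \<noteq> 0 \<or> b \<noteq> 0)" for v by blast
    have mult: "\<exists>c. y \<star> v = c *s (\<epsilon> \<star> v)" if "\<epsilon> \<star> v \<noteq> 0" for v
    proof -
      obtain a b where ab: "a *s (\<epsilon> \<star> v) + b *s (y \<star> v) = 0" "a \<noteq> 0 \<or> b \<noteq> 0" using dep by blast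
      then have "b \<noteq> 0" using that by auto
      then have "y \<star> v = (- a / b) *s (\<epsilon> \<star> v)"
        using ab(1) by (simp add: vec_eq_iff eq_divide_eq field_simps eq_neg_iff_add_eq_0)
      then show ?thesis by blast
    qed
    have nz: "\<epsilon> \<star> e0 \<noteq> 0" "\<epsilon> \<star> e1 \<noteq> 0" "\<epsilon> \<star> (e0 + e1) \<noteq> 0"
      using ind[of 1 0] ind[of 0 1] ind[of 1 1] by (auto simp: app_vadd)
    obtain c1 c2 c3 where c: "y \<star> e0 = c1 *s (\<epsilon> \<star> e0)" "y \<star> e1 = c2 *s (\<epsilon> \<star> e1)" "y \<star> (e0 + e1) = c3 *s (\<epsilon> \<star> (e0 + e1))"
      using mult[OF nz(1)] mult[OF nz(2)] mult[OF nz(3)] by blast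
    have "(c1 - c3) *s (\<epsilon> \<star> e0) + (c2 - c3) *s (\<epsilon> \<star> e1) = 0"
    proof -
      have "c1 *s (\<epsilon> \<star> e0) + c2 *s (\<epsilon> \<star> e1) = c3 *s (\<epsilon> \<star> e0) + c3 *s (\<epsilon> \<star> e1)"
        using c by (simp add: app_vadd vec.scale_right_distrib)
      then show ?thesis by (simp only: vec.scale_left_diff_distrib add_diff_add[symmetric]) simp
    qed
    then have "c1 = c3" "c2 = c3" using ind by fastforce+
    then have "y = scal c3 * \<epsilon>"
      by (intro frame_eqI) (simp_all add: c app_mult app_scal y\<epsilon>0 \<epsilon>\<epsilon>)
    with y(3) show False by blast
  qed
  then obtain b0 where i0: "\<And>a b. a *s (\<epsilon> \<star> b0) + b *s (y \<star> b0) = 0 \<Longrightarrow> a = 0 \<and> b = 0" by blast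
  obtain b1' where b1': "y \<star> b0 = \<epsilon> \<star> b1'" using yi by blast
  interpret fr: frame f d \<epsilon> b0 b1' by unfold_locales (use \<epsilon> card i0 b1' in auto)
  obtain w where w: "y \<star> b1' = \<epsilon> \<star> w" using yi by blast
  obtain \<alpha> \<beta> where ab: "y \<star> b1' = \<alpha> *s (\<epsilon> \<star> b0) + \<beta> *s (\<epsilon> \<star> b1')" unfolding w using fr.image[of w] by blast
  obtain \<mu> where "poly [:- \<alpha>, - \<beta>, 1:] \<mu> = 0" using alg_closed_imp_poly_has_root[of "[:- \<alpha>, - \<beta>, 1:]"] by auto
  then have \<mu>: "\<alpha> = \<mu> * \<mu> - \<beta> * \<mu>" by (simp add: algebra_simps)
  define x where "x = y - scal \<mu> * \<epsilon>"
  define b1 where "b1 = b1' - \<mu> *s b0"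
  define \<rho> where "\<rho> = \<beta> - 2 * \<mu>"
  have xZ: "x \<in> Z" unfolding x_def by (rule Z_diff[OF y(1) Z_mult[OF Z_scal \<epsilon>(1)]])
  have xa: "x \<star> v = y \<star> v - \<mu> *s (\<epsilon> \<star> v)" for v by (simp add: x_def app_diff app_mult app_scal)
  have x\<epsilon>: "x \<star> \<epsilon> \<star> v = 0" for v by (simp add: xa y\<epsilon>0 fr.\<epsilon>\<epsilon>)
  have xe0: "x \<star> b0 = \<epsilon> \<star> b1" by (simp add: xa b1' b1_def app_vdiff app_vscale)
  have xe1: "x \<star> b1 = \<rho> *s (\<epsilon> \<star> b1)"
    unfolding xa b1_def app_vdiff app_vscale ab b1' \<rho>_def \<mu>
    by (simp add: vec_eq_iff algebra_simps)
  have i1: "a = 0 \<and> b = 0" if "a *s (\<epsilon> \<star> b0) + b *s (\<epsilon> \<star> b1) = 0" for a b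
  proof -
    have "(a - b * \<mu>) *s (\<epsilon> \<star> b0) + b *s (y \<star> b0) = 0"
      using that by (simp add: b1_def b1' app_vdiff app_vscale vec_eq_iff algebra_simps)
    from i0[OF this] show ?thesis by simp
  qed
  have rho: "pair (lin (\<epsilon> \<star> b1) * lin b1 * X) f = \<rho> * pair (lin (\<epsilon> \<star> b1) * lin b0 * X) f" for X
  proof -
    have "pair (lin (\<epsilon> \<star> b1) * lin b1 * X) f = pair (lin b0 * lin (\<rho> *s (\<epsilon> \<star> b1)) * X) f"
      using pair_move[OF xZ, of b0 b1 X] by (simp only: xe0 xe1)
    also have "lin b0 * lin (\<rho> *s (\<epsilon> \<star> b1)) * X = lin (\<epsilon> \<star> b1) * lin b0 * X * Poly_Mapping.single 0 \<rho>"
      by (simp only: lin_scale ac_simps)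
    finally show ?thesis by (simp add: pair_def contract_mult[of _ "Poly_Mapping.single 0 \<rho>"] contract_const contract_fscale lookup_fscale)
  qed
  interpret df: double_frame f d \<epsilon> b0 b1 \<rho> by unfold_locales (use \<epsilon> card i1 rho in auto)
  have "spanned 1 3"
  proof (rule spanned_oneI)
    fix z assume z: "z \<in> Z"
    obtain c z1 m where cz: "z = scal c + z1" "z1 \<in> Z" "z1 ^ m = 0" using decomp[OF z] by blast
    obtain w where "z1 \<star> b0 = \<epsilon> \<star> w" using img[OF cz(2,3)] by blast
    then obtain a b where ab: "z1 \<star> b0 = a *s (\<epsilon> \<star> b0) + b *s (\<epsilon> \<star> b1)" using df.image[of w] by auto
    define s where "s = z1 - scal a * \<epsilon> - scal b * x"
    have sZ: "s \<in> Z" unfolding s_def by (intro Z_diff cz Z_mult Z_scal \<epsilon> xZ)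
    have sa: "s \<star> v = z1 \<star> v - a *s (\<epsilon> \<star> v) - b *s (x \<star> v)" for v by (simp add: s_def app_diff app_mult app_scal)
    have s0: "s \<star> b0 = 0" by (simp add: sa ab xe0)
    have si: "\<exists>w. s \<star> v = \<epsilon> \<star> w" for v
    proof -
      obtain w1 w2 where "z1 \<star> v = \<epsilon> \<star> w1" "y \<star> v = \<epsilon> \<star> w2" using img[OF cz(2,3)] yi by blast
      then have "s \<star> v = \<epsilon> \<star> (w1 - a *s v - b *s (w2 - \<mu> *s v))" by (simp add: sa xa app_vdiff app_vscale)
      then show ?thesis by blast
    qed
    have s\<epsilon>: "s \<star> \<epsilon> \<star> v = 0" for v by (rule maps_into_image_kills_image[OF si sZ])
    have s1: "s \<star> b1 = 0"
    proof -
      obtain w where w: "s \<star> b1 = \<epsilon> \<star> w" using si by blast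
      define g where "g = ctr (s \<star> b1) f"
      have swap: "ctr p (ctr (A \<star> q) h) = ctr q (ctr (A \<star> p) h)" if "A \<in> Z" "h = f" for A p q h
        using Z_sym[OF that(1), of q p] that(2) by (simp add: ctr_commute)
      have g0: "ctr b0 g = 0" unfolding g_def using swap[OF sZ refl, of b0 b1] s0 by simp
      have g\<epsilon>: "ctr (\<epsilon> \<star> v) g = 0" for v
      proof -
        have "ctr (\<epsilon> \<star> v) g = ctr b1 (ctr (s \<star> \<epsilon> \<star> v) f)" unfolding g_def by (rule swap[OF sZ refl])
        then show ?thesis by (simp add: s\<epsilon>)
      qed
      have expand: "v = df.coord 0 v *s b0 + df.coord 1 v *s b1 + \<epsilon> \<star> (df.coord 2 v *s b0 + df.coord 3 v *s b1)" for v
        using df.expand[of v] by (simp add: df.sum4 app_vadd app_vscale add.assoc)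
      have red: "h = 0" if "h \<in> homogeneous n" "n > 0" "ctr b0 h = 0" "ctr b1 h = 0" "\<And>v. ctr (\<epsilon> \<star> v) h = 0" for h n
      proof (rule form_zeroI[OF that(1,2)])
        fix v
        have "ctr (df.coord 0 v *s b0 + df.coord 1 v *s b1 + \<epsilon> \<star> (df.coord 2 v *s b0 + df.coord 3 v *s b1)) h = 0"
          by (simp only: ctr_vadd ctr_vscale that) simp
        then show "ctr v h = 0" using expand[of v] by simp
      qed
      have gh: "g \<in> homogeneous (d - 1)" unfolding g_def by (rule homogeneous_ctr[OF f])
      have "ctr b1 g = 0"
      proof (rule red)
        show "ctr b1 g \<in> homogeneous (d - 1 - 1)" by (rule homogeneous_ctr[OF gh])
        show "0 < d - 1 - 1" using d by simp
        show "ctr b0 (ctr b1 g) = 0" using g0 by (simp add: ctr_commute[of b0 b1])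
        show "ctr (\<epsilon> \<star> v) (ctr b1 g) = 0" for v using g\<epsilon>[of v] by (simp add: ctr_commute[of _ b1])
        have "ctr b1 g = ctr w (ctr (\<epsilon> \<star> b1) f)" unfolding g_def w by (rule swap[OF \<epsilon>(1) refl])
        also have "\<dots> = ctr b0 (ctr (x \<star> w) f)" unfolding xe0[symmetric] by (rule swap[OF xZ refl])
        finally have "ctr b1 (ctr b1 g) = ctr b0 (ctr b1 (ctr (x \<star> w) f))" by (simp only: ctr_commute[of b1 b0])
        also have "\<dots> = ctr b0 (ctr w (ctr (x \<star> b1) f))" by (simp only: swap[OF xZ refl, of b1])
        also have "\<dots> = fscale \<rho> (ctr b0 (ctr w (ctr (\<epsilon> \<star> b1) f)))" by (simp add: xe1 ctr_vscale ctr_fscale)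
        also have "ctr w (ctr (\<epsilon> \<star> b1) f) = ctr b1 g" unfolding g_def w by (rule swap[OF \<epsilon>(1) refl])
        also have "ctr b0 (ctr b1 g) = 0" using g0 by (simp add: ctr_commute[of b0 b1])
        finally show "ctr b1 (ctr b1 g) = 0" by simp
      qed
      then have "g = 0" using red[OF gh _ g0 _ g\<epsilon>] d by simp
      then show ?thesis unfolding g_def by (rule ctr_eq_0D)
    qed
    have "s = 0" by (rule df.frame_eqI) (simp_all add: s0 s1 s\<epsilon>)
    then have "z = scal c * 1 + scal a * \<epsilon> + scal b * x" using cz(1) by (simp add: s_def algebra_simps)
    then have "z = (\<Sum>i<(3::nat). scal (if i = 0 then c else if i = 1 then a else b) * (if i = 0 then 1 else if i = 1 then \<epsilon> else x))"
      by (simp add: eval_nat_numeral)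
    then show "\<exists>c. z = (\<Sum>i<(3::nat). scal (c i) * (if i = 0 then 1 else if i = 1 then \<epsilon> else x))"
      by (intro exI[of _ "\<lambda>i. if i = 0 then c else if i = 1 then a else b"])
  qed
  then show ?thesis using df.frame_three by blast
qed

end

context nondegenerate_form
begin

text \<open>
  The four vectors of the frame span \<open>V\<close> and lie in \<open>eV\<close>, so that \<open>e = 1\<close>. If some nilpotent does not map into the
  image of \<open>\<epsilon>\<close>, there are four pieces; otherwise \<open>Z\<close> is spanned by \<open>1\<close> and \<open>\<epsilon>\<close>, and \<open>\<epsilon>\<close> itself yields two pieces, or there are three.
\<close>

theorem special_case:
  assumes card: "CARD('r) \<le> 4" and e: "primitive e" and sp: "special e \<epsilon>"
    and cube: "\<And>y m. y \<in> Z \<Longrightarrow> e * y = y \<Longrightarrow> y ^ m = 0 \<Longrightarrow> y ^ 3 = 0"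
  shows "\<exists>n. spanned e n \<and> deforms_into d f e n"
proof -
  have eZ: "e \<in> Z" "e * e = e" "e \<noteq> 0" using e by (auto simp: primitive_def)
  have \<epsilon>: "\<epsilon> \<in> Z" "\<epsilon> * \<epsilon> = 0" "e * \<epsilon> = \<epsilon>" using sp by (auto simp: special_def)
  obtain u1 u2 where ind: "\<And>a b. a *s (\<epsilon> \<star> u1) + b *s (\<epsilon> \<star> u2) = 0 \<Longrightarrow> a = 0 \<and> b = 0"
    using sp unfolding special_def by blast
  have \<epsilon>e: "\<epsilon> \<star> e \<star> v = \<epsilon> \<star> v" for v
    using app_commute[OF \<epsilon>(1) eZ(1), of v] \<epsilon>(3) by (simp only: app_mult[symmetric])
  have e\<epsilon>: "e * \<epsilon> = \<epsilon>" by (rule \<epsilon>(3))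
  have "e = 1"
  proof -
    interpret frame f d \<epsilon> "e \<star> u1" "e \<star> u2" by unfold_locales (use \<epsilon> card ind in \<open>auto simp: \<epsilon>e\<close>)
    have "e \<star> e \<star> v = e \<star> v" "e \<star> \<epsilon> \<star> v = \<epsilon> \<star> v" for v
      by (simp_all only: app_mult[symmetric] eZ(2) e\<epsilon>)
    then show ?thesis by (intro frame_eqI) simp_all
  qed
  have decomp: "\<exists>c y m. z = scal c + y \<and> y \<in> Z \<and> y ^ m = 0" if z: "z \<in> Z" for z
  proof -
    have "e * z = z" by (simp add: \<open>e = 1\<close>)
    then obtain c y m where "z = scal c * e + y" "y \<in> Z" "y ^ m = 0" by (rule primitive_decompose[OF e z])
    then show ?thesis using \<open>e = 1\<close> by auto
  qed
  have cube1: "y ^ 3 = 0" if "y \<in> Z" "y ^ m = 0" for y m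
    using cube[OF that(1) _ that(2)] \<open>e = 1\<close> by simp
  interpret u: frame f d \<epsilon> u1 u2 by unfold_locales (use \<epsilon> card ind in auto)
  show ?thesis unfolding \<open>e = 1\<close>
  proof (cases "\<exists>y\<in>Z. \<exists>m v. y ^ m = 0 \<and> (\<nexists>w. y \<star> v = \<epsilon> \<star> w)")
    case True
    then obtain y m v where y: "y \<in> Z" "y ^ m = 0" "\<nexists>w. y \<star> v = \<epsilon> \<star> w" by blast
    have "spanned 1 4 \<and> deforms_into d f 1 4"
      by (rule u.four_pieces_outside_image[OF y(1,2) cube1[OF y(1,2)] y(3)])
    then show "\<exists>n. spanned 1 n \<and> deforms_into d f 1 n" by blast
  next
    case False
    then have img: "\<exists>w. y \<star> v = \<epsilon> \<star> w" if "y \<in> Z" "y ^ m = 0" for y m v using that by blast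
    show "\<exists>n. spanned 1 n \<and> deforms_into d f 1 n"
    proof (cases "\<forall>y\<in>Z. \<forall>m. y ^ m = 0 \<longrightarrow> (\<exists>c. y = scal c * \<epsilon>)")
      case True
      have "spanned 1 2"
      proof (rule spanned_oneI)
        fix z assume z: "z \<in> Z"
        obtain c y m where cy: "z = scal c + y" "y \<in> Z" "y ^ m = 0" using decomp[OF z] by blast
        then obtain a where "y = scal a * \<epsilon>" using True by blast
        then have "z = (\<Sum>i<(2::nat). scal ((\<lambda>i. if i = 0 then c else a) i) * (if i = 0 then 1 else \<epsilon>))"
          using cy(1) by (simp add: numeral_2_eq_2)
        then show "\<exists>c. z = (\<Sum>i<(2::nat). scal (c i) * (if i = 0 then 1 else \<epsilon>))"
          by (intro exI[of _ "\<lambda>i. if i = 0 then c else a"])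
      qed
      moreover have "\<epsilon> \<noteq> 0" using ind[of 1 0] by auto
      then have "deforms_into d f 1 2"
        using deforms_into_power[OF Z_one _ \<epsilon>(1), of 2] \<epsilon>(2) by (simp add: power2_eq_square)
      ultimately show ?thesis by blast
    next
      case False
      then obtain y m where y: "y \<in> Z" "y ^ m = 0" "\<And>c. y \<noteq> scal c * \<epsilon>" by blast
      have "spanned 1 3 \<and> deforms_into d f 1 3" by (rule u.three_pieces_inside_image[OF decomp img y])
      then show ?thesis by blast
    qed
  qed
qed

end

section \<open>From the matrix algebra to self-adjoint operators\<close>

lemma contract_diff_left: "contract (D - E) f = contract D f - contract E f"
  using contract_add_left[of "D - E" E f] by (simp add: algebra_simps)

lemma self_adjointI_axis:
  assumes "\<And>i j. ctr (A \<star> axis i 1) (ctr (axis j 1) f) = ctr (axis i 1) (ctr (A \<star> axis j 1) f)"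
  shows "self_adjoint A f"
  unfolding self_adjoint_def
proof (intro allI)
  fix v w
  have e: "A \<star> v = (\<Sum>i\<in>UNIV. v $ i *s (A \<star> axis i 1))" for v
    by (subst vec_expand[of v]) (simp only: app_vsum app_vscale)
  have "ctr (A \<star> v) (ctr w f) = (\<Sum>i\<in>UNIV. fscale (v $ i) (\<Sum>j\<in>UNIV. fscale (w $ j) (ctr (A \<star> axis i 1) (ctr (axis j 1) f))))"
  proof -
    have "ctr (A \<star> v) (ctr w f) = (\<Sum>j\<in>UNIV. \<Sum>i\<in>UNIV. fscale (w $ j * v $ i) (ctr (A \<star> axis i 1) (ctr (axis j 1) f)))"
      unfolding e[of v] ctr_expand[of w f] by (simp only: ctr_vsum ctr_vscale ctr_sum ctr_fscale fscale_sum fscale_fscale)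
    also have "\<dots> = (\<Sum>i\<in>UNIV. \<Sum>j\<in>UNIV. fscale (v $ i * w $ j) (ctr (A \<star> axis i 1) (ctr (axis j 1) f)))"
      by (subst sum.swap) (simp only: mult.commute)
    finally show ?thesis by (simp only: fscale_sum fscale_fscale)
  qed
  also have "\<dots> = (\<Sum>i\<in>UNIV. fscale (v $ i) (\<Sum>j\<in>UNIV. fscale (w $ j) (ctr (axis i 1) (ctr (A \<star> axis j 1) f))))"
    by (simp only: assms)
  also have "\<dots> = ctr v (ctr (A \<star> w) f)"
    unfolding e[of w] ctr_expand[of v] by (simp only: ctr_vsum ctr_vscale ctr_sum ctr_fscale)
  finally show "ctr (A \<star> v) (ctr w f) = ctr v (ctr (A \<star> w) f)" .
qed

text \<open>
  The entries of \<open>A\<partial>\<close> are the derivatives in the directions \<open>A\<^sup>T e\<^sub>i\<close>, so that the minors are the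
  differences of the two sides of self-adjointness on basis vectors.
\<close>

lemma M_alg_self_adjoint:
  fixes f :: "('k::field, 'r::finite) dpower"
  assumes "A \<in> M_alg f"
  shows "self_adjoint (endo_of (transpose A)) f"
proof (rule self_adjointI_axis)
  fix i j
  let ?z = "endo_of (transpose A)"
  have z: "(?z \<star> axis l 1) $ m = A $ l $ m" for l m
    by (simp add: app_nth endo_of_inverse transpose_def axis_def if_distrib cong: if_cong)
  have w: "(const_matrix A *v del) $ l = lin (?z \<star> axis l 1)" for l
    by (simp add: matrix_vector_mult_def const_matrix_def del_def lin_def z mult_single)
  have d: "del $ l = lin (axis l 1)" for l
    by (simp add: del_def lin_axis)
  let ?u = "del :: ('k, 'r) diffop ^ 'r" and ?v = "const_matrix A *v del"
  interpret module "(*) :: ('k, 'r) diffop \<Rightarrow> _" by unfold_locales (simp_all add: algebra_simps)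
  have "?u $ i * ?v $ j - ?v $ i * ?u $ j \<in> I2 ?u ?v"
    unfolding I2_def ideal_generated_def by (rule span_base) blast
  then have "contract (?u $ i * ?v $ j - ?v $ i * ?u $ j) f = 0"
    using assms by (auto simp: M_alg_def ann_def)
  then show "ctr (?z \<star> axis i 1) (ctr (axis j 1) f) = ctr (axis i 1) (ctr (?z \<star> axis j 1) f)"
    by (simp add: w d contract_diff_left contract_mult ctr_def)
qed

lemma nondegenerate_if_ann:
  fixes f :: "('k::field, 'r::finite) dpower"
  assumes "ann f \<inter> homogeneous 1 = {0}"
  shows "nondegenerate f"
  unfolding nondegenerate_def
proof (intro allI impI)
  fix v assume v: "ctr v f = 0"
  have co: "Poly_Mapping.lookup (lin v) (Poly_Mapping.single i 1) = v $ i" for i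
  proof -
    have "Poly_Mapping.single j (1::nat) = Poly_Mapping.single i 1 \<longleftrightarrow> j = i" for j
      by (metis lookup_single_eq lookup_single_not_eq one_neq_zero)
    then show ?thesis by (simp add: lin_def lookup_sum lookup_single when_def)
  qed
  have "lin v \<in> homogeneous 1"
    unfolding lin_def by (intro homogeneous_sum) (auto simp: homogeneous_def split: if_splits)
  then have "lin v = 0" using v assms by (auto simp: ann_def ctr_def)
  then have "v $ i = 0" for i using co[of i] by simp
  then show "v = 0" by (simp add: vec_eq_iff)
qed

theorem theorem4p9:
  fixes f :: "('k::alg_closed_field, 'r::finite) dpower" and d :: nat
  assumes "CARD('r) \<le> 4"
    and "d \<ge> 3"
    and "f \<in> homogeneous d"
    and "ann f \<inter> homogeneous 1 = {0}"
  shows "\<exists>n\<ge>1. \<exists>ft :: ('k tpoly, 'r) dpower.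
           ft \<in> homogeneous_over (tpolys n) d \<and>
           specialize (\<lambda>_. 0) ft = f \<and>
           splits_regularly_over (trats n) d (matrix.dim (M_alg f) - 1) (generic_form ft)"
proof -
  have nd: "nondegenerate f" by (rule nondegenerate_if_ann[OF assms(4)])
  interpret nondegenerate_form f d by unfold_locales (use assms nd in auto)
  have "\<exists>n. spanned e n \<and> deforms_into d f e n" if "primitive e" for e
    by (rule primitive_case[OF assms(1) that]) (rule special_case[OF assms(1) that])
  then obtain n where n: "spanned 1 n" "deforms_into d f 1 n"
    using reduction_to_primitive[of 1] Z_one by (metis mult_1 one_neq_zero)
  obtain g where g: "\<And>z. z \<in> Z \<Longrightarrow> \<exists>c. z = (\<Sum>i<n. scal (c i) * g i)"
    using n(1) unfolding spanned_def by auto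
  have n1: "n \<ge> 1"
  proof (rule ccontr)
    assume "\<not> n \<ge> 1"
    then have "n = 0" by simp
    then have "(1 :: ('k, 'r) endo) = 0" using g[OF Z_one] by simp
    then show False by simp
  qed
  \<comment> \<open>The spanning operators are translated back into matrices that span \<open>M\<^sub>f\<close>.\<close>
  have scal_mat: "mat_of (scal c * B) = scale_matrix c (mat_of B)" for c and B :: "('k, 'r) endo"
  proof -
    have "mat_of C $ i $ j = (C \<star> axis j 1) $ i" for C :: "('k, 'r) endo" and i j
      by (simp add: app_nth axis_def if_distrib cong: if_cong)
    then show ?thesis by (simp add: vec_eq_iff scale_matrix_def app_mult app_scal)
  qed
  have "M_alg f \<subseteq> matrix.span ((\<lambda>i. transpose (mat_of (g i))) ` {..<n})"
  proof
    fix A assume "A \<in> M_alg f"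
    then have "endo_of (transpose A) \<in> Z" by (simp add: M_alg_self_adjoint)
    then obtain c where "endo_of (transpose A) = (\<Sum>i<n. scal (c i) * g i)" using g by blast
    then have "transpose A = mat_of (\<Sum>i<n. scal (c i) * g i)" by (metis UNIV_I endo_of_inverse)
    also have "\<dots> = (\<Sum>i<n. scale_matrix (c i) (mat_of (g i)))"
      by (induction n) (simp_all add: zero_endo.rep_eq plus_endo.rep_eq scal_mat)
    finally have "transpose (transpose A) = transpose (\<Sum>i<n. scale_matrix (c i) (mat_of (g i)))" by simp
    then have "A = (\<Sum>i<n. scale_matrix (c i) (transpose (mat_of (g i))))"
      by (simp add: vec_eq_iff transpose_def scale_matrix_def)
    also have "\<dots> \<in> matrix.span ((\<lambda>i. transpose (mat_of (g i))) ` {..<n})"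
      by (intro matrix.span_sum matrix.span_scale matrix.span_base) simp
    finally show "A \<in> matrix.span ((\<lambda>i. transpose (mat_of (g i))) ` {..<n})" .
  qed
  then have "matrix.dim (M_alg f) \<le> card ((\<lambda>i. transpose (mat_of (g i))) ` {..<n})"
    by (rule matrix.dim_le_card) simp
  also have "\<dots> \<le> n" using card_image_le[of "{..<n}" "\<lambda>i. transpose (mat_of (g i))"] by simp
  finally have "matrix.dim (M_alg f) - 1 + 1 \<le> n" using n1 by simp
  then show ?thesis
    using deforms_into_splits[OF assms(3) nd _ n(2)] assms(2) by (intro exI[of _ 1]) auto
qed

end
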